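(* Let $T>0$ and let $\Omega\subset\mathbb{R}^2$ be a bounded domain. Let the pressure $p=p(\varrho)$ be a given function of the density with $p(\varrho)>0$ for all $\varrho>0$. Let $\varrho_0\in L^\infty(\Omega;(0,\infty))$ and $b_0\in L^\infty(\Omega)$ be arbitrary piecewise constant functions. Then there exists $\mathbf{u}_0\in L^\infty(\Omega;\mathbb{R}^2)$ such that there are infinitely many energy-conserving weak solutions $(\varrho,\mathbf{u},b)$ on $[0,T)\times\Omega$ to the system \[ \begin{aligned} \partial_t \varrho + \mathrm{div}(\varrho\mathbf{u}) &=0,\\ \partial_t (\varrho\mathbf{u}) + \mathrm{div}(\varrho\mathbf{u}\otimes\mathbf{u}) + \nabla\big(p(\varrho)+\tfrac12 b^2\big) &= 0,\\ \partial_t b+\mathrm{div}(b\mathbf{u})&=0, \end{aligned} \] with initial data $\varrho_0,\mathbf{u}_0,b_0$ and impermeability boundary condition $\mathbf{u}\cdot\mathbf{n}|_{\partial\Omega}=0$. These solutions have the property that $\varrho$ and $b$ do not depend on time; in other words, $\varrho\equiv\varrho_0$ and $b\equiv b_0$.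
   Context: The system is the isentropic ideal compressible magneto-hydrodynamics system in the two-dimensional setting where the velocity is $(u,v,0)$, the magnetic field is $(0,0,b)$, and all unknowns depend only on $t$ and $\mathbf{x}=(x,y)\in\Omega$; one writes $\mathbf{u}=(u,v)$. The operators $\mathrm{div}$ and $\nabla$ are two-dimensional (in $\mathbf{x}$), and $\mathbf{n}$ is the unit normal on $\partial\Omega$. The pressure potential $P$ is given by \[ P(\varrho)=\varrho\int_1^\varrho\frac{p(r)}{r^2}\,dr . \] Piecewise constant: for the functions $\varrho_0,b_0$ on $\Omega$ this means that there are finitely many open, pairwise disjoint sets $Q_i\subset\Omega$ with $\Omega=\bigcup_i\overline{Q_i}$ (closures taken in $\Omega$) such that $\varrho_0|_{Q_i}=\varrho_i$ and $b_0|_{Q_i}=b_i$ with constants $\varrho_i>0$ and $b_i\in\mathbb{R}$. Weak solution: a triple $(\varrho,\mathbf{u},b)\in L^\infty\big([0,T)\times\Omega;(0,\infty)\times\mathbb{R}^2\times\mathbb{R}\big)$ is a weak solution to the system with initial data $(\varrho_0,\mathbf{u}_0,b_0)$ and impermeability boundary condition if for all test functions $\varphi,\psi\in C^\infty_{\rm c}([0,T)\times\mathbb{R}^2)$ and all $\boldsymbol{\varphi}\in C^\infty_{\rm c}([0,T)\times\mathbb{R}^2;\mathbb{R}^2)$ with $\boldsymbol{\varphi}\cdot\mathbf{n}|_{\partial\Omega}=0$: \[ \int_0^T\!\!\int_\Omega\big[\varrho\,\partial_t\varphi+\varrho\mathbf{u}\cdot\nabla\varphi\big]\,d\mathbf{x}\,dt+\int_\Omega\varrho_0\,\varphi(0,\cdot)\,d\mathbf{x}=0,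 \] \[ \int_0^T\!\!\int_\Omega\big[\varrho\mathbf{u}\cdot\partial_t\boldsymbol{\varphi}+(\varrho\mathbf{u}\otimes\mathbf{u}):\nabla\boldsymbol{\varphi}+\big(p(\varrho)+\tfrac12 b^2\big)\,\mathrm{div}\,\boldsymbol{\varphi}\big]\,d\mathbf{x}\,dt+\int_\Omega\varrho_0\mathbf{u}_0\cdot\boldsymbol{\varphi}(0,\cdot)\,d\mathbf{x}=0, \] \[ \int_0^T\!\!\int_\Omega\big[b\,\partial_t\psi+b\mathbf{u}\cdot\nabla\psi\big]\,d\mathbf{x}\,dt+\int_\Omega b_0\,\psi(0,\cdot)\,d\mathbf{x}=0. \] The impermeability boundary condition is represented by the choice of the test functions. Here $A:B=\sum_{i,j}A_{ij}B_{ij}$. Energy-conserving: a weak solution is called energy-conserving if in addition for all $\phi\in C^\infty_{\rm c}([0,T)\times\mathbb{R}^2)$ \[ \begin{aligned} \int_0^T\!\!\int_\Omega\Big[\big(\tfrac12\varrho|\mathbf{u}|^2+P(\varrho)+\tfrac12b^2\big)\partial_t\phi+\big(\tfrac12\varrho|\mathbf{u}|^2+P(\varrho)+p(\varrho)+b^2\big)\mathbf{u}\cdot\nabla\phi\Big]\,d\mathbf{x}\,dt&\\ +\int_\Omega\big(\tfrac12\varrho_0|\mathbf{u}_0|^2+P(\varrho_0)+\tfrac12b_0^2\big)\phi(0,\cdot)\,d\mathbf{x}&=0. \end{aligned} \]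
   Formalization: Piecewise constant additionally requires the interfaces, i.e. Ω minus the union of the Q_i, to have Lebesgue measure zero; otherwise the data there are arbitrary and p(ϱ_0) may fail to be integrable, leaving the momentum equation undefined. *)

theory Defs
  imports "HOL-Analysis.Analysis"
begin

text \<open>
  Points of space-time are pairs \<open>(t, x)\<close>.  Elements of
  \<open>L\<^sup>\<infinity>\<close> are represented by functions; every property of them below is invariant under
  changes on null sets.
\<close>

type_synonym stpoint = "real \<times> (real^2)"

definition L_infty :: "'a measure \<Rightarrow> ('a \<Rightarrow> 'b::real_normed_vector) \<Rightarrow> bool" where
  "L_infty M f \<longleftrightarrow> f \<in> borel_measurable M \<and> (\<exists>C. AE x in M. norm (f x) \<le> C)"

definition space_time :: "real \<Rightarrow> (real^2) set \<Rightarrow> stpoint set" where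
  "space_time T \<Omega> = {0..<T} \<times> \<Omega>"


subsection \<open>Test functions\<close>

text \<open>
  Derivatives are taken within \<open>S\<close>, so that on \<open>S = [0,T) \<times> \<real>\<^sup>2\<close> smoothness holds up to and
  including the initial time, with one-sided time derivatives there.
\<close>

primrec Ck_on :: "nat \<Rightarrow> 'a::real_normed_vector set \<Rightarrow> ('a \<Rightarrow> 'b::real_normed_vector) \<Rightarrow> bool" where
  "Ck_on 0 S f \<longleftrightarrow> continuous_on S f"
| "Ck_on (Suc k) S f \<longleftrightarrow>
     (\<exists>f'. (\<forall>z\<in>S. (f has_derivative f' z) (at z within S)) \<and> (\<forall>v. Ck_on k S (\<lambda>z. f' z v)))"

definition smooth_on :: "'a::real_normed_vector set \<Rightarrow> ('a \<Rightarrow> 'b::real_normed_vector) \<Rightarrow> bool" where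
  "smooth_on S f \<longleftrightarrow> (\<forall>k. Ck_on k S f)"

definition test_function :: "real \<Rightarrow> (stpoint \<Rightarrow> 'b::real_normed_vector) \<Rightarrow> bool" where
  "test_function T \<phi> \<longleftrightarrow>
     smooth_on (space_time T UNIV) \<phi> \<and>
     (\<exists>K. compact K \<and> K \<subseteq> space_time T UNIV \<and> (\<forall>z \<in> space_time T UNIV - K. \<phi> z = 0))"

text \<open>
  \<open>\<nu>\<close> is an outward unit normal at the boundary point \<open>x\<close> if a ball inside \<open>\<Omega>\<close> with centre
  \<open>x - r \<nu>\<close> touches the boundary at \<open>x\<close>.  This makes sense for every open set.  If the boundary
  is of class \<open>C\<^sup>2\<close> it is the usual outward unit normal at every boundary point.  For less regular
  boundaries the points having such a normal are still dense in the boundary; for a continuously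
  differentiable vector field on the plane and a domain with Lipschitz boundary, orthogonality to
  all these normals is equivalent to orthogonality to the classical normal wherever the latter
  exists.
\<close>

definition outward_unit_normal :: "(real^2) set \<Rightarrow> real^2 \<Rightarrow> real^2 \<Rightarrow> bool" where
  "outward_unit_normal \<Omega> x \<nu> \<longleftrightarrow>
     x \<in> frontier \<Omega> \<and> norm \<nu> = 1 \<and> (\<exists>r>0. ball (x - r *\<^sub>R \<nu>) r \<subseteq> \<Omega>)"

definition tangential_on_boundary :: "real \<Rightarrow> (real^2) set \<Rightarrow> (stpoint \<Rightarrow> real^2) \<Rightarrow> bool" where
  "tangential_on_boundary T \<Omega> \<Phi> \<longleftrightarrow>
     (\<forall>t\<in>{0..<T}. \<forall>x \<nu>. outward_unit_normal \<Omega> x \<nu> \<longrightarrow> \<Phi> (t, x) \<bullet> \<nu> = 0)"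


subsection \<open>Differential operators acting on test functions\<close>

definition time_deriv :: "real \<Rightarrow> (stpoint \<Rightarrow> 'b::real_normed_vector) \<Rightarrow> stpoint \<Rightarrow> 'b" where
  "time_deriv T f z = vector_derivative (\<lambda>s. f (s, snd z)) (at (fst z) within {0..<T})"

definition space_deriv :: "2 \<Rightarrow> (stpoint \<Rightarrow> real) \<Rightarrow> stpoint \<Rightarrow> real" where
  "space_deriv i f z = frechet_derivative (\<lambda>x. f (fst z, x)) (at (snd z)) (axis i 1)"

definition grad :: "(stpoint \<Rightarrow> real) \<Rightarrow> stpoint \<Rightarrow> real^2" where
  "grad f z = (\<chi> i. space_deriv i f z)"

definition jacobi :: "(stpoint \<Rightarrow> real^2) \<Rightarrow> stpoint \<Rightarrow> real^2^2" where
  "jacobi \<Phi> z = (\<chi> i j. space_deriv j (\<lambda>w. \<Phi> w $ i) z)"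

definition diverg :: "(stpoint \<Rightarrow> real^2) \<Rightarrow> stpoint \<Rightarrow> real" where
  "diverg \<Phi> z = (\<Sum>i\<in>UNIV. space_deriv i (\<lambda>w. \<Phi> w $ i) z)"

definition outer :: "real^2 \<Rightarrow> real^2 \<Rightarrow> real^2^2" where
  "outer v w = (\<chi> i j. v $ i * w $ j)"

definition contract :: "real^2^2 \<Rightarrow> real^2^2 \<Rightarrow> real" where
  "contract A B = (\<Sum>i\<in>UNIV. \<Sum>j\<in>UNIV. A $ i $ j * B $ i $ j)"


subsection \<open>Weak solutions\<close>

text \<open>
  Integrability is part of the balance because the Bochner integral of a non-integrable function
  is \<open>0\<close> by convention.
\<close>

definition weak_balance ::
    "real \<Rightarrow> (real^2) set \<Rightarrow> (stpoint \<Rightarrow> real) \<Rightarrow> (real^2 \<Rightarrow> real) \<Rightarrow> bool" where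
  "weak_balance T \<Omega> F G \<longleftrightarrow>
     integrable (lebesgue_on (space_time T \<Omega>)) F \<and> integrable (lebesgue_on \<Omega>) G \<and>
     integral\<^sup>L (lebesgue_on (space_time T \<Omega>)) F + integral\<^sup>L (lebesgue_on \<Omega>) G = 0"

definition weak_solution ::
    "(real \<Rightarrow> real) \<Rightarrow> real \<Rightarrow> (real^2) set \<Rightarrow>
     (real^2 \<Rightarrow> real) \<Rightarrow> (real^2 \<Rightarrow> real^2) \<Rightarrow> (real^2 \<Rightarrow> real) \<Rightarrow>
     (stpoint \<Rightarrow> real) \<Rightarrow> (stpoint \<Rightarrow> real^2) \<Rightarrow> (stpoint \<Rightarrow> real) \<Rightarrow> bool" where
  "weak_solution p T \<Omega> \<rho>0 u0 b0 \<rho> u b \<longleftrightarrow>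
     L_infty (lebesgue_on (space_time T \<Omega>)) \<rho> \<and>
     (AE z in lebesgue_on (space_time T \<Omega>). \<rho> z > 0) \<and>
     L_infty (lebesgue_on (space_time T \<Omega>)) u \<and>
     L_infty (lebesgue_on (space_time T \<Omega>)) b \<and>
     (\<forall>\<phi>::stpoint \<Rightarrow> real. test_function T \<phi> \<longrightarrow>
        weak_balance T \<Omega>
          (\<lambda>z. \<rho> z * time_deriv T \<phi> z + (\<rho> z *\<^sub>R u z) \<bullet> grad \<phi> z)
          (\<lambda>x. \<rho>0 x * \<phi> (0, x))) \<and>
     (\<forall>\<Phi>::stpoint \<Rightarrow> real^2. test_function T \<Phi> \<and> tangential_on_boundary T \<Omega> \<Phi> \<longrightarrow>
        weak_balance T \<Omega>
          (\<lambda>z. (\<rho> z *\<^sub>R u z) \<bullet> time_deriv T \<Phi> z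
             + contract (\<rho> z *\<^sub>R outer (u z) (u z)) (jacobi \<Phi> z)
             + (p (\<rho> z) + (b z)\<^sup>2 / 2) * diverg \<Phi> z)
          (\<lambda>x. (\<rho>0 x *\<^sub>R u0 x) \<bullet> \<Phi> (0, x))) \<and>
     (\<forall>\<psi>::stpoint \<Rightarrow> real. test_function T \<psi> \<longrightarrow>
        weak_balance T \<Omega>
          (\<lambda>z. b z * time_deriv T \<psi> z + (b z *\<^sub>R u z) \<bullet> grad \<psi> z)
          (\<lambda>x. b0 x * \<psi> (0, x)))"

text \<open>The interval integral is oriented, so the definition is the intended one for \<open>\<rho> < 1\<close> too.\<close>

definition pressure_potential :: "(real \<Rightarrow> real) \<Rightarrow> real \<Rightarrow> real" where
  "pressure_potential p \<rho> = \<rho> * (LINT r=ereal 1..ereal \<rho>|lebesgue. (p r / r\<^sup>2))"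

definition energy_conserving ::
    "(real \<Rightarrow> real) \<Rightarrow> real \<Rightarrow> (real^2) set \<Rightarrow>
     (real^2 \<Rightarrow> real) \<Rightarrow> (real^2 \<Rightarrow> real^2) \<Rightarrow> (real^2 \<Rightarrow> real) \<Rightarrow>
     (stpoint \<Rightarrow> real) \<Rightarrow> (stpoint \<Rightarrow> real^2) \<Rightarrow> (stpoint \<Rightarrow> real) \<Rightarrow> bool" where
  "energy_conserving p T \<Omega> \<rho>0 u0 b0 \<rho> u b \<longleftrightarrow>
     (\<forall>\<phi>::stpoint \<Rightarrow> real. test_function T \<phi> \<longrightarrow>
        weak_balance T \<Omega>
          (\<lambda>z. (\<rho> z * (norm (u z))\<^sup>2 / 2 + pressure_potential p (\<rho> z) + (b z)\<^sup>2 / 2) * time_deriv T \<phi> z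
             + (\<rho> z * (norm (u z))\<^sup>2 / 2 + pressure_potential p (\<rho> z) + p (\<rho> z) + (b z)\<^sup>2)
               * (u z \<bullet> grad \<phi> z))
          (\<lambda>x. (\<rho>0 x * (norm (u0 x))\<^sup>2 / 2 + pressure_potential p (\<rho>0 x) + (b0 x)\<^sup>2 / 2) * \<phi> (0, x)))"


subsection \<open>Piecewise constant data\<close>

text \<open>
  The interfaces \<open>\<Omega> - \<Union>Q\<^sub>i\<close> are required to be null sets, since otherwise the constants would not
  determine the data as elements of \<open>L\<^sup>\<infinity>\<close> (boundaries of open sets may have positive measure).
\<close>

definition piecewise_constant :: "(real^2) set \<Rightarrow> (real^2 \<Rightarrow> real) \<Rightarrow> (real^2 \<Rightarrow> real) \<Rightarrow> bool" where
  "piecewise_constant \<Omega> \<rho>0 b0 \<longleftrightarrow>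
     (\<exists>(n::nat) Q (\<rho>c::nat \<Rightarrow> real) (bc::nat \<Rightarrow> real).
        (\<forall>i<n. open (Q i) \<and> Q i \<subseteq> \<Omega>) \<and>
        disjoint_family_on Q {..<n} \<and>
        \<Omega> = (\<Union>i<n. closure (Q i) \<inter> \<Omega>) \<and>
        negligible (\<Omega> - (\<Union>i<n. Q i)) \<and>
        (\<forall>i<n. \<rho>c i > 0 \<and>
           (AE x in lebesgue_on (Q i). \<rho>0 x = \<rho>c i) \<and> (AE x in lebesgue_on (Q i). b0 x = bc i)))"


subsection \<open>Equality of states in \<open>L\<^sup>\<infinity>\<close>\<close>

definition same_state ::
    "real \<Rightarrow> (real^2) set \<Rightarrow>
     (stpoint \<Rightarrow> real) \<times> (stpoint \<Rightarrow> real^2) \<times> (stpoint \<Rightarrow> real) \<Rightarrow>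
     (stpoint \<Rightarrow> real) \<times> (stpoint \<Rightarrow> real^2) \<times> (stpoint \<Rightarrow> real) \<Rightarrow> bool" where
  "same_state T \<Omega> = (\<lambda>(\<rho>, u, b) (\<rho>', u', b').
     AE z in lebesgue_on (space_time T \<Omega>). \<rho> z = \<rho>' z \<and> u z = u' z \<and> b z = b' z)"

end

theory Submission
  imports Defs
begin

text \<open>
  Keep \<open>\<rho>\<close> and \<open>b\<close> frozen and choose \<open>\<bar>u\<bar>\<^sup>2\<close> constant on each piece so that the total pressure
  \<open>\<rho> \<bar>u\<bar>\<^sup>2 / 2 + p(\<rho>) + b\<^sup>2 / 2\<close> is one constant on all of \<open>\<Omega>\<close>.  That constant does not contribute to the
  momentum balance, because the integral over \<open>\<Omega>\<close> of the divergence of a tangential field vanishes,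
  and every remaining balance splits into the linear system \<open>div u = 0\<close>, \<open>\<partial>\<^sub>t u + div U = 0\<close> on each piece,
  with \<open>U\<close> the trace-free part of \<open>u \<otimes> u\<close> and no flux through the boundary of the piece.

  On one piece this is solved by convex integration in the manner of De Lellis and
  Szekelyhidi: to a strict subsolution one adds finitely many localized high-frequency plane waves in
  disjoint boxes.  Each step gains kinetic energy in proportion to the square of the energy
  deficit and is almost orthogonal to all earlier stages, so the stages converge strongly and the
  limit has no deficit.  Almost every time slice of the limit has full energy and can serve as initial
  datum.  The solution can be continued after its time interval by any other one, which gives infinitely
  many solutions with the same datum.
\<close>

subsection \<open>Plane waves and the hull of the constraint\<close>

text \<open>Once the isotropic stress is one constant, the pieces decouple: a field supported in one
  piece, tested against functions that do not vanish on its boundary, carries its own no-flux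
  condition. The remaining obstacle is the initial time. Convergence of the stages in space-time
  says nothing about a prescribed time slice, and a datum with less than full energy would break the
  energy balance at time 0. So every stage satisfies its linear identity from each time onwards, and
  the limit is taken at a time where the slices converge almost everywhere; the quadratic relation
  between velocity and matrix appears only in the limit. A second obstacle is that the boundary of
  the domain has no regularity, so the divergence of a tangential field cannot be handled through
  traces. Touching balls supply exactly the normals at nearest boundary points, and these are the
  only directions that the distance to the complement sees.\<close>

text \<open>
  A state \<open>(w, \<zeta>)\<close> encodes the velocity \<open>u = (Re w, Im w)\<close> and the trace-free symmetric matrix \<open>U\<close> with
  first row \<open>(Re \<zeta>, Im \<zeta>)\<close>; the trace-free part of \<open>u \<otimes> u\<close> is then \<open>w\<^sup>2 / 2\<close>, and the generalized energy
  is the largest eigenvalue of \<open>u \<otimes> u - U\<close>.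
\<close>

definition gen_energy :: "complex \<times> complex \<Rightarrow> real" where
  "gen_energy Y = (norm (fst Y))\<^sup>2 / 2 + norm (snd Y - (fst Y)\<^sup>2 / 2)"

text \<open>
  Symbol of a third-order potential for \<open>div u = 0\<close>, \<open>\<partial>\<^sub>t u + div U = 0\<close>: with \<open>q = x + \<i> y\<close> it is
  \<open>(\<i> q \<bar>q\<bar>\<^sup>2, - \<i> t q\<^sup>2)\<close>.
\<close>

definition wave :: "stpoint \<Rightarrow> complex \<times> complex" where
  "wave \<eta> = (let t = fst \<eta>; x = snd \<eta> $ 1; y = snd \<eta> $ 2 in
     (Complex (- y * (x\<^sup>2 + y\<^sup>2)) (x * (x\<^sup>2 + y\<^sup>2)),
      Complex (2 * x * y * t) ((y\<^sup>2 - x\<^sup>2) * t)))"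

lemma continuous_wave: "continuous_on UNIV wave"
  unfolding wave_def Let_def Complex_eq by (intro continuous_intros)

text \<open>Every component of \<open>wave\<close> is a polynomial of degree three, and a fourth
  central difference annihilates such polynomials.\<close>

lemma wave_fourth_difference:
  "wave (\<eta> - 2 *\<^sub>R \<delta>) - 4 *\<^sub>R wave (\<eta> - \<delta>) + 6 *\<^sub>R wave \<eta> - 4 *\<^sub>R wave (\<eta> + \<delta>) + wave (\<eta> + 2 *\<^sub>R \<delta>) = 0"
  by (simp add: wave_def Let_def prod_eq_iff complex_eq_iff power2_eq_square algebra_simps)

lemma continuous_gen_energy: "continuous_on UNIV gen_energy"
  unfolding gen_energy_def by (intro continuous_intros) auto

text \<open>This is convexity of the largest eigenvalue along the segment to the origin, where it
  vanishes. Explicitly, the kinetic part drops to s^2 times its value, and the surplus (s - s^2)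
  |w|^2 / 2 pays for the term that the matrix part picks up.\<close>

lemma gen_energy_scale:
  assumes "0 \<le> s" "s \<le> 1"
  shows "gen_energy (s *\<^sub>R Y) \<le> s * gen_energy Y"
proof -
  obtain w z where Y: "Y = (w, z)" by force
  have "s *\<^sub>R z - (s *\<^sub>R w)\<^sup>2 / 2 = s *\<^sub>R (z - w\<^sup>2 / 2) + (s - s\<^sup>2) *\<^sub>R (w\<^sup>2 / 2)"
    by (simp add: scaleR_conv_of_real algebra_simps power2_eq_square)
  then have "norm (s *\<^sub>R z - (s *\<^sub>R w)\<^sup>2 / 2) \<le> norm (s *\<^sub>R (z - w\<^sup>2 / 2)) + norm ((s - s\<^sup>2) *\<^sub>R (w\<^sup>2 / 2))"
    by (metis norm_triangle_ineq)
  also have "\<dots> = s * norm (z - w\<^sup>2 / 2) + (s - s\<^sup>2) * ((norm w)\<^sup>2 / 2)"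
  proof -
    have "s\<^sup>2 \<le> s" using assms by (simp add: power2_eq_square mult_left_le_one_le)
    then show ?thesis using assms by (simp add: norm_divide norm_power)
  qed
  finally have 1: "norm (s *\<^sub>R z - (s *\<^sub>R w)\<^sup>2 / 2) \<le> s * norm (z - w\<^sup>2 / 2) + (s - s\<^sup>2) * ((norm w)\<^sup>2 / 2)" .
  have "(norm (s *\<^sub>R w))\<^sup>2 = s\<^sup>2 * (norm w)\<^sup>2" by (simp add: power_mult_distrib)
  then show ?thesis using 1 unfolding Y gen_energy_def fst_scaleR snd_scaleR fst_conv snd_conv by (simp add: field_simps)
qed

text \<open>
  Write \<open>\<delta> = \<zeta> - w\<^sup>2 / 2 = \<bar>\<delta>\<bar> v\<^sup>2\<close> with \<open>\<bar>v\<bar> = 1\<close> and take the wave whose velocity points along \<open>v\<close> and whose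
  time frequency is the component of \<open>w\<close> orthogonal to \<open>v\<close>.  Then \<open>\<delta>\<close> only changes along \<open>v\<^sup>2\<close>.
\<close>

lemma gen_energy_wave:
  assumes H: "gen_energy Y < e"
  obtains \<xi> where "norm (fst (wave \<xi>)) = 1" "\<xi> \<noteq> 0"
    "\<And>\<tau>. \<bar>\<tau>\<bar> \<le> 1 \<Longrightarrow>
       gen_energy (Y + (\<tau> * ((e - (norm (fst Y))\<^sup>2 / 2) / (4 * sqrt (2 * e)))) *\<^sub>R wave \<xi>) < e"
proof -
  obtain w z where Y: "Y = (w, z)" by force
  define \<delta> where "\<delta> = z - w\<^sup>2 / 2"
  define g where "g = e - (norm w)\<^sup>2 / 2"
  \<comment> \<open>Since |\<alpha>| \<le> |w| \<le> sqrt (2 e), this amplitude gives A |\<alpha>|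
    \<le> g / 4 and A^2 \<le> g / 32, which keeps the change of kinetic energy below g / 2.\<close>
  define A where "A = g / (4 * sqrt (2 * e))"
  have Hw: "(norm w)\<^sup>2 / 2 + norm \<delta> < e" using H by (simp add: gen_energy_def Y \<delta>_def)
  have g: "g > norm \<delta>" using Hw by (simp add: g_def)
  have g0: "g > 0" by (rule le_less_trans[OF norm_ge_zero g])
  have e0: "e > 0" using Hw zero_le_power2[of "norm w"] norm_ge_zero[of \<delta>] by linarith
  have "norm w \<le> sqrt (2 * e)" using g0 unfolding g_def by (intro real_le_rsqrt) simp
  \<comment> \<open>A unit square root of the direction of \<delta>; if \<delta> = 0 every direction
    works and 1 is taken.\<close>
  define v where "v = (if \<delta> = 0 then 1 else csqrt (sgn \<delta>))"
  have v1: "norm v = 1" by (auto simp: v_def norm_sgn)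
  have v2: "\<delta> = norm \<delta> *\<^sub>R v\<^sup>2" by (auto simp: v_def sgn_div_norm)
  have vv: "v * cnj v = 1" using v1 by (simp add: complex_norm_square[symmetric])
  define \<alpha> where "\<alpha> = Re (w * cnj v)"
  define \<beta> where "\<beta> = Im (w * cnj v)"
  have w: "w = (of_real \<alpha> + \<i> * of_real \<beta>) * v"
  proof -
    have "of_real \<alpha> + \<i> * of_real \<beta> = w * cnj v" by (simp add: \<alpha>_def \<beta>_def complex_eq_iff)
    then have "(of_real \<alpha> + \<i> * of_real \<beta>) * v = w * (v * cnj v)" by (simp add: mult_ac)
    then show ?thesis by (simp add: vv)
  qed
  have \<alpha>: "\<bar>\<alpha>\<bar> \<le> norm w" unfolding \<alpha>_def using abs_Re_le_cmod[of "w * cnj v"] v1 by (simp add: norm_mult)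
  \<comment> \<open>The spatial frequency is v turned by a right angle, q = - \<i> v. Then \<i> q
    |q|^2 = v, and the matrix part - \<i> \<beta> q^2 equals \<i> \<beta> v^2.\<close>
  define \<xi> :: stpoint where "\<xi> = (\<beta>, vector [Im v, - Re v])"
  have vn: "(Re v)\<^sup>2 + (Im v)\<^sup>2 = 1" using v1 by (simp add: cmod_def)
  have wv: "wave \<xi> = (v, \<i> * of_real \<beta> * v\<^sup>2)"
    using vn by (simp add: wave_def \<xi>_def Let_def complex_eq_iff Re_power2 Im_power2 add.commute)
  have "gen_energy (Y + (\<tau> * A) *\<^sub>R wave \<xi>) < e" if \<tau>: "\<bar>\<tau>\<bar> \<le> 1" for \<tau>
  proof -
    define s where "s = \<tau> * A * \<alpha> + (\<tau> * A)\<^sup>2 / 2"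
    have A0: "A > 0" using g0 e0 by (simp add: A_def)
    have "\<tau> * A * \<alpha> \<le> \<bar>\<tau>\<bar> * A * \<bar>\<alpha>\<bar>" using A0 by (metis abs_ge_self abs_mult abs_of_pos)
    also have "\<dots> \<le> 1 * A * sqrt (2 * e)"
      using \<tau> A0 \<alpha> \<open>norm w \<le> sqrt (2 * e)\<close> e0 by (intro mult_mono) auto
    also have "\<dots> = g / 4" using e0 by (simp add: A_def)
    finally have s1: "\<tau> * A * \<alpha> \<le> g / 4" .
    have "(\<tau> * A)\<^sup>2 \<le> A\<^sup>2" using \<tau> A0 by (simp add: power_mult_distrib mult_left_le_one_le abs_square_le_1)
    also have "A\<^sup>2 = g\<^sup>2 / (32 * e)" using e0 by (simp add: A_def power_divide power_mult_distrib)
    also have "\<dots> \<le> g / 32"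
    proof -
      have "g \<le> e" by (simp add: g_def)
      then have "g * g \<le> g * e" using g0 by (intro mult_left_mono) auto
      then show ?thesis using e0 by (simp add: field_simps power2_eq_square)
    qed
    finally have s: "s < g / 2" using s1 g0 unfolding s_def by simp
    have n1: "(norm (w + (\<tau> * A) *\<^sub>R v))\<^sup>2 / 2 = (norm w)\<^sup>2 / 2 + s"
    proof -
      have "(norm (w + (\<tau> * A) *\<^sub>R v))\<^sup>2 = (norm w)\<^sup>2 + 2 * (\<tau> * A) * \<alpha> + (\<tau> * A)\<^sup>2 * ((Re v)\<^sup>2 + (Im v)\<^sup>2)"
        unfolding cmod_power2 \<alpha>_def by (simp add: power2_eq_square algebra_simps)
      then show ?thesis by (simp add: vn s_def)
    qed
    \<comment> \<open>Half the square of w + \<tau> A v contributes \<tau> A (\<alpha> + \<i>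
      \<beta>) v^2. Its \<beta> part is cancelled by the matrix part of the wave, so only a real
      multiple of v^2 changes.\<close>
    have n2: "z + (\<tau> * A) *\<^sub>R (\<i> * of_real \<beta> * v\<^sup>2) - (w + (\<tau> * A) *\<^sub>R v)\<^sup>2 / 2 = (norm \<delta> - s) *\<^sub>R v\<^sup>2"
    proof -
      have "z = w\<^sup>2 / 2 + norm \<delta> *\<^sub>R v\<^sup>2" using v2 by (simp add: \<delta>_def)
      then show ?thesis unfolding s_def
        by (subst w, subst (asm) w) (simp add: scaleR_conv_of_real power2_eq_square field_simps)
    qed
    have "norm (z + (\<tau> * A) *\<^sub>R (\<i> * of_real \<beta> * v\<^sup>2) - (w + (\<tau> * A) *\<^sub>R v)\<^sup>2 / 2) = \<bar>norm \<delta> - s\<bar>"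
      unfolding n2 by (simp add: norm_power v1)
    then have "gen_energy (Y + (\<tau> * A) *\<^sub>R wave \<xi>) = (norm w)\<^sup>2 / 2 + s + \<bar>norm \<delta> - s\<bar>"
      using n1 by (simp add: gen_energy_def Y wv)
    \<comment> \<open>If norm \<delta> \<ge> s this is norm \<delta> < g; otherwise it follows from
      2 s < g.\<close>
    moreover have "\<bar>norm \<delta> - s\<bar> < g - s" using g s norm_ge_zero[of \<delta>] unfolding abs_less_iff by linarith
    ultimately show ?thesis unfolding g_def by linarith
  qed
  moreover have "norm (fst (wave \<xi>)) = 1" using v1 by (simp add: wv)
  moreover have "\<xi> \<noteq> 0" using calculation(2) by (auto simp: wave_def Let_def cmod_def)
  ultimately show ?thesis using that unfolding A_def g_def Y by simp
qed


subsection \<open>Localized plane waves\<close>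

text \<open>
  The cut-off is a product of fourth powers of cosines.  So a localized wave is a trigonometric
  polynomial, and multiplying by a cut-off amounts to a weighted average over shifted frequencies.
  Applying a cubic symbol frequency by frequency gives an exact solution of the linear system.
\<close>

definition avg4 :: "'a::real_vector \<Rightarrow> ('a \<Rightarrow> 'v::real_vector) \<Rightarrow> 'a \<Rightarrow> 'v" where
  "avg4 d g \<eta> = (1/16) *\<^sub>R (g (\<eta> - 4 *\<^sub>R d) + 4 *\<^sub>R g (\<eta> - 2 *\<^sub>R d) + 6 *\<^sub>R g \<eta>
     + 4 *\<^sub>R g (\<eta> + 2 *\<^sub>R d) + g (\<eta> + 4 *\<^sub>R d))"

lemma avg4_commute: "avg4 d (avg4 d' g) \<eta> = avg4 d' (avg4 d g) \<eta>"
  unfolding avg4_def by (simp add: algebra_simps)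

lemma avg4_zero [simp]: "avg4 d (\<lambda>\<eta>. 0) = (\<lambda>\<eta>. 0)"
  by (simp add: avg4_def fun_eq_iff)

lemma avg4_diff: "avg4 d f \<eta> - avg4 d g \<eta> = avg4 d (\<lambda>\<eta>. f \<eta> - g \<eta>) \<eta>"
  unfolding avg4_def by (simp add: algebra_simps)

lemma avg4_linear:
  assumes "linear L"
  shows "L (avg4 d g \<eta>) = avg4 d (\<lambda>\<eta>. L (g \<eta>)) \<eta>"
  using assms by (simp add: avg4_def linear_add linear_scale)

lemma avg4_has_derivative:
  fixes g :: "'b::real_normed_vector \<Rightarrow> 'a::real_vector \<Rightarrow> 'v::real_normed_vector"
  assumes "\<And>\<eta>. ((\<lambda>z. g z \<eta>) has_derivative (\<lambda>h. g' h \<eta>)) F"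
  shows "((\<lambda>z. avg4 d (g z) \<eta>) has_derivative (\<lambda>h. avg4 d (g' h) \<eta>)) F"
  unfolding avg4_def by (intro derivative_intros assms)

lemma avg4_lipschitz:
  fixes g :: "'b::metric_space \<Rightarrow> 'a::real_vector \<Rightarrow> 'v::real_normed_vector"
  assumes "\<And>\<eta>. \<exists>L. L-lipschitz_on UNIV (\<lambda>z. g z \<eta>)"
  shows "\<exists>L. L-lipschitz_on UNIV (\<lambda>z. avg4 d (g z) \<eta>)"
proof -
  have add: "\<exists>L. L-lipschitz_on UNIV (\<lambda>z. f z + h z)"
    if "\<exists>L. L-lipschitz_on UNIV f" "\<exists>L. L-lipschitz_on UNIV h" for f h :: "'b \<Rightarrow> 'v"
    using that lipschitz_on_add by blast
  have scale: "\<exists>L. L-lipschitz_on UNIV (\<lambda>z. s *\<^sub>R f z)"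
    if "\<exists>L. L-lipschitz_on UNIV f" for f :: "'b \<Rightarrow> 'v" and s
    using that lipschitz_on_cmult by blast
  show ?thesis unfolding avg4_def by (intro add scale assms)
qed

text \<open>The weights 1, 4, 6, 4, 1 over 16 are positive with sum one, so the average obeys any
  bound valid at the five sample points, all within 4 |d| of \<eta>.\<close>

lemma avg4_norm_le:
  fixes g :: "'a::real_normed_vector \<Rightarrow> 'v::real_normed_vector"
  assumes "\<And>\<kappa>. norm (\<kappa> - \<eta>) \<le> 4 * norm d \<Longrightarrow> norm (g \<kappa>) \<le> B"
  shows "norm (avg4 d g \<eta>) \<le> B"
proof -
  have B: "norm (g (\<eta> - 4 *\<^sub>R d)) \<le> B" "norm (g (\<eta> - 2 *\<^sub>R d)) \<le> B" "norm (g \<eta>) \<le> B"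
    "norm (g (\<eta> + 2 *\<^sub>R d)) \<le> B" "norm (g (\<eta> + 4 *\<^sub>R d)) \<le> B"
    by (auto intro!: assms)
  have "norm (g (\<eta> - 4 *\<^sub>R d) + 4 *\<^sub>R g (\<eta> - 2 *\<^sub>R d) + 6 *\<^sub>R g \<eta>
     + 4 *\<^sub>R g (\<eta> + 2 *\<^sub>R d) + g (\<eta> + 4 *\<^sub>R d)) \<le> B + 4 * B + 6 * B + 4 * B + B"
    using B by (intro norm_triangle_mono) auto
  then show ?thesis unfolding avg4_def by simp
qed

text \<open>This is the source of the cut-off: 16 cos^4 \<theta> = 2 cos (4 \<theta>) + 8 cos (2
  \<theta>) + 6, so the binomial average over shifted frequencies multiplies a single sine by a
  fourth power of a cosine.\<close>

lemma avg4_sin: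
  fixes d \<zeta> :: "'a::real_inner"
  shows "avg4 d (\<lambda>\<eta>. sin (\<eta> \<bullet> \<zeta>) *\<^sub>R v) \<eta> = (cos (d \<bullet> \<zeta>) ^ 4 * sin (\<eta> \<bullet> \<zeta>)) *\<^sub>R v"
proof -
  define \<theta> A where "\<theta> = d \<bullet> \<zeta>" and "A = \<eta> \<bullet> \<zeta>"
  have c2: "cos (2 * \<theta>) = 2 * (cos \<theta>)\<^sup>2 - 1" by (rule cos_double_cos)
  have c4: "cos (4 * \<theta>) = 2 * (cos (2 * \<theta>))\<^sup>2 - 1" using cos_double_cos[of "2 * \<theta>"] by simp
  have "sin (A - 4 * \<theta>) + 4 * sin (A - 2 * \<theta>) + 6 * sin A + 4 * sin (A + 2 * \<theta>) + sin (A + 4 * \<theta>)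
      = sin A * (2 * cos (4 * \<theta>) + 8 * cos (2 * \<theta>) + 6)"
    by (simp add: sin_add sin_diff algebra_simps)
  also have "2 * cos (4 * \<theta>) + 8 * cos (2 * \<theta>) + 6 = 16 * cos \<theta> ^ 4"
    unfolding c4 c2 by (simp add: power2_eq_square power4_eq_xxxx algebra_simps)
  finally have "sin (A - 4 * \<theta>) + 4 * sin (A - 2 * \<theta>) + 6 * sin A + 4 * sin (A + 2 * \<theta>) + sin (A + 4 * \<theta>)
      = 16 * (cos \<theta> ^ 4 * sin A)" by simp
  then have "(1/16) *\<^sub>R ((sin (A - 4 * \<theta>) + 4 * sin (A - 2 * \<theta>) + 6 * sin A + 4 * sin (A + 2 * \<theta>) + sin (A + 4 * \<theta>)) *\<^sub>R v)
      = (cos \<theta> ^ 4 * sin A) *\<^sub>R v" by simp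
  then show ?thesis
    by (simp add: avg4_def inner_diff_left inner_add_left scaleR_add_left flip: \<theta>_def A_def)
qed

text \<open>Holds for polynomial symbols of degree at most three. As a difference equation it passes
  to images under linear maps and can be evaluated directly at the shifted frequencies.\<close>

definition fourth_diff_zero :: "('a::real_vector \<Rightarrow> 'v::real_vector) \<Rightarrow> bool" where
  "fourth_diff_zero P \<longleftrightarrow> (\<forall>\<eta> \<delta>.
     P (\<eta> - 2 *\<^sub>R \<delta>) - 4 *\<^sub>R P (\<eta> - \<delta>) + 6 *\<^sub>R P \<eta> - 4 *\<^sub>R P (\<eta> + \<delta>) + P (\<eta> + 2 *\<^sub>R \<delta>) = 0)"

text \<open>
  On a face of the box the shifts contribute alternating signs, so the sum is a fourth difference
  of the cubic symbol: the wave vanishes there although its potential was differentiated three times.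
\<close>

lemma avg4_osc_eq_0:
  fixes d \<zeta> :: "'a::real_inner"
  assumes P: "fourth_diff_zero P" and c: "cos (d \<bullet> \<zeta>) = 0"
  shows "avg4 d (\<lambda>\<eta>. sin (\<eta> \<bullet> \<zeta>) *\<^sub>R P \<eta>) \<eta> = 0"
proof -
  define \<theta> A where "\<theta> = d \<bullet> \<zeta>" and "A = \<eta> \<bullet> \<zeta>"
  have c2: "cos (2 * \<theta>) = - 1" "sin (2 * \<theta>) = 0" using c by (simp_all add: cos_double_cos sin_double flip: \<theta>_def)
  have c4: "cos (4 * \<theta>) = 1" "sin (4 * \<theta>) = 0"
    using cos_double_cos[of "2 * \<theta>"] sin_double[of "2 * \<theta>"] c2 by simp_all
  have s: "sin (A - 4 * \<theta>) = sin A" "sin (A - 2 * \<theta>) = - sin A" "sin (A + 2 * \<theta>) = - sin A" "sin (A + 4 * \<theta>) = sin A"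
    by (simp_all add: sin_add sin_diff c2 c4)
  have "P (\<eta> - 4 *\<^sub>R d) - 4 *\<^sub>R P (\<eta> - 2 *\<^sub>R d) + 6 *\<^sub>R P \<eta> - 4 *\<^sub>R P (\<eta> + 2 *\<^sub>R d) + P (\<eta> + 4 *\<^sub>R d) = 0"
    using P[unfolded fourth_diff_zero_def, rule_format, of \<eta> "2 *\<^sub>R d"] by simp
  then have "(sin A / 16) *\<^sub>R (P (\<eta> - 4 *\<^sub>R d) - 4 *\<^sub>R P (\<eta> - 2 *\<^sub>R d) + 6 *\<^sub>R P \<eta> - 4 *\<^sub>R P (\<eta> + 2 *\<^sub>R d) + P (\<eta> + 4 *\<^sub>R d)) = 0"
    by simp
  then show ?thesis
    by (simp add: avg4_def inner_diff_left inner_add_left s scaleR_add_right scaleR_diff_right flip: \<theta>_def A_def)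
qed

definition st_dir :: "nat \<Rightarrow> stpoint" where
  "st_dir i = (if i = 0 then (1, 0) else if i = 1 then (0, axis 1 1) else (0, axis 2 1))"

lemma Basis_stpoint: "(Basis :: stpoint set) = {st_dir 0, st_dir 1, st_dir 2}"
proof -
  have "(Basis :: (real^2) set) = {axis 1 1, axis 2 1}"
    by (auto simp: Basis_vec_def UNIV_2)
  then show ?thesis by (auto simp: Basis_prod_def st_dir_def)
qed

lemma st_dir_distinct: "st_dir 0 \<noteq> st_dir 1" "st_dir 0 \<noteq> st_dir 2" "st_dir 1 \<noteq> st_dir 2"
  by (auto simp: st_dir_def axis_eq_axis)

text \<open>Scaled so that the phase measured from the centre of the box runs from - pi / 2 to pi /
  2 along each side; within the box the cosine then vanishes exactly on the two opposite
  faces.\<close>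

definition box_freq :: "stpoint \<Rightarrow> stpoint \<Rightarrow> nat \<Rightarrow> stpoint" where
  "box_freq a b i = (pi / ((b - a) \<bullet> st_dir i)) *\<^sub>R st_dir i"

abbreviation avg_box :: "stpoint \<Rightarrow> stpoint \<Rightarrow> (stpoint \<Rightarrow> 'v::real_vector) \<Rightarrow> stpoint \<Rightarrow> 'v" where
  "avg_box a b g \<equiv> avg4 (box_freq a b 0) (avg4 (box_freq a b 1) (avg4 (box_freq a b 2) g))"

text \<open>A single oscillation at frequency N \<xi>, cut off by averaging over nearby frequencies.
  The symbol is evaluated at \<eta> / N; for the homogeneous cubic \<open>wave\<close> this divides
  the third derivatives of the potential by N^3, so amplitudes stay bounded as N grows.\<close>

definition packet :: "(stpoint \<Rightarrow> 'v::real_vector) \<Rightarrow> stpoint \<Rightarrow> stpoint \<Rightarrow> stpoint \<Rightarrow> real \<Rightarrow> stpoint \<Rightarrow> 'v" where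
  "packet P a b \<xi> N z =
     avg_box a b (\<lambda>\<eta>. sin (\<eta> \<bullet> (z - (1/2) *\<^sub>R (a + b))) *\<^sub>R P ((1 / N) *\<^sub>R \<eta>)) (N *\<^sub>R \<xi>)"

definition block :: "(stpoint \<Rightarrow> 'v::real_vector) \<Rightarrow> stpoint \<Rightarrow> stpoint \<Rightarrow> stpoint \<Rightarrow> real \<Rightarrow> stpoint \<Rightarrow> 'v" where
  "block P a b \<xi> N z = (if z \<in> cbox a b then packet P a b \<xi> N z else 0)"

text \<open>The envelope that a packet would have exactly if its symbol did not depend on the
  frequency, by \<open>avg4_sin\<close> in the three coordinates.\<close>

definition bump :: "stpoint \<Rightarrow> stpoint \<Rightarrow> stpoint \<Rightarrow> real" where
  "bump a b z = (if z \<in> cbox a b then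
     (cos (box_freq a b 0 \<bullet> (z - (1/2) *\<^sub>R (a + b))) * cos (box_freq a b 1 \<bullet> (z - (1/2) *\<^sub>R (a + b)))
       * cos (box_freq a b 2 \<bullet> (z - (1/2) *\<^sub>R (a + b)))) ^ 4 else 0)"

lemma bump_nonneg: "0 \<le> bump a b z" by (simp add: bump_def)

lemma bump_le_1: "bump a b z \<le> 1"
proof -
  have "\<bar>cos x * cos y * cos w\<bar> \<le> 1" for x y w :: real
    by (simp add: abs_mult mult_le_one)
  then have "(cos x * cos y * cos w) ^ 4 \<le> 1" for x y w :: real
    by (metis abs_ge_zero power_abs power_even_abs_numeral power_le_one even_numeral)
  then show ?thesis by (simp add: bump_def)
qed

lemma cos_box_freq_face:
  assumes b: "box a b \<noteq> {}" and z: "z \<in> cbox a b - box a b"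
  shows "\<exists>i\<in>{0,1,2}. cos (box_freq a b i \<bullet> (z - (1/2) *\<^sub>R (a + b))) = 0"
proof -
  have "\<exists>v\<in>Basis. z \<bullet> v = a \<bullet> v \<or> z \<bullet> v = b \<bullet> v"
  proof -
    obtain v where "v \<in> Basis" "\<not> (a \<bullet> v < z \<bullet> v \<and> z \<bullet> v < b \<bullet> v)"
      using z unfolding Diff_iff mem_box by blast
    moreover have "a \<bullet> v \<le> z \<bullet> v \<and> z \<bullet> v \<le> b \<bullet> v"
      using z \<open>v \<in> Basis\<close> unfolding Diff_iff mem_box by blast
    ultimately show ?thesis by (intro bexI[of _ v]) linarith+
  qed
  then obtain v where v: "v \<in> Basis" "z \<bullet> v = a \<bullet> v \<or> z \<bullet> v = b \<bullet> v" by blast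
  obtain i where i: "i \<in> {0,1,2}" "v = st_dir i" using v(1) unfolding Basis_stpoint by auto
  have ab: "(b - a) \<bullet> v > 0" using b v(1) unfolding box_ne_empty by (auto simp: inner_diff_left)
  have "box_freq a b i \<bullet> (z - (1/2) *\<^sub>R (a + b)) = pi / 2 \<or> box_freq a b i \<bullet> (z - (1/2) *\<^sub>R (a + b)) = - (pi / 2)"
    using v(2)
  proof
    assume "z \<bullet> v = a \<bullet> v"
    then have H: "v \<bullet> (z - (1/2) *\<^sub>R (a + b)) = - ((b - a) \<bullet> v / 2)"
      by (simp add: inner_diff_left inner_diff_right inner_add_right inner_commute field_simps)
    show ?thesis unfolding box_freq_def i(2)[symmetric] inner_scaleR_left H using ab by (simp add: field_simps)
  next
    assume "z \<bullet> v = b \<bullet> v"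
    then have H: "v \<bullet> (z - (1/2) *\<^sub>R (a + b)) = ((b - a) \<bullet> v / 2)"
      by (simp add: inner_diff_left inner_diff_right inner_add_right inner_commute field_simps)
    show ?thesis unfolding box_freq_def i(2)[symmetric] inner_scaleR_left H using ab by (simp add: field_simps)
  qed
  then have "cos (box_freq a b i \<bullet> (z - (1/2) *\<^sub>R (a + b))) = 0" by (metis cos_pi_half cos_minus)
  then show ?thesis using i(1) by blast
qed

lemma bump_face: "box a b \<noteq> {} \<Longrightarrow> z \<notin> box a b \<Longrightarrow> bump a b z = 0"
proof -
  assume a: "box a b \<noteq> {}" "z \<notin> box a b"
  show ?thesis
  proof (cases "z \<in> cbox a b")
    case True
    then have "\<exists>i\<in>{0,1,2}. cos (box_freq a b i \<bullet> (z - (1/2) *\<^sub>R (a + b))) = 0"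
      using cos_box_freq_face[OF a(1)] a(2) by blast
    then have "cos (box_freq a b 0 \<bullet> (z - (1/2) *\<^sub>R (a + b))) * cos (box_freq a b 1 \<bullet> (z - (1/2) *\<^sub>R (a + b)))
       * cos (box_freq a b 2 \<bullet> (z - (1/2) *\<^sub>R (a + b))) = 0"
      by (elim bexE insertE emptyE) (simp_all only: mult_zero_left mult_zero_right)
    then show ?thesis by (simp only: bump_def if_True True power_zero_numeral)
  qed (simp only: bump_def if_False)
qed

text \<open>The three averages commute, so the one whose cosine vanishes on the given face can be
  moved innermost. There it annihilates the oscillation by \<open>avg4_osc_eq_0\<close>.\<close>

lemma packet_face:
  assumes "box a b \<noteq> {}" "z \<in> cbox a b - box a b" "fourth_diff_zero P"
  shows "packet P a b \<xi> N z = 0"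
proof -
  define \<zeta> where "\<zeta> = z - (1/2) *\<^sub>R (a + b)"
  have P': "fourth_diff_zero (\<lambda>\<eta>. P ((1 / N) *\<^sub>R \<eta>))"
    unfolding fourth_diff_zero_def
  proof (intro allI)
    fix \<eta> \<delta> :: stpoint
    show "P ((1 / N) *\<^sub>R (\<eta> - 2 *\<^sub>R \<delta>)) - 4 *\<^sub>R P ((1 / N) *\<^sub>R (\<eta> - \<delta>)) + 6 *\<^sub>R P ((1 / N) *\<^sub>R \<eta>)
        - 4 *\<^sub>R P ((1 / N) *\<^sub>R (\<eta> + \<delta>)) + P ((1 / N) *\<^sub>R (\<eta> + 2 *\<^sub>R \<delta>)) = 0"
      using assms(3)[unfolded fourth_diff_zero_def, rule_format, of "(1 / N) *\<^sub>R \<eta>" "(1 / N) *\<^sub>R \<delta>"]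
      by (simp add: scaleR_diff_right scaleR_add_right)
  qed
  have 0: "avg4 (box_freq a b i) (\<lambda>\<eta>. sin (\<eta> \<bullet> \<zeta>) *\<^sub>R P ((1 / N) *\<^sub>R \<eta>)) = (\<lambda>\<eta>. 0)"
    if "cos (box_freq a b i \<bullet> \<zeta>) = 0" for i
    using avg4_osc_eq_0[OF P' that] by auto
  have c: "avg4 d (avg4 d' g) = avg4 d' (avg4 d g)" for d d' and g :: "stpoint \<Rightarrow> 'a" 
    by (rule ext) (rule avg4_commute)
  obtain i where "i \<in> {0::nat,1,2}" "cos (box_freq a b i \<bullet> \<zeta>) = 0"
    using cos_box_freq_face[OF assms(1,2)] unfolding \<zeta>_def by blast
  then consider "cos (box_freq a b 0 \<bullet> \<zeta>) = 0" | "cos (box_freq a b 1 \<bullet> \<zeta>) = 0" | "cos (box_freq a b 2 \<bullet> \<zeta>) = 0" by auto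
  then show ?thesis
  proof cases
    case 1
    then show ?thesis unfolding packet_def \<zeta>_def[symmetric]
      by (subst c, subst c[of "box_freq a b 0" "box_freq a b 2"]) (simp only: 0 avg4_zero)
  next
    case 2
    then show ?thesis unfolding packet_def \<zeta>_def[symmetric]
      by (subst c[of "box_freq a b 1" "box_freq a b 2"]) (simp only: 0 avg4_zero)
  next
    case 3
    then show ?thesis unfolding packet_def \<zeta>_def[symmetric] by (simp only: 0 avg4_zero)
  qed
qed

lemma block_face:
  "box a b \<noteq> {} \<Longrightarrow> fourth_diff_zero P \<Longrightarrow> z \<notin> box a b \<Longrightarrow> block P a b \<xi> N z = 0"
  using packet_face[of a b z P] by (auto simp: block_def)

text \<open>A segment from a point of S to a point outside meets the frontier, where f vanishes, so
  the value inside is bounded through the distance to that meeting point. The Lipschitz constant is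
  kept.\<close>

lemma zero_extension_lipschitz:
  fixes f :: "'a::euclidean_space \<Rightarrow> 'b::real_normed_vector"
  assumes f: "L-lipschitz_on UNIV f" and z: "\<And>x. x \<in> frontier S \<Longrightarrow> f x = 0"
  shows "L-lipschitz_on UNIV (\<lambda>x. if x \<in> S then f x else 0)"
proof -
  have L: "0 \<le> L" using f by (rule lipschitz_on_nonneg)
  have mixed: "dist (f x) 0 \<le> L * dist x y" if "x \<in> S" "y \<notin> S" for x y
  proof -
    have "closed_segment x y \<inter> frontier S \<noteq> {}"
      using that by (intro connected_Int_frontier) auto
    then obtain w where w: "w \<in> closed_segment x y" "f w = 0" using z by auto
    have "dist (f x) (f w) \<le> L * dist x w" using f by (rule lipschitz_onD) auto
    also have "\<dots> \<le> L * dist x y"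
      using L dist_in_closed_segment[OF w(1)] by (intro mult_left_mono) (auto simp: dist_commute)
    finally show ?thesis using w by simp
  qed
  show ?thesis
  proof (rule lipschitz_onI[OF _ L])
    fix x y
    show "dist (if x \<in> S then f x else 0) (if y \<in> S then f y else 0) \<le> L * dist x y"
      using mixed[of x y] mixed[of y x] lipschitz_onD[OF f, of x y] L
      by (auto simp: dist_commute)
  qed
qed

lemma frontier_cbox_eq: "frontier (cbox a b) = cbox a b - box a (b::'a::euclidean_space)"
  by (simp add: frontier_def closure_closed)

lemma osc_lipschitz: "\<exists>L. L-lipschitz_on UNIV (\<lambda>z. sin (\<eta> \<bullet> (z - c)) *\<^sub>R (v::'v::real_normed_vector))"
  for \<eta> c :: "'a::real_inner"
proof -
  have "(norm \<eta> * norm v)-lipschitz_on UNIV (\<lambda>z. sin (\<eta> \<bullet> (z - c)) *\<^sub>R v)"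
  proof (rule lipschitz_onI)
    fix x y :: 'a
    have "dist (sin (\<eta> \<bullet> (x - c)) *\<^sub>R v) (sin (\<eta> \<bullet> (y - c)) *\<^sub>R v)
        = \<bar>sin (\<eta> \<bullet> (x - c)) - sin (\<eta> \<bullet> (y - c))\<bar> * norm v"
      by (simp add: dist_norm flip: scaleR_diff_left)
    also have "\<dots> \<le> \<bar>\<eta> \<bullet> (x - c) - \<eta> \<bullet> (y - c)\<bar> * norm v"
    proof (intro mult_right_mono norm_ge_zero)
      have "\<bar>sin s - sin t\<bar> \<le> \<bar>s - t\<bar>" for s t :: real
      proof -
        have "sin s - sin t = 2 * (sin ((s - t) / 2) * cos ((s + t) / 2))"
          using sin_diff_sin[of s t] by simp
        then have "\<bar>sin s - sin t\<bar> = 2 * \<bar>sin ((s - t) / 2)\<bar> * \<bar>cos ((s + t) / 2)\<bar>"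
          by (simp add: abs_mult)
        also have "\<dots> \<le> 2 * \<bar>(s - t) / 2\<bar> * 1"
          by (intro mult_mono) (auto simp: abs_sin_x_le_abs_x simp del: abs_divide)
        finally show ?thesis by simp
      qed
      then show "\<bar>sin (\<eta> \<bullet> (x - c)) - sin (\<eta> \<bullet> (y - c))\<bar> \<le> \<bar>\<eta> \<bullet> (x - c) - \<eta> \<bullet> (y - c)\<bar>" .
    qed
    also have "\<eta> \<bullet> (x - c) - \<eta> \<bullet> (y - c) = \<eta> \<bullet> (x - y)" by (simp add: inner_diff_right)
    also have "\<bar>\<eta> \<bullet> (x - y)\<bar> * norm v \<le> (norm \<eta> * norm (x - y)) * norm v"
      by (intro mult_right_mono Cauchy_Schwarz_ineq2) auto
    finally show "dist (sin (\<eta> \<bullet> (x - c)) *\<^sub>R v) (sin (\<eta> \<bullet> (y - c)) *\<^sub>R v) \<le> norm \<eta> * norm v * dist x y"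
      by (simp add: dist_norm mult_ac)
  qed auto
  then show ?thesis ..
qed

lemma block_lipschitz:
  fixes P :: "stpoint \<Rightarrow> 'v::real_normed_vector"
  assumes "box a b \<noteq> {}" "fourth_diff_zero P"
  shows "\<exists>L. L-lipschitz_on UNIV (block P a b \<xi> N)"
proof -
  have "\<exists>L. L-lipschitz_on UNIV (packet P a b \<xi> N)"
    unfolding packet_def by (intro avg4_lipschitz osc_lipschitz)
  then show ?thesis
    using zero_extension_lipschitz[of _ "packet P a b \<xi> N" "cbox a b"] packet_face[OF assms(1) _ assms(2)]
    unfolding block_def frontier_cbox_eq by blast
qed

lemma block_has_derivative:
  fixes P :: "stpoint \<Rightarrow> 'v::real_normed_vector"
  assumes "z \<in> box a b"
  shows "(block P a b \<xi> N has_derivative (\<lambda>h. avg_box a b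
     (\<lambda>\<eta>. (cos (\<eta> \<bullet> (z - (1/2) *\<^sub>R (a + b))) * (\<eta> \<bullet> h)) *\<^sub>R P ((1 / N) *\<^sub>R \<eta>)) (N *\<^sub>R \<xi>))) (at z)"
proof -
  have "(packet P a b \<xi> N has_derivative (\<lambda>h. avg_box a b
     (\<lambda>\<eta>. (cos (\<eta> \<bullet> (z - (1/2) *\<^sub>R (a + b))) * (\<eta> \<bullet> h)) *\<^sub>R P ((1 / N) *\<^sub>R \<eta>)) (N *\<^sub>R \<xi>))) (at z)"
    unfolding packet_def
    by (intro avg4_has_derivative) (auto intro!: derivative_eq_intros simp: mult_ac)
  then show ?thesis
    by (rule has_derivative_transform_within_open[OF _ open_box assms])
      (use box_subset_cbox in \<open>auto simp: block_def\<close>)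
qed

text \<open>The divergence brings down the factor \<eta> at each frequency separately, and P (\<eta>
  / N) is orthogonal to \<eta> because it is orthogonal to \<eta> / N. The cut-off therefore leaves
  no error in the equation.\<close>

lemma block_divergence:
  fixes P :: "stpoint \<Rightarrow> stpoint"
  assumes "\<And>\<eta>. P \<eta> \<bullet> \<eta> = 0" "N \<noteq> 0"
  shows "(\<Sum>v\<in>Basis. avg_box a b
     (\<lambda>\<eta>. (cos (\<eta> \<bullet> \<zeta>) * (\<eta> \<bullet> v)) *\<^sub>R P ((1 / N) *\<^sub>R \<eta>)) (N *\<^sub>R \<xi>) \<bullet> v) = 0"
proof -
  have lin: "linear (\<lambda>x. x \<bullet> v)" for v :: stpoint by (simp add: linear_iff inner_add_left)
  have add: "avg4 d f \<eta> + avg4 d g \<eta> = avg4 d (\<lambda>\<eta>. f \<eta> + g \<eta>) \<eta>" for d \<eta> and f g :: "stpoint \<Rightarrow> real"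
    unfolding avg4_def by (simp add: algebra_simps)
  have sum: "(\<Sum>v\<in>Basis. avg4 d (f v) \<eta>) = avg4 d (\<lambda>\<eta>. \<Sum>v\<in>Basis. f v \<eta>) \<eta>"
    for d \<eta> and f :: "stpoint \<Rightarrow> stpoint \<Rightarrow> real"
    unfolding avg4_def by (simp add: sum.distrib sum_distrib_left flip: sum_divide_distrib)
  have "(\<Sum>v\<in>Basis. (\<eta> \<bullet> v) * (P ((1 / N) *\<^sub>R \<eta>) \<bullet> v)) = 0" for \<eta>
  proof -
    have "\<eta> \<bullet> P ((1 / N) *\<^sub>R \<eta>) = 0"
      using assms(1)[of "(1 / N) *\<^sub>R \<eta>"] assms(2) by (simp add: inner_commute)
    then show ?thesis unfolding euclidean_inner[of \<eta> "P ((1 / N) *\<^sub>R \<eta>)"] .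
  qed
  then have "(\<Sum>v\<in>Basis. cos (\<eta> \<bullet> \<zeta>) * (\<eta> \<bullet> v) * (P ((1 / N) *\<^sub>R \<eta>) \<bullet> v)) = 0" for \<eta>
    by (simp add: mult.assoc flip: sum_distrib_left)
  then show ?thesis by (simp add: avg4_linear[OF lin] sum)
qed

text \<open>All frequencies in the average lie within a fixed distance R of N \<xi>, so after
  division by N they converge to \<xi>, where P is continuous. With the symbol frozen at P \<xi> the
  average is exactly the envelope times the sine.\<close>

lemma block_approx:
  fixes P :: "stpoint \<Rightarrow> 'v::real_normed_vector"
  assumes P: "continuous_on UNIV P" and "\<epsilon> > 0"
  shows "\<forall>\<^sub>F n in sequentially. \<forall>z.
     norm (block P a b \<xi> (real n) z - (bump a b z * sin (real n * (\<xi> \<bullet> (z - (1/2) *\<^sub>R (a + b))))) *\<^sub>R P \<xi>) \<le> \<epsilon>"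
proof -
  define d where "d = box_freq a b"
  define R where "R = 4 * norm (d 0) + 4 * norm (d 1) + 4 * norm (d 2)"
  have R: "R \<ge> 0" by (simp add: R_def)
  have "isCont P \<xi>" using P unfolding continuous_on_eq_continuous_at[OF open_UNIV] by blast
  then obtain \<delta> where \<delta>: "\<delta> > 0" "\<And>x. dist x \<xi> < \<delta> \<Longrightarrow> dist (P x) (P \<xi>) < \<epsilon>"
    unfolding continuous_at_eps_delta using assms(2) by metis
  have "norm (block P a b \<xi> (real n) z - (bump a b z * sin (real n * (\<xi> \<bullet> (z - (1/2) *\<^sub>R (a + b))))) *\<^sub>R P \<xi>) \<le> \<epsilon>"
    if n: "real n > R / \<delta>" for n z
  proof (cases "z \<in> cbox a b")
    case True
    define \<zeta> where "\<zeta> = z - (1/2) *\<^sub>R (a + b)"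
    have n0: "real n > 0" using n divide_nonneg_pos[OF R \<delta>(1)] by linarith
    define g where "g = (\<lambda>\<eta>. sin (\<eta> \<bullet> \<zeta>) *\<^sub>R (P ((1 / real n) *\<^sub>R \<eta>) - P \<xi>))"
    have bd: "norm (g \<eta>) \<le> \<epsilon>" if "norm (\<eta> - real n *\<^sub>R \<xi>) \<le> R" for \<eta>
    proof -
      have "dist ((1 / real n) *\<^sub>R \<eta>) \<xi> = norm ((1 / real n) *\<^sub>R (\<eta> - real n *\<^sub>R \<xi>))"
        using n0 by (simp add: dist_norm scaleR_diff_right)
      also have "\<dots> = norm (\<eta> - real n *\<^sub>R \<xi>) / real n" by simp
      also have "\<dots> \<le> R / real n" using that n0 by (intro divide_right_mono) auto
      also have "\<dots> < \<delta>" using n \<delta>(1) n0 by (simp add: field_simps)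
      finally have "dist (P ((1 / real n) *\<^sub>R \<eta>)) (P \<xi>) < \<epsilon>" by (rule \<delta>(2))
      then have "norm (P ((1 / real n) *\<^sub>R \<eta>) - P \<xi>) \<le> \<epsilon>" unfolding dist_norm by (rule less_imp_le)
      then have "\<bar>sin (\<eta> \<bullet> \<zeta>)\<bar> * norm (P ((1 / real n) *\<^sub>R \<eta>) - P \<xi>) \<le> 1 * \<epsilon>"
        using assms(2) by (intro mult_mono) auto
      then show ?thesis by (simp add: g_def)
    qed
    have "norm (avg_box a b g (real n *\<^sub>R \<xi>)) \<le> \<epsilon>"
    proof (intro avg4_norm_le bd)
      fix k0 k1 k2
      assume "norm (k0 - real n *\<^sub>R \<xi>) \<le> 4 * norm (box_freq a b 0)"
        "norm (k1 - k0) \<le> 4 * norm (box_freq a b 1)" "norm (k2 - k1) \<le> 4 * norm (box_freq a b 2)"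
      then show "norm (k2 - real n *\<^sub>R \<xi>) \<le> R"
        using norm_triangle_ineq[of "k2 - k1" "k1 - real n *\<^sub>R \<xi>"] norm_triangle_ineq[of "k1 - k0" "k0 - real n *\<^sub>R \<xi>"]
        unfolding R_def d_def by simp
    qed
    moreover have "avg_box a b g (real n *\<^sub>R \<xi>) = packet P a b \<xi> (real n) z
        - avg_box a b (\<lambda>\<eta>. sin (\<eta> \<bullet> \<zeta>) *\<^sub>R P \<xi>) (real n *\<^sub>R \<xi>)"
      unfolding packet_def g_def avg4_diff \<zeta>_def by (simp add: scaleR_diff_right)
    moreover have "avg_box a b (\<lambda>\<eta>. sin (\<eta> \<bullet> \<zeta>) *\<^sub>R P \<xi>) (real n *\<^sub>R \<xi>)
        = (bump a b z * sin (real n * (\<xi> \<bullet> \<zeta>))) *\<^sub>R P \<xi>"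
    proof -
      have c: "avg4 d (\<lambda>\<eta>. (s * sin (\<eta> \<bullet> \<zeta>)) *\<^sub>R P \<xi>) = (\<lambda>\<eta>. ((cos (d \<bullet> \<zeta>) ^ 4 * s) * sin (\<eta> \<bullet> \<zeta>)) *\<^sub>R P \<xi>)" for d s
        using avg4_sin[of d \<zeta> "s *\<^sub>R P \<xi>"] by (simp add: fun_eq_iff mult_ac)
      have "avg_box a b (\<lambda>\<eta>. (1 * sin (\<eta> \<bullet> \<zeta>)) *\<^sub>R P \<xi>) (real n *\<^sub>R \<xi>)
        = ((cos (box_freq a b 0 \<bullet> \<zeta>) ^ 4 * (cos (box_freq a b 1 \<bullet> \<zeta>) ^ 4 * (cos (box_freq a b 2 \<bullet> \<zeta>) ^ 4 * 1)))
            * sin ((real n *\<^sub>R \<xi>) \<bullet> \<zeta>)) *\<^sub>R P \<xi>"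
        by (simp only: c)
      then show ?thesis
        using True by (simp add: bump_def power_mult_distrib mult_ac flip: \<zeta>_def)
    qed
    ultimately show ?thesis using True by (simp add: block_def \<zeta>_def)
  qed (use assms(2) in \<open>auto simp: block_def bump_def\<close>)
  moreover have "\<forall>\<^sub>F n in sequentially. real n > R / \<delta>"
    using filterlim_real_sequentially by (simp add: filterlim_at_top_dense)
  ultimately show ?thesis by (auto elim!: eventually_mono)
qed

lemma continuous_bump:
  assumes "box a b \<noteq> {}"
  shows "continuous_on UNIV (bump a b)"
proof -
  define f where "f = (\<lambda>z. (cos (box_freq a b 0 \<bullet> (z - (1/2) *\<^sub>R (a + b))) * cos (box_freq a b 1 \<bullet> (z - (1/2) *\<^sub>R (a + b)))
       * cos (box_freq a b 2 \<bullet> (z - (1/2) *\<^sub>R (a + b)))) ^ 4)"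
  have "continuous_on (cbox a b \<union> (- box a b)) (\<lambda>z. if z \<in> cbox a b then f z else 0)"
  proof (rule continuous_on_cases)
    show "continuous_on (cbox a b) f" unfolding f_def by (intro continuous_intros)
    show "\<forall>x. x \<in> cbox a b \<and> x \<notin> cbox a b \<or> x \<in> - box a b \<and> x \<in> cbox a b \<longrightarrow> f x = 0"
    proof (intro allI impI)
      fix x assume "x \<in> cbox a b \<and> x \<notin> cbox a b \<or> x \<in> - box a b \<and> x \<in> cbox a b"
      then have "x \<notin> box a b" "x \<in> cbox a b" by blast+
      then show "f x = 0" using bump_face[OF assms, of x] unfolding bump_def f_def by presburger
    qed
  qed (auto simp: closed_Compl)
  moreover have "cbox a b \<union> (- box a b) = UNIV" using box_subset_cbox by auto
  moreover have "bump a b = (\<lambda>z. if z \<in> cbox a b then f z else 0)" by (auto simp: bump_def f_def)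
  ultimately show ?thesis by simp
qed

text \<open>On the concentric box of half the side lengths each phase is at most pi / 4 in size, so
  each of the three fourth powers is at least 1 / 4.\<close>

lemma bump_inner:
  assumes "box a b \<noteq> {}" "z \<in> cbox ((1/4) *\<^sub>R (3 *\<^sub>R a + b)) ((1/4) *\<^sub>R (a + 3 *\<^sub>R b))"
  shows "z \<in> cbox a b" "bump a b z \<ge> 1/64"
proof -
  have ab: "a \<bullet> v < b \<bullet> v" if "v \<in> Basis" for v using assms(1) that by (auto simp: box_ne_empty)
  have z: "(3 * (a \<bullet> v) + b \<bullet> v) / 4 \<le> z \<bullet> v" "z \<bullet> v \<le> (a \<bullet> v + 3 * (b \<bullet> v)) / 4" if "v \<in> Basis" for v
    using assms(2) that by (auto simp: mem_box inner_add_left)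
  show zz: "z \<in> cbox a b" unfolding mem_box
  proof (intro ballI conjI)
    fix v :: stpoint assume v: "v \<in> Basis"
    show "a \<bullet> v \<le> z \<bullet> v" "z \<bullet> v \<le> b \<bullet> v" using z[OF v] ab[OF v] by auto
  qed
  have c: "cos (box_freq a b i \<bullet> (z - (1/2) *\<^sub>R (a + b))) ^ 4 \<ge> 1/4" if i: "i \<in> {0,1,2}" for i
  proof -
    define v where "v = st_dir i"
    have v: "v \<in> Basis" using i unfolding Basis_stpoint v_def by auto
    define \<theta> where "\<theta> = box_freq a b i \<bullet> (z - (1/2) *\<^sub>R (a + b))"
    define l where "l = b \<bullet> v - a \<bullet> v"
    have l: "l > 0" using ab[OF v] by (simp add: l_def)
    have \<theta>: "\<theta> = pi * ((z \<bullet> v - (a \<bullet> v + b \<bullet> v) / 2) / l)"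
      unfolding \<theta>_def box_freq_def v_def[symmetric] l_def
      by (simp add: inner_diff_left inner_diff_right inner_add_right inner_commute)
    have "\<bar>(z \<bullet> v - (a \<bullet> v + b \<bullet> v) / 2) / l\<bar> \<le> 1/4"
      using z[OF v] l unfolding l_def abs_le_iff by (simp add: field_simps)
    then have "pi * \<bar>(z \<bullet> v - (a \<bullet> v + b \<bullet> v) / 2) / l\<bar> \<le> pi * (1/4)" by (rule mult_left_mono) simp
    then have "\<bar>\<theta>\<bar> \<le> pi / 4" unfolding \<theta> abs_mult by simp
    then have "cos (pi / 4) \<le> cos \<bar>\<theta>\<bar>" by (intro cos_monotone_0_pi_le) auto
    then have "sqrt 2 / 2 \<le> cos \<theta>" by (simp add: cos_45)
    then have "(sqrt 2 / 2) ^ 4 \<le> cos \<theta> ^ 4" by (intro power_mono) auto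
    then show ?thesis by (simp add: \<theta>_def power_divide power4_eq_xxxx)
  qed
  have "(1/4) * (1/4) * (1/4) \<le> cos (box_freq a b 0 \<bullet> (z - (1/2) *\<^sub>R (a + b))) ^ 4
      * cos (box_freq a b 1 \<bullet> (z - (1/2) *\<^sub>R (a + b))) ^ 4 * cos (box_freq a b 2 \<bullet> (z - (1/2) *\<^sub>R (a + b))) ^ 4"
    by (intro mult_mono c) auto
  then show "bump a b z \<ge> 1/64" using zz by (simp add: bump_def power_mult_distrib)
qed


subsection \<open>Oscillatory integrals\<close>

lemma integrable_continuous_bounded_support:
  fixes f :: "'a::euclidean_space \<Rightarrow> 'b::{banach, second_countable_topology}"
  assumes "continuous_on UNIV f" "bounded S" "\<And>x. x \<notin> S \<Longrightarrow> f x = 0"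
  shows "integrable lborel f"
proof -
  obtain K where K: "S \<subseteq> cball 0 K" using bounded_subset_ballD[OF assms(2), of 0] ball_subset_cball by blast
  have "integrable lborel (\<lambda>x. indicator (cball 0 K) x *\<^sub>R f x)"
    by (intro borel_integrable_compact continuous_on_subset[OF assms(1)]) auto
  also have "(\<lambda>x. indicator (cball 0 K) x *\<^sub>R f x) = f"
  proof
    fix x show "indicator (cball 0 K) x *\<^sub>R f x = f x"
      using K assms(3)[of x] by (cases "x \<in> S") auto
  qed
  finally show ?thesis .
qed

lemma lborel_integral_shift:
  fixes f :: "'a::euclidean_space \<Rightarrow> 'b::{banach, second_countable_topology}"
  assumes "f \<in> borel_measurable borel"
  shows "(LINT x|lborel. f (x + h)) = (LINT x|lborel. f x)"
proof -
  have "(LINT x|lborel. f x) = (LINT x|distr lborel borel ((+) h). f x)" by (simp only: lborel_distr_plus)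
  also have "\<dots> = (LINT x|lborel. f (h + x))" 
    by (subst integral_distr) (use assms in auto)
  finally show ?thesis by (simp add: add.commute)
qed

lemma lborel_integrable_shift:
  fixes f :: "'a::euclidean_space \<Rightarrow> 'b::{banach, second_countable_topology}"
  assumes "integrable lborel f"
  shows "integrable lborel (\<lambda>x. f (x + h))"
proof -
  have "integrable (distr lborel borel ((+) h)) f" using assms by (simp only: lborel_distr_plus)
  moreover have "f \<in> borel_measurable borel" using borel_measurable_integrable[OF assms] by simp
  ultimately show ?thesis by (subst (asm) integrable_distr_eq) (auto simp: add.commute)
qed

text \<open>Translating by half a period changes the sign of the oscillating factor.\<close>

lemma riemann_lebesgue:
  fixes g :: "'a::euclidean_space \<Rightarrow> real"
  assumes g: "continuous_on UNIV g" and S: "bounded S" "\<And>x. x \<notin> S \<Longrightarrow> g x = 0" and \<xi>: "\<xi> \<noteq> 0"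
  shows "(\<lambda>n. LINT x|lborel. g x * sin (real n * (\<xi> \<bullet> x) + c n)) \<longlonglongrightarrow> 0"
proof (rule LIMSEQ_I)
  fix \<epsilon> :: real assume \<epsilon>: "\<epsilon> > 0"
  obtain R where R: "R > 0" "S \<subseteq> cball 0 R" using bounded_subset_ballD[OF S(1), of 0] ball_subset_cball by blast
  \<comment> \<open>With |h| < 1 the sum of f and its translate lives in the ball of radius R + 1,
    and radius R + 2 leaves room for the translated points.\<close>
  define V where "V = measure lborel (cball (0::'a) (R + 1))"
  have V: "V \<ge> 0" by (simp add: V_def)
  have "uniformly_continuous_on (cball 0 (R + 2)) g"
    by (intro compact_uniformly_continuous continuous_on_subset[OF g]) auto
  then obtain \<delta> where \<delta>: "\<delta> > 0"
    "\<And>x y. x \<in> cball 0 (R + 2) \<Longrightarrow> y \<in> cball 0 (R + 2) \<Longrightarrow> dist y x < \<delta> \<Longrightarrow> dist (g y) (g x) < \<epsilon> / (V + 1)"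
    unfolding uniformly_continuous_on_def using \<epsilon> V by (metis add_nonneg_pos divide_pos_pos zero_less_one)
  define m where "m = min \<delta> 1"
  have m: "m > 0" "m \<le> \<delta>" "m \<le> 1" using \<delta>(1) by (auto simp: m_def)
  define N where "N = nat \<lceil>pi / (norm \<xi> * m)\<rceil> + 1"
  have "norm ((LINT x|lborel. g x * sin (real n * (\<xi> \<bullet> x) + c n)) - 0) < \<epsilon>" if n: "n \<ge> N" for n
  proof -
    have n0: "real n > 0" using n by (simp add: N_def)
    define h where "h = (pi / (real n * (norm \<xi>)\<^sup>2)) *\<^sub>R \<xi>"
    have "real n \<ge> real N" using n by simp
    then have n1: "real n > pi / (norm \<xi> * m)" unfolding N_def by linarith
    have "norm h = pi / (real n * norm \<xi>)" using \<xi> n0 by (simp add: h_def power2_eq_square)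
    also have "\<dots> < m" using n1 \<xi> m(1) n0 by (simp add: field_simps)
    finally have "norm h < m" .
    then have h: "norm h < \<delta>" "norm h < 1" using m by linarith+
    have hx: "real n * (\<xi> \<bullet> h) = pi" using \<xi> n0 by (simp add: h_def power2_norm_eq_inner)
    define I where "I = (LINT x|lborel. g x * sin (real n * (\<xi> \<bullet> x) + c n))"
    define f where "f = (\<lambda>x. g x * sin (real n * (\<xi> \<bullet> x) + c n))"
    have fi: "integrable lborel f"
      unfolding f_def using S by (intro integrable_continuous_bounded_support[of _ S] continuous_intros g) auto
    have fm: "f \<in> borel_measurable borel" using borel_measurable_integrable[OF fi] by simp
    have I1: "I = (LINT x|lborel. f (x + h))" unfolding lborel_integral_shift[OF fm] by (simp add: I_def f_def)
    have fh: "f (x + h) = - (g (x + h) * sin (real n * (\<xi> \<bullet> x) + c n))" for x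
    proof -
      have E: "real n * (\<xi> \<bullet> (x + h)) + c n = (real n * (\<xi> \<bullet> x) + c n) + pi"
        using hx by (simp add: inner_add_right algebra_simps)
      show ?thesis unfolding f_def E sin_periodic_pi by simp
    qed
    have "I = (LINT x|lborel. f x)" by (simp add: I_def f_def)
    \<comment> \<open>Adding the translated integral turns the integrand into (g x - g (x + h))
      times the sine, which uniform continuity makes small.\<close>
    with I1 have "2 * I = (LINT x|lborel. f x) + (LINT x|lborel. f (x + h))"
      by linarith
    also have "\<dots> = (LINT x|lborel. f x + f (x + h))"
      by (intro Bochner_Integration.integral_add[symmetric] fi lborel_integrable_shift)
    finally have I2: "2 * I = (LINT x|lborel. f x + f (x + h))" .
    have bd: "norm (f x + f (x + h)) \<le> indicator (cball 0 (R + 1)) x * (\<epsilon> / (V + 1))" for x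
    proof (cases "x \<in> cball 0 (R + 1)")
      case True
      have "norm (x + h) \<le> norm x + norm h" by (rule norm_triangle_ineq)
      then have "dist (g x) (g (x + h)) < \<epsilon> / (V + 1)"
      proof (intro \<delta>(2))
        show "x + h \<in> cball 0 (R + 2)" "x \<in> cball 0 (R + 2)"
          using True h \<open>norm (x + h) \<le> norm x + norm h\<close> unfolding mem_cball_0 by linarith+
        show "dist x (x + h) < \<delta>" using h by (simp add: dist_norm)
      qed
      moreover have "f x + f (x + h) = (g x - g (x + h)) * sin (real n * (\<xi> \<bullet> x) + c n)"
        unfolding fh by (simp add: f_def left_diff_distrib)
      moreover have "\<bar>(g x - g (x + h)) * sin (real n * (\<xi> \<bullet> x) + c n)\<bar> \<le> \<bar>g x - g (x + h)\<bar> * 1"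
        unfolding abs_mult by (intro mult_left_mono) auto
      ultimately show ?thesis using True by (simp add: dist_real_def)
    next
      case False
      have "norm x \<le> norm (x + h) + norm h" using norm_triangle_ineq4[of "x + h" h] by simp
      then have "x + h \<notin> S" "x \<notin> S" using False R h by (auto simp: subset_iff)
      then show ?thesis using False S(2) by (simp add: f_def)
    qed
    have ii: "integrable lborel (\<lambda>x::'a. indicator (cball 0 (R + 1)) x * (\<epsilon> / (V + 1)))"
      using emeasure_bounded_finite[of "cball (0::'a) (R + 1)"] by (intro integrable_mult_left integrable_real_indicator) auto
    have "norm (LINT x|lborel. f x + f (x + h)) \<le> (LINT x|lborel. indicator (cball (0::'a) (R + 1)) x * (\<epsilon> / (V + 1)))"
      by (intro Bochner_Integration.integral_norm_bound_integral[OF _ ii bd] Bochner_Integration.integrable_add fi lborel_integrable_shift[OF fi])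
    also have "\<dots> = V * (\<epsilon> / (V + 1))" by (simp add: V_def)
    also have "\<dots> < 2 * \<epsilon>"
    proof -
      have "V * \<epsilon> \<ge> 0" using V \<epsilon> by simp
      then have "V * \<epsilon> < 2 * \<epsilon> * (V + 1)" using \<epsilon> by (simp add: algebra_simps)
      moreover have "V + 1 > 0" using V by simp
      ultimately show ?thesis by (simp add: pos_divide_less_eq)
    qed
    finally have "norm (2 * I) < 2 * \<epsilon>" unfolding I2 .
    then have "norm I < \<epsilon>" by simp
    then show ?thesis unfolding I_def by simp
  qed
  then show "\<exists>no. \<forall>n\<ge>no. norm ((LINT x|lborel. g x * sin (real n * (\<xi> \<bullet> x) + c n)) - 0) < \<epsilon>"
    by (intro exI[of _ N] allI impI)
qed


subsection \<open>Weakly divergence-free fields in space-time\<close>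

abbreviation half_space :: "stpoint set" where
  "half_space \<equiv> {z. 0 \<le> fst z}"

lemma closed_half_space: "closed half_space"
  by (intro closed_Collect_le continuous_intros)

text \<open>By translation invariance of the Lebesgue measure, applied to difference quotients.\<close>

lemma integral_directional_derivative:
  fixes f f' :: "'a::euclidean_space \<Rightarrow> real"
  assumes f: "integrable lborel f" and f': "f' \<in> borel_measurable lborel"
    and S: "\<And>x. norm x > R \<Longrightarrow> f x = 0"
    and L: "\<And>x h. \<bar>f (x + h *\<^sub>R v) - f x\<bar> \<le> L * \<bar>h\<bar>"
    and D: "AE x in lborel. ((\<lambda>h. f (x + h *\<^sub>R v)) has_real_derivative f' x) (at 0)"
  shows "(LINT x|lborel. f' x) = 0"
proof -
  define h where "h = (\<lambda>n::nat. 1 / (real n + 1))"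
  have h0: "h n > 0" "h n \<le> 1" for n by (auto simp: h_def)
  have hlim: "h \<longlonglongrightarrow> 0" unfolding h_def by real_asymp
  have L0: "L \<ge> 0" using L[of 0 1] by linarith
  define s where "s = (\<lambda>n x. (f (x + h n *\<^sub>R v) - f x) / h n)"
  have fm: "f \<in> borel_measurable borel" using borel_measurable_integrable[OF f] by simp
  have si: "integrable lborel (s n)" for n
    unfolding s_def by (intro Bochner_Integration.integrable_diff integrable_divide f lborel_integrable_shift)
  have s0: "(LINT x|lborel. s n x) = 0" for n
  proof -
    have "(LINT x|lborel. f (x + h n *\<^sub>R v) - f x) = (LINT x|lborel. f (x + h n *\<^sub>R v)) - (LINT x|lborel. f x)"
      by (intro Bochner_Integration.integral_diff f lborel_integrable_shift)
    then show ?thesis unfolding s_def by (simp add: lborel_integral_shift[OF fm])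
  qed
  have "(\<lambda>n. LINT x|lborel. s n x) \<longlonglongrightarrow> (LINT x|lborel. f' x)"
  proof (rule integral_dominated_convergence[where w = "\<lambda>x. indicator (cball 0 (\<bar>R\<bar> + norm v)) x * L"])
    show "f' \<in> borel_measurable lborel" "s n \<in> borel_measurable lborel" for n
      using f' borel_measurable_integrable[OF si] by auto
    show "integrable lborel (\<lambda>x. indicator (cball 0 (\<bar>R\<bar> + norm v)) x * L)"
      using emeasure_bounded_finite[of "cball 0 (\<bar>R\<bar> + norm v)"]
      by (intro integrable_mult_left integrable_real_indicator) auto
    show "AE x in lborel. (\<lambda>n. s n x) \<longlonglongrightarrow> f' x"
      using D
    proof (rule eventually_mono)
      fix x assume "((\<lambda>h. f (x + h *\<^sub>R v)) has_real_derivative f' x) (at 0)"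
      then have "((\<lambda>t. (f (x + t *\<^sub>R v) - f x) / t) \<longlongrightarrow> f' x) (at 0)"
        unfolding has_field_derivative_iff by simp
      moreover have "filterlim h (at 0) sequentially"
        unfolding filterlim_at using hlim h0 by (auto intro!: always_eventually simp: less_imp_neq[symmetric])
      ultimately show "(\<lambda>n. s n x) \<longlonglongrightarrow> f' x" unfolding s_def by (rule filterlim_compose)
    qed
    show "AE x in lborel. norm (s n x) \<le> indicator (cball 0 (\<bar>R\<bar> + norm v)) x * L" for n
    proof (intro AE_I2)
      fix x
      show "norm (s n x) \<le> indicator (cball 0 (\<bar>R\<bar> + norm v)) x * L"
      proof (cases "x \<in> cball 0 (\<bar>R\<bar> + norm v)")
        case True
        have "\<bar>f (x + h n *\<^sub>R v) - f x\<bar> \<le> L * h n" using L[of x "h n"] h0[of n] by simp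
        then show ?thesis using True h0[of n] by (simp add: s_def abs_div pos_divide_le_eq)
      next
        case False
        have "norm (h n *\<^sub>R v) \<le> norm v" using h0[of n] by (simp add: mult_left_le_one_le)
        moreover have "norm x \<le> norm (x + h n *\<^sub>R v) + norm (h n *\<^sub>R v)"
          using norm_triangle_ineq4[of "x + h n *\<^sub>R v" "h n *\<^sub>R v"] by simp
        moreover have "norm x > \<bar>R\<bar> + norm v" using False by simp
        ultimately have "norm (x + h n *\<^sub>R v) > R" "norm x > R" using norm_ge_zero[of v] by linarith+
        then show ?thesis using False by (simp add: s_def S)
      qed
    qed
  qed
  then show ?thesis using s0 by (simp add: LIMSEQ_const_iff)
qed

text \<open>
  A field \<open>(f, g)\<close> with values in \<open>\<real> \<times> \<real>\<^sup>2\<close> stands for the conservation law \<open>\<partial>\<^sub>t f + div g = 0\<close>, so that the pairing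
  with the derivative of a test function is its weak form.  The identity is required after every
  time shift \<open>s\<close>, hence with every time slice as initial datum.
\<close>

definition c1_test :: "(stpoint \<Rightarrow> real) \<Rightarrow> (stpoint \<Rightarrow> stpoint \<Rightarrow> real) \<Rightarrow> bool" where
  "c1_test \<phi> \<phi>' \<longleftrightarrow>
     (\<forall>z\<in>half_space. (\<phi> has_derivative \<phi>' z) (at z within half_space)) \<and>
     (\<forall>v. continuous_on half_space (\<lambda>z. \<phi>' z v)) \<and>
     (\<exists>R. \<forall>z\<in>half_space. norm z > R \<longrightarrow> \<phi> z = 0 \<and> (\<forall>v. \<phi>' z v = 0))"

text \<open>The tests need not vanish at the edge of the support of F, so for a field supported in a
  piece the identity also says that nothing flows through the boundary of that piece.\<close>

definition weakly_div_free :: "(stpoint \<Rightarrow> stpoint) \<Rightarrow> bool" where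
  "weakly_div_free F \<longleftrightarrow> continuous_on UNIV F \<and> (\<exists>R. \<forall>z. norm z > R \<longrightarrow> F z = 0) \<and>
     (\<forall>s \<phi> \<phi>'. c1_test \<phi> \<phi>' \<longrightarrow>
        (LINT z|lborel. indicator half_space z * \<phi>' z (F (z + (s, 0)))) + (LINT x|lborel. fst (F (s, x)) * \<phi> (0, x)) = 0)"

lemma integrable_half_space:
  fixes g :: "stpoint \<Rightarrow> real"
  assumes "continuous_on half_space g" "\<And>z. z \<in> half_space \<Longrightarrow> norm z > R \<Longrightarrow> g z = 0"
  shows "integrable lborel (\<lambda>z. indicator half_space z * g z)"
proof -
  have "integrable lborel (\<lambda>z. indicator (half_space \<inter> cball 0 R) z *\<^sub>R g z)"
  proof (intro borel_integrable_compact)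
    show "compact (half_space \<inter> cball 0 R)"
      by (intro closed_Int_compact closed_half_space) auto
    show "continuous_on (half_space \<inter> cball 0 R) g"
      by (rule continuous_on_subset[OF assms(1)]) auto
  qed
  also have "(\<lambda>z. indicator (half_space \<inter> cball 0 R) z *\<^sub>R g z) = (\<lambda>z. indicator half_space z * g z)"
  proof
    fix z :: stpoint
    show "indicator (half_space \<inter> cball 0 R) z *\<^sub>R g z = indicator half_space z * g z"
      using assms(2)[of z] by (cases "z \<in> half_space"; cases "z \<in> cball 0 R") (auto simp: indicator_def)
  qed
  finally show ?thesis .
qed

lemma bounded_half_space:
  fixes g :: "stpoint \<Rightarrow> real"
  assumes "continuous_on half_space g" "\<And>z. z \<in> half_space \<Longrightarrow> norm z > R \<Longrightarrow> g z = 0"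
  obtains C where "C \<ge> 0" "\<And>z. z \<in> half_space \<Longrightarrow> \<bar>g z\<bar> \<le> C"
proof -
  have "compact (half_space \<inter> cball 0 R)"
    by (intro closed_Int_compact closed_half_space) auto
  then have "bounded (g ` (half_space \<inter> cball 0 R))"
    by (intro compact_imp_bounded compact_continuous_image continuous_on_subset[OF assms(1)]) auto
  then obtain C where "\<forall>y\<in>g ` (half_space \<inter> cball 0 R). \<bar>y\<bar> \<le> C"
    unfolding bounded_iff real_norm_def by blast
  then have C: "\<And>z. z \<in> half_space \<inter> cball 0 R \<Longrightarrow> \<bar>g z\<bar> \<le> C" by blast
  have "\<bar>g z\<bar> \<le> \<bar>C\<bar>" if "z \<in> half_space" for z
    using C[of z] assms(2)[of z] that by (cases "norm z > R") auto
  then show ?thesis using that[of "\<bar>C\<bar>"] by auto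
qed

lemma c1_test_D:
  assumes "c1_test \<phi> \<phi>'"
  shows "continuous_on half_space \<phi>" "\<And>z. z \<in> half_space \<Longrightarrow> linear (\<phi>' z)"
    "\<And>z. z \<in> half_space \<Longrightarrow> (\<phi> has_derivative \<phi>' z) (at z within half_space)"
    "\<And>v. continuous_on half_space (\<lambda>z. \<phi>' z v)"
proof -
  show D: "\<And>z. z \<in> half_space \<Longrightarrow> (\<phi> has_derivative \<phi>' z) (at z within half_space)"
    using assms unfolding c1_test_def by blast
  show "continuous_on half_space \<phi>" using has_derivative_continuous_on[of half_space \<phi> \<phi>'] D by blast
  show "\<And>z. z \<in> half_space \<Longrightarrow> linear (\<phi>' z)"
    using D has_derivative_linear by blast
  show "\<And>v. continuous_on half_space (\<lambda>z. \<phi>' z v)" using assms unfolding c1_test_def by blast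
qed

lemma c1_test_pairing:
  assumes t: "c1_test \<phi> \<phi>'" and z: "z \<in> half_space"
  shows "\<phi>' z y = (\<Sum>v\<in>Basis. (y \<bullet> v) * \<phi>' z v)"
proof -
  have "\<phi>' z (\<Sum>v\<in>Basis. (y \<bullet> v) *\<^sub>R v) = (\<Sum>v\<in>Basis. \<phi>' z ((y \<bullet> v) *\<^sub>R v))"
    by (rule linear_sum[OF c1_test_D(2)[OF t z]])
  also have "\<dots> = (\<Sum>v\<in>Basis. (y \<bullet> v) * \<phi>' z v)"
    by (simp add: linear_scale[OF c1_test_D(2)[OF t z]])
  finally show ?thesis by (simp add: euclidean_representation)
qed

lemma continuous_c1_test_pairing:
  assumes t: "c1_test \<phi> \<phi>'" and F: "continuous_on half_space F"
  shows "continuous_on half_space (\<lambda>z. \<phi>' z (F z))"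
proof -
  have "continuous_on half_space (\<lambda>z. \<Sum>v\<in>Basis. (F z \<bullet> v) * \<phi>' z v)"
    by (intro continuous_intros F c1_test_D(4)[OF t])
  then show ?thesis
    by (rule continuous_on_eq) (simp add: c1_test_pairing[OF t])
qed

text \<open>A line without time component stays in the half space, so the derivative within the half
  space is a full two-sided derivative along it, even at time 0. The mean value inequality then
  gives the Lipschitz bound.\<close>

lemma c1_test_line_lipschitz:
  assumes t: "c1_test \<phi> \<phi>'" and v: "fst v = 0"
    and C: "\<And>z. z \<in> half_space \<Longrightarrow> \<bar>\<phi>' z v\<bar> \<le> C" and z: "z \<in> half_space"
  shows "\<bar>\<phi> (z + h *\<^sub>R v) - \<phi> z\<bar> \<le> C * \<bar>h\<bar>"
    "((\<lambda>h. \<phi> (z + h *\<^sub>R v)) has_real_derivative \<phi>' z v) (at 0)"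
proof -
  have D: "((\<lambda>s. \<phi> (z + s *\<^sub>R v)) has_real_derivative \<phi>' (z + s *\<^sub>R v) v) (at s)" for s
  proof -
    have m: "z + s *\<^sub>R v \<in> half_space" for s using z v by simp
    have fd: "((\<lambda>s. z + s *\<^sub>R v) has_derivative (\<lambda>h. h *\<^sub>R v)) (at s)"
      by (auto intro!: derivative_eq_intros)
    have "((\<lambda>s. \<phi> (z + s *\<^sub>R v)) has_derivative (\<lambda>h. \<phi>' (z + s *\<^sub>R v) (h *\<^sub>R v))) (at s)"
      by (rule has_derivative_in_compose2[OF c1_test_D(3)[OF t] _ UNIV_I fd]) (use m in blast)+
    then show ?thesis
      by (rule has_derivative_imp_has_field_derivative) (simp add: linear_scale[OF c1_test_D(2)[OF t m]])
  qed
  show "((\<lambda>h. \<phi> (z + h *\<^sub>R v)) has_real_derivative \<phi>' z v) (at 0)" using D[of 0] by simp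
  have "norm (\<phi> (z + h *\<^sub>R v) - \<phi> (z + 0 *\<^sub>R v)) \<le> C * norm (h - 0)"
  proof (rule field_differentiable_bound[of UNIV])
    fix s show "((\<lambda>s. \<phi> (z + s *\<^sub>R v)) has_field_derivative \<phi>' (z + s *\<^sub>R v) v) (at s within UNIV)"
      using D[of s] by simp
    show "norm (\<phi>' (z + s *\<^sub>R v) v) \<le> C" using C[of "z + s *\<^sub>R v"] z v by simp
  qed auto
  then show "\<bar>\<phi> (z + h *\<^sub>R v) - \<phi> z\<bar> \<le> C * \<bar>h\<bar>" by simp
qed

section \<open>Integration by parts for Lipschitz fields supported in a box\<close>

lemma mem_box_pair:
  fixes a b :: "real \<times> 'a::euclidean_space"
  shows "(s, x) \<in> box a b \<longleftrightarrow> fst a < s \<and> s < fst b \<and> x \<in> box (snd a) (snd b)"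
  by (auto simp: mem_box Basis_prod_def inner_prod_def ball_Un)

text \<open>Tailored to the blocks: derivatives may jump across the faces of the box, while the
  field itself is Lipschitz on the whole space. \<open>F'\<close> is tied to F only inside the
  box.\<close>

locale compact_div_free =
  fixes F :: "stpoint \<Rightarrow> stpoint" and F' :: "stpoint \<Rightarrow> stpoint \<Rightarrow> stpoint" and a b :: stpoint and L :: real
  assumes lip: "L-lipschitz_on UNIV F"
    and out: "\<And>z. z \<notin> box a b \<Longrightarrow> F z = 0"
    and der: "\<And>z. z \<in> box a b \<Longrightarrow> (F has_derivative F' z) (at z)"
    and cont': "\<And>v. continuous_on UNIV (\<lambda>z. F' z v)"
    and div0: "\<And>z. z \<in> box a b \<Longrightarrow> (\<Sum>v\<in>Basis. F' z v \<bullet> v) = 0"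
begin

lemma contF: "continuous_on UNIV F" using lip by (rule lipschitz_on_continuous_on)

lemma bounded_support: obtains R where "R > 0" "box a b \<subseteq> ball 0 R" "\<And>z. norm z \<ge> R \<Longrightarrow> F z = 0"
proof -
  obtain R where R: "R > 0" "box a b \<subseteq> ball 0 R" using bounded_subset_ballD[of "box a b" 0] bounded_box[of a b] by blast
  have "F z = 0" if "norm z \<ge> R" for z
  proof (rule out, rule notI)
    assume "z \<in> box a b"
    then have "z \<in> ball 0 R" using R(2) by blast
    then show False using that by simp
  qed
  then show ?thesis by (rule that[OF R])
qed

context
  fixes \<phi> \<phi>' assumes t: "c1_test \<phi> \<phi>'"
begin

text \<open>The derivative along v of (F \<bullet> v) \<phi>, cut to the half space and the box. In
  the sum over the basis the first terms add up to the divergence of F and drop out, which leaves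
  the pairing.\<close>

definition D where
  "D v z = indicator (half_space \<inter> box a b) z * ((F' z v \<bullet> v) * \<phi> z + (F z \<bullet> v) * \<phi>' z v)"

lemma D_integrable: "integrable lborel (D v)"
proof -
  have "continuous_on half_space (\<lambda>z. (F' z v \<bullet> v) * \<phi> z + (F z \<bullet> v) * \<phi>' z v)"
    by (intro continuous_intros c1_test_D[OF t] continuous_on_subset[OF cont'] continuous_on_subset[OF contF]) auto
  then have "continuous_on (half_space \<inter> cbox a b) (\<lambda>z. (F' z v \<bullet> v) * \<phi> z + (F z \<bullet> v) * \<phi>' z v)"
    by (rule continuous_on_subset) blast
  then have "integrable lborel (\<lambda>z. indicator (half_space \<inter> cbox a b) z *\<^sub>R ((F' z v \<bullet> v) * \<phi> z + (F z \<bullet> v) * \<phi>' z v))"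
    by (intro borel_integrable_compact closed_Int_compact closed_half_space compact_cbox)
  then have "integrable lborel (\<lambda>z. indicator (box a b) z *\<^sub>R (indicator (half_space \<inter> cbox a b) z *\<^sub>R ((F' z v \<bullet> v) * \<phi> z + (F z \<bullet> v) * \<phi>' z v)))"
    by (rule integrable_mult_indicator[rotated]) auto
  moreover have "indicator (box a b) z *\<^sub>R (indicator (half_space \<inter> cbox a b) z *\<^sub>R y) = indicator (half_space \<inter> box a b) z * y"
    for z and y :: real
    using box_subset_cbox[of a b] by (auto simp: indicator_def)
  ultimately show ?thesis unfolding D_def[abs_def] by (simp only:)
qed

lemma D_sum: "(\<Sum>v\<in>Basis. D v z) = indicator half_space z * \<phi>' z (F z)"
proof (cases "z \<in> half_space")
  case z: True
  show ?thesis
  proof (cases "z \<in> box a b")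
    case True
    have "(\<Sum>v\<in>Basis. D v z) = (\<Sum>v\<in>Basis. F' z v \<bullet> v) * \<phi> z + (\<Sum>v\<in>Basis. (F z \<bullet> v) * \<phi>' z v)"
      using z True by (simp add: D_def sum.distrib sum_distrib_right)
    then show ?thesis using z div0[OF True] c1_test_pairing[OF t z, of "F z"] by simp
  next
    case False
    then have "\<phi>' z (F z) = 0" using out[OF False] linear_0[OF c1_test_D(2)[OF t z]] by simp
    then show ?thesis using False by (simp add: D_def)
  qed
qed (simp add: D_def)

text \<open>Translations along v preserve the half space, so the product (F \<bullet> v) \<phi> cut
  to it is Lipschitz along v and no boundary term arises.\<close>

lemma D_space:
  assumes v: "v \<in> Basis" "fst v = 0"
  shows "(LINT z|lborel. D v z) = 0"
proof -
  obtain R where R: "R > 0" "box a b \<subseteq> ball 0 R" "\<And>z. norm z \<ge> R \<Longrightarrow> F z = 0" by (rule bounded_support) blast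
  obtain R' where R': "\<And>z. z \<in> half_space \<Longrightarrow> norm z > R' \<Longrightarrow> \<phi> z = 0 \<and> (\<forall>v. \<phi>' z v = 0)"
    using t unfolding c1_test_def by blast
  obtain C0 where C0: "C0 \<ge> 0" "\<And>z. z \<in> half_space \<Longrightarrow> \<bar>\<phi> z\<bar> \<le> C0"
    using bounded_half_space[OF c1_test_D(1)[OF t]] R' by metis
  obtain C1 where C1: "C1 \<ge> 0" "\<And>z. z \<in> half_space \<Longrightarrow> \<bar>\<phi>' z v\<bar> \<le> C1"
    using bounded_half_space[OF c1_test_D(4)[OF t, of v]] R' by metis
  have cFv: "continuous_on half_space (\<lambda>z. F z \<bullet> v)"
    by (intro continuous_intros continuous_on_subset[OF contF]) auto
  obtain M where M: "M \<ge> 0" "\<And>z. z \<in> half_space \<Longrightarrow> \<bar>F z \<bullet> v\<bar> \<le> M"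
    using bounded_half_space[OF cFv, of R] R(3) by (metis inner_zero_left less_imp_le)
  define f where "f = (\<lambda>z. indicator half_space z * ((F z \<bullet> v) * \<phi> z))"
  have nv: "norm v = 1" using v by simp
  have L0: "L \<ge> 0" using lip by (rule lipschitz_on_nonneg)
  have Fl: "\<bar>F (z + h *\<^sub>R v) \<bullet> v - F z \<bullet> v\<bar> \<le> L * \<bar>h\<bar>" for z h
  proof -
    have "\<bar>F (z + h *\<^sub>R v) \<bullet> v - F z \<bullet> v\<bar> \<le> norm (F (z + h *\<^sub>R v) - F z) * norm v"
      using Cauchy_Schwarz_ineq2[of "F (z + h *\<^sub>R v) - F z" v] by (simp add: inner_diff_left)
    also have "\<dots> \<le> L * \<bar>h\<bar>"
      using lipschitz_onD[OF lip, of "z + h *\<^sub>R v" z] by (simp add: dist_norm nv)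
    finally show ?thesis .
  qed
  have m: "z + h *\<^sub>R v \<in> half_space \<longleftrightarrow> z \<in> half_space" for z h using v by simp
  show ?thesis
  proof (rule integral_directional_derivative[of f _ R v "L * C0 + M * C1"])
    show "integrable lborel f" unfolding f_def
      by (rule integrable_half_space[of _ R])
        (use R(3) in \<open>auto intro!: continuous_intros c1_test_D[OF t] continuous_on_subset[OF contF]\<close>)
    show "D v \<in> borel_measurable lborel" using D_integrable by (rule borel_measurable_integrable)
    show "f z = 0" if "norm z > R" for z using R(3)[of z] that by (simp add: f_def)
    show "\<bar>f (z + h *\<^sub>R v) - f z\<bar> \<le> (L * C0 + M * C1) * \<bar>h\<bar>" for z h
    proof (cases "z \<in> half_space")
      case True
      have "f (z + h *\<^sub>R v) - f z = (F (z + h *\<^sub>R v) \<bullet> v - F z \<bullet> v) * \<phi> (z + h *\<^sub>R v) + (F z \<bullet> v) * (\<phi> (z + h *\<^sub>R v) - \<phi> z)"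
        using True m[of z h] unfolding f_def by (simp add: algebra_simps)
      also have "\<bar>\<dots>\<bar> \<le> \<bar>F (z + h *\<^sub>R v) \<bullet> v - F z \<bullet> v\<bar> * \<bar>\<phi> (z + h *\<^sub>R v)\<bar> + \<bar>F z \<bullet> v\<bar> * \<bar>\<phi> (z + h *\<^sub>R v) - \<phi> z\<bar>"
        unfolding abs_mult[symmetric] by (rule abs_triangle_ineq)
      also have "\<dots> \<le> (L * \<bar>h\<bar>) * C0 + M * (C1 * \<bar>h\<bar>)"
        using True m[of z h] C0 M C1 L0
        by (intro add_mono mult_mono Fl c1_test_line_lipschitz(1)[OF t v(2) C1(2)]) auto
      finally show ?thesis by (simp add: algebra_simps)
    next
      case False
      then show ?thesis using m[of z h] L0 C0 M C1 unfolding f_def by simp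
    qed
    \<comment> \<open>Off the null set of faces a point lies in the open box, where the product rule
      applies, or in the open exterior, where the product vanishes nearby.\<close>
    have "AE z in lborel. z \<notin> cbox a b - box a b"
    proof (rule AE_not_in)
      have "cbox a b - box a b \<in> null_sets lebesgue"
        using negligible_frontier_interval[of a b] by (simp add: negligible_iff_null_sets)
      then show "cbox a b - box a b \<in> null_sets lborel"
        by (subst (asm) null_sets_completion_iff) auto
    qed
    then show "AE z in lborel. ((\<lambda>h. f (z + h *\<^sub>R v)) has_real_derivative D v z) (at 0)"
    proof (rule eventually_mono)
      fix z assume z: "z \<notin> cbox a b - box a b"
      show "((\<lambda>h. f (z + h *\<^sub>R v)) has_real_derivative D v z) (at 0)"
      proof (cases "z \<in> half_space")
        case hs: True
        show ?thesis
        proof (cases "z \<in> box a b")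
          case True
          have "((\<lambda>h. F (z + h *\<^sub>R v) \<bullet> v) has_derivative (\<lambda>h. F' z (h *\<^sub>R v) \<bullet> v)) (at 0)"
            by (rule has_derivative_inner_left, rule has_derivative_compose[of "\<lambda>h. z + h *\<^sub>R v" _ _ _ F, simplified])
              (use der[OF True] in \<open>auto intro!: derivative_eq_intros\<close>)
          then have 1: "((\<lambda>h. F (z + h *\<^sub>R v) \<bullet> v) has_real_derivative (F' z v \<bullet> v)) (at 0)"
            by (rule has_derivative_imp_has_field_derivative)
              (simp add: linear_scale[OF has_derivative_linear[OF der[OF True]]])
          have "((\<lambda>h. (F (z + h *\<^sub>R v) \<bullet> v) * \<phi> (z + h *\<^sub>R v)) has_real_derivative D v z) (at 0)"
            using DERIV_mult[OF 1 c1_test_line_lipschitz(2)[OF t v(2) C1(2) hs]] hs True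
            by (simp add: D_def mult_ac add_ac)
          moreover have "f (z + h *\<^sub>R v) = (F (z + h *\<^sub>R v) \<bullet> v) * \<phi> (z + h *\<^sub>R v)" for h
            using hs m[of z h] by (simp add: f_def)
          ultimately show ?thesis by simp
        next
          case False
          then have "z \<in> - cbox a b" using z by blast
          then obtain e where e: "e > 0" "ball z e \<subseteq> - cbox a b"
            using open_contains_ball[of "- cbox a b"] by (auto simp: open_Compl)
          have "((\<lambda>h. 0) has_real_derivative D v z) (at 0)" using False by (simp add: D_def)
          then show ?thesis
          proof (rule has_field_derivative_transform_within[OF _ e(1)])
            fix h :: real assume "dist h 0 < e"
            then have "z + h *\<^sub>R v \<in> ball z e" by (simp add: dist_norm nv)
            then have "z + h *\<^sub>R v \<notin> box a b" using e(2) box_subset_cbox[of a b] by blast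
            then show "0 = f (z + h *\<^sub>R v)" by (simp add: f_def out)
          qed simp
        qed
      next
        case False
        then have "f (z + h *\<^sub>R v) = 0" for h using m[of z h] unfolding f_def by simp
        then show ?thesis using False by (simp add: D_def)
      qed
    qed
  qed
qed

text \<open>Fundamental theorem of calculus on a time line. At the late end F vanishes, so only the
  slice at time 0 contributes.\<close>

lemma D_time_line: "((\<lambda>s. D (1, 0) (s, x)) has_integral (- (fst (F (0, x)) * \<phi> (0, x)))) UNIV"
proof -
  obtain R where R: "R > 0" "box a b \<subseteq> ball 0 R" "\<And>z. norm z \<ge> R \<Longrightarrow> F z = 0" by (rule bounded_support) blast
  define f where "f = (\<lambda>s. fst (F (s, x)) * \<phi> (s, x))"
  have big: "norm (s, x) \<ge> R" if "s \<ge> R" for s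
    using that R(1) norm_fst_le[of s x] by simp
  have "((\<lambda>s. D (1, 0) (s, x)) has_integral (f R - f 0)) {0..R}"
  \<comment> \<open>For x in the open spatial cross-section the line crosses faces only at the times
    \<open>fst a\<close> and \<open>fst b\<close>; for other x it never enters the open box.\<close>
  proof (rule fundamental_theorem_of_calculus_interior_strong[of "{fst a, fst b}"])
    show "continuous_on {0..R} f" unfolding f_def
      by (intro continuous_intros continuous_on_compose2[OF contF] continuous_on_compose2[OF c1_test_D(1)[OF t]]) auto
    fix s assume s: "s \<in> {0<..<R} - {fst a, fst b}"
    show "(f has_vector_derivative D (1, 0) (s, x)) (at s)"
    proof (cases "(s, x) \<in> box a b")
      case True
      have 1: "((\<lambda>s. F (s, x)) has_derivative (\<lambda>h. F' (s, x) (h, 0))) (at s)"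
        by (rule has_derivative_compose[of "\<lambda>s. (s, x)" _ _ _ F, simplified])
          (use der[OF True] in \<open>auto intro!: derivative_eq_intros\<close>)
      have fd: "((\<lambda>s. (s, x)) has_derivative (\<lambda>h. (h, 0))) (at s within {0<..})"
        by (auto intro!: derivative_eq_intros)
      have "((\<lambda>s. \<phi> (s, x)) has_derivative (\<lambda>h. \<phi>' (s, x) (h, 0))) (at s within {0<..})"
        by (rule has_derivative_in_compose2[OF c1_test_D(3)[OF t] _ _ fd]) (use s in auto)
      then have 2: "((\<lambda>s. \<phi> (s, x)) has_derivative (\<lambda>h. \<phi>' (s, x) (h, 0))) (at s)"
        using s by (simp add: at_within_open[of s "{0<..}"])
      have l1: "F' (s, x) (h, 0) = h *\<^sub>R F' (s, x) (1, 0)" for h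
        using linear_scale[OF has_derivative_linear[OF der[OF True]], of h "(1, 0)"] by simp
      have l2: "\<phi>' (s, x) (h, 0) = h * \<phi>' (s, x) (1, 0)" for h
        using linear_scale[OF c1_test_D(2)[OF t, of "(s, x)"], of h "(1, 0)"] s by simp
      have "(f has_derivative (\<lambda>h. fst (F (s, x)) * \<phi>' (s, x) (h, 0) + fst (F' (s, x) (h, 0)) * \<phi> (s, x))) (at s)"
        unfolding f_def by (intro has_derivative_mult has_derivative_fst 1 2)
      moreover have "fst (F (s, x)) * \<phi>' (s, x) (h, 0) + fst (F' (s, x) (h, 0)) * \<phi> (s, x) = h *\<^sub>R D (1, 0) (s, x)" for h
        unfolding l1[of h] l2[of h] using s True by (simp add: D_def inner_prod_def algebra_simps)
      ultimately show ?thesis unfolding has_vector_derivative_def by simp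
    next
      case False
      have "\<exists>e>0. \<forall>s'. dist s' s < e \<longrightarrow> (s', x) \<notin> box a b"
      proof (cases "s < fst a \<or> s > fst b \<or> x \<notin> box (snd a) (snd b)")
        case True
        then consider "s < fst a" | "s > fst b" | "x \<notin> box (snd a) (snd b)" by blast
        then show ?thesis
        proof cases
          case 1
          then show ?thesis by (intro exI[of _ "fst a - s"]) (auto simp: dist_real_def mem_box_pair)
        next
          case 2
          then show ?thesis by (intro exI[of _ "s - fst b"]) (auto simp: dist_real_def mem_box_pair)
        next
          case 3
          then show ?thesis by (intro exI[of _ 1]) (auto simp: mem_box_pair)
        qed
      next
        case F: False
        then have "(s, x) \<in> box a b" using s by (auto simp: mem_box_pair)
        then show ?thesis using False by blast
      qed
      then obtain e where e: "e > 0" "\<And>s'. dist s' s < e \<Longrightarrow> (s', x) \<notin> box a b" by blast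
      have "((\<lambda>s. 0) has_vector_derivative D (1, 0) (s, x)) (at s)" using False by (simp add: D_def)
      then show ?thesis
        by (rule has_vector_derivative_transform_within[OF _ e(1)]) (use e in \<open>auto simp: f_def out\<close>)
    qed
  qed (use R in auto)
  moreover have "f R = 0" using R(3)[OF big] by (simp add: f_def)
  ultimately have "((\<lambda>s. D (1, 0) (s, x)) has_integral (- f 0)) {0..R}" by simp
  then have "((\<lambda>s. D (1, 0) (s, x)) has_integral (- f 0)) UNIV"
  proof (rule has_integral_on_superset)
    fix s assume s: "s \<notin> {0..R}"
    have "(s, x) \<notin> half_space \<inter> box a b"
    proof
      assume m: "(s, x) \<in> half_space \<inter> box a b"
      then have "(s, x) \<in> ball 0 R" using R(2) by blast
      then have "norm (s, x) < R" by simp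
      moreover have "s \<ge> R" using m s by simp
      ultimately show False using big[of s] by simp
    qed
    then show "D (1, 0) (s, x) = 0" by (simp add: D_def)
  qed auto
  then show ?thesis by (simp add: f_def)
qed

lemma D_time: "(LINT z|lborel. D (1, 0) z) = - (LINT x|lborel. fst (F (0, x)) * \<phi> (0, x))"
proof -
  have i: "integrable (lborel \<Otimes>\<^sub>M lborel) (\<lambda>(s, x). D (1, 0) (s, x))"
    using D_integrable[of "(1, 0)"] by (simp add: lborel_prod)
  have "(LINT z|lborel. D (1, 0) z) = (LINT x|lborel. LINT s|lborel. D (1, 0) (s, x))"
    using lborel_pair.integral_snd[OF i] by (simp add: lborel_prod)
  also have "\<dots> = (LINT x|lborel. - (fst (F (0, x)) * \<phi> (0, x)))"
  proof (rule integral_cong_AE)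
    show "(\<lambda>x. LINT s|lborel. D (1, 0) (s, x)) \<in> borel_measurable lborel"
      using lborel_pair.integrable_snd[OF i] by (rule borel_measurable_integrable)
    have "continuous_on UNIV (\<lambda>x. - (fst (F (0, x)) * \<phi> (0, x)))"
      by (intro continuous_intros continuous_on_compose2[OF contF] continuous_on_compose2[OF c1_test_D(1)[OF t]]) auto
    then show "(\<lambda>x. - (fst (F (0, x)) * \<phi> (0, x))) \<in> borel_measurable lborel"
      unfolding measurable_lborel2 by (rule borel_measurable_continuous_onI)
    show "AE x in lborel. (LINT s|lborel. D (1, 0) (s, x)) = - (fst (F (0, x)) * \<phi> (0, x))"
      using lborel_pair.AE_integrable_snd[OF i]
    proof (rule eventually_mono)
      fix x assume "integrable lborel (\<lambda>s. D (1, 0) (s, x))"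
      from has_integral_unique[OF has_integral_integral_lborel[OF this] D_time_line]
      show "(LINT s|lborel. D (1, 0) (s, x)) = - (fst (F (0, x)) * \<phi> (0, x))" .
    qed
  qed
  finally show ?thesis by simp
qed

lemma balance_at_0:
  "(LINT z|lborel. indicator half_space z * \<phi>' z (F z)) + (LINT x|lborel. fst (F (0, x)) * \<phi> (0, x)) = 0"
proof -
  have "(LINT z|lborel. indicator half_space z * \<phi>' z (F z)) = (\<Sum>v\<in>Basis. LINT z|lborel. D v z)"
    unfolding D_sum[symmetric] by (rule Bochner_Integration.integral_sum) (rule D_integrable)
  also have "\<dots> = (LINT z|lborel. D (1, 0) z)"
  proof -
    have b: "st_dir 1 \<in> Basis" "st_dir 2 \<in> Basis" "fst (st_dir 1) = 0" "fst (st_dir 2) = 0"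
      unfolding Basis_stpoint by (auto simp: st_dir_def)
    have 0: "(LINT z|lborel. D (st_dir 1) z) = 0" "(LINT z|lborel. D (st_dir 2) z) = 0"
      using D_space[of "st_dir 1"] D_space[of "st_dir 2"] b by auto
    show ?thesis unfolding Basis_stpoint using 0 st_dir_distinct by (simp add: st_dir_def)
  qed
  finally show ?thesis using D_time by simp
qed

end

end

text \<open>Translation in time reduces the balance starting at time s to the balance starting at
  time 0.\<close>

lemma compact_div_free_shift:
  assumes "compact_div_free F F' a b L"
  shows "compact_div_free (\<lambda>z. F (z + c)) (\<lambda>z. F' (z + c)) (a - c) (b - c) L"
proof -
  interpret compact_div_free F F' a b L by (rule assms)
  have m: "z + c \<in> box a b \<longleftrightarrow> z \<in> box (a - c) (b - c)" for z
    by (simp add: mem_box inner_diff_left inner_add_left algebra_simps)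
  show ?thesis
  proof
    show "L-lipschitz_on UNIV (\<lambda>z. F (z + c))"
    proof (rule lipschitz_onI[OF _ lipschitz_on_nonneg[OF lip]])
      show "dist (F (x + c)) (F (y + c)) \<le> L * dist x y" for x y
        using lipschitz_onD[OF lip, of "x + c" "y + c"] by (simp add: dist_norm)
    qed
    show "\<And>z. z \<notin> box (a - c) (b - c) \<Longrightarrow> F (z + c) = 0" using out m by blast
    show "((\<lambda>z. F (z + c)) has_derivative F' (z + c)) (at z)" if "z \<in> box (a - c) (b - c)" for z
      by (rule has_derivative_compose[of "\<lambda>z. z + c" _ _ _ F, simplified])
        (use der[of "z + c"] that m in \<open>auto intro!: derivative_eq_intros\<close>)
    show "continuous_on UNIV (\<lambda>z. F' (z + c) v)" for v
      by (rule continuous_on_compose2[OF cont'[of v]]) (auto intro!: continuous_intros)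
    show "(\<Sum>v\<in>Basis. F' (z + c) v \<bullet> v) = 0" if "z \<in> box (a - c) (b - c)" for z
      using div0 m that by blast
  qed
qed

lemma (in compact_div_free) weakly_div_free: "weakly_div_free F"
  unfolding weakly_div_free_def
proof (intro conjI allI impI)
  show "continuous_on UNIV F" by (rule contF)
  show "\<exists>R. \<forall>z. norm z > R \<longrightarrow> F z = 0" by (rule bounded_support) (meson less_imp_le)
  fix s \<phi> \<phi>' assume "c1_test \<phi> \<phi>'"
  then show "(LINT z|lborel. indicator half_space z * \<phi>' z (F (z + (s, 0)))) + (LINT x|lborel. fst (F (s, x)) * \<phi> (0, x)) = 0"
    using compact_div_free.balance_at_0[OF compact_div_free_shift[OF compact_div_free_axioms, of "(s, 0)"]] by simp
qed

lemma weakly_div_free_block: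
  fixes P :: "stpoint \<Rightarrow> stpoint"
  assumes "box a b \<noteq> {}" "fourth_diff_zero P" "\<And>\<eta>. P \<eta> \<bullet> \<eta> = 0" "N \<noteq> 0"
  shows "weakly_div_free (block P a b \<xi> N)"
proof -
  obtain L where L: "L-lipschitz_on UNIV (block P a b \<xi> N)" using block_lipschitz[OF assms(1,2)] by blast
  have "compact_div_free (block P a b \<xi> N) (\<lambda>z h. avg_box a b
     (\<lambda>\<eta>. (cos (\<eta> \<bullet> (z - (1/2) *\<^sub>R (a + b))) * (\<eta> \<bullet> h)) *\<^sub>R P ((1 / N) *\<^sub>R \<eta>)) (N *\<^sub>R \<xi>)) a b L"
  proof
    show "continuous_on UNIV (\<lambda>z. avg_box a b
     (\<lambda>\<eta>. (cos (\<eta> \<bullet> (z - (1/2) *\<^sub>R (a + b))) * (\<eta> \<bullet> v)) *\<^sub>R P ((1 / N) *\<^sub>R \<eta>)) (N *\<^sub>R \<xi>))" for v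
      unfolding avg4_def by (intro continuous_intros)
  qed (rule L block_face[OF assms(1,2)] block_has_derivative block_divergence[OF assms(3,4)]; assumption)+
  then show ?thesis by (rule compact_div_free.weakly_div_free)
qed

lemma weakly_div_free_integrable:
  assumes F: "weakly_div_free F" and t: "c1_test \<phi> \<phi>'"
  shows "integrable lborel (\<lambda>z. indicator half_space z * \<phi>' z (F (z + (s, 0))))"
    "integrable lborel (\<lambda>x. fst (F (s, x)) * \<phi> (0, x))"
proof -
  have c: "continuous_on UNIV F" using F by (simp add: weakly_div_free_def)
  obtain R where R: "\<And>z. z \<in> half_space \<Longrightarrow> norm z > R \<Longrightarrow> \<phi> z = 0 \<and> (\<forall>v. \<phi>' z v = 0)"
    using t unfolding c1_test_def by blast
  show "integrable lborel (\<lambda>z. indicator half_space z * \<phi>' z (F (z + (s, 0))))"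
  proof (rule integrable_half_space)
    show "continuous_on half_space (\<lambda>z. \<phi>' z (F (z + (s, 0))))"
      by (intro continuous_c1_test_pairing[OF t] continuous_on_compose2[OF c] continuous_intros) auto
  qed (use R in blast)
  show "integrable lborel (\<lambda>x. fst (F (s, x)) * \<phi> (0, x))"
  proof (rule integrable_continuous_bounded_support[of _ "cball 0 R"])
    show "continuous_on UNIV (\<lambda>x. fst (F (s, x)) * \<phi> (0, x))"
      by (intro continuous_intros continuous_on_compose2[OF c] continuous_on_compose2[OF c1_test_D(1)[OF t]]) auto
    show "fst (F (s, x)) * \<phi> (0, x) = 0" if "x \<notin> cball 0 R" for x
      using R[of "(0, x)"] that by (simp add: norm_Pair)
  qed auto
qed

lemma weakly_div_free_lincomb:
  assumes F: "weakly_div_free F" and G: "weakly_div_free G"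
  shows "weakly_div_free (\<lambda>z. F z + r *\<^sub>R G z)"
  unfolding weakly_div_free_def
proof (intro conjI allI impI)
  show "continuous_on UNIV (\<lambda>z. F z + r *\<^sub>R G z)"
    using F G unfolding weakly_div_free_def by (intro continuous_intros) auto
  have lin: "x = a + r * c \<Longrightarrow> y = b + r * d \<Longrightarrow> a + b = 0 \<Longrightarrow> c + d = 0 \<Longrightarrow> x + y = 0" for x y a b c d :: real
    by (simp add: eq_neg_iff_add_eq_0[symmetric])
  obtain R1 R2 where R: "\<And>z. norm z > R1 \<Longrightarrow> F z = 0" "\<And>z. norm z > R2 \<Longrightarrow> G z = 0"
    using F G unfolding weakly_div_free_def by metis
  show "\<exists>R. \<forall>z. norm z > R \<longrightarrow> F z + r *\<^sub>R G z = 0"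
    by (rule exI[of _ "max R1 R2"]) (simp add: R)
  fix s \<phi> \<phi>' assume t: "c1_test \<phi> \<phi>'"
  note i = weakly_div_free_integrable[OF F t, of s] weakly_div_free_integrable[OF G t, of s]
  have e: "indicator half_space z * \<phi>' z (F (z + (s, 0)) + r *\<^sub>R G (z + (s, 0)))
      = indicator half_space z * \<phi>' z (F (z + (s, 0))) + r * (indicator half_space z * \<phi>' z (G (z + (s, 0))))" for z
    using linear_add[OF c1_test_D(2)[OF t, of z]] linear_scale[OF c1_test_D(2)[OF t, of z]]
    by (cases "z \<in> half_space") (simp_all add: algebra_simps)
  have "(LINT z|lborel. indicator half_space z * \<phi>' z (F (z + (s, 0)) + r *\<^sub>R G (z + (s, 0))))
      = (LINT z|lborel. indicator half_space z * \<phi>' z (F (z + (s, 0)))) + r * (LINT z|lborel. indicator half_space z * \<phi>' z (G (z + (s, 0))))"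
    unfolding e using i by simp
  moreover have "(LINT x|lborel. fst (F (s, x) + r *\<^sub>R G (s, x)) * \<phi> (0, x))
      = (LINT x|lborel. fst (F (s, x)) * \<phi> (0, x)) + r * (LINT x|lborel. fst (G (s, x)) * \<phi> (0, x))"
    using i by (simp add: distrib_right mult.assoc)
  moreover have "(LINT z|lborel. indicator half_space z * \<phi>' z (F (z + (s, 0)))) + (LINT x|lborel. fst (F (s, x)) * \<phi> (0, x)) = 0"
    "(LINT z|lborel. indicator half_space z * \<phi>' z (G (z + (s, 0)))) + (LINT x|lborel. fst (G (s, x)) * \<phi> (0, x)) = 0"
    using F G t unfolding weakly_div_free_def by auto
  ultimately show "(LINT z|lborel. indicator half_space z * \<phi>' z (F (z + (s, 0)) + r *\<^sub>R G (z + (s, 0))))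
      + (LINT x|lborel. fst (F (s, x) + r *\<^sub>R G (s, x)) * \<phi> (0, x)) = 0"
    by (rule lin)
qed

lemma weakly_div_free_0: "weakly_div_free (\<lambda>z. 0)"
  unfolding weakly_div_free_def
proof (intro conjI allI impI)
  fix s :: real and \<phi> \<phi>' assume t: "c1_test \<phi> \<phi>'"
  have "indicator half_space z * \<phi>' z 0 = 0" for z
    using linear_0[OF c1_test_D(2)[OF t, of z]] by (cases "z \<in> half_space") auto
  show "(LINT z|lborel. indicator half_space z * \<phi>' z 0) + (LINT x|lborel. fst (0::stpoint) * \<phi> (0, x)) = 0"
    unfolding \<open>\<And>z. indicator half_space z * \<phi>' z 0 = 0\<close> by simp
qed auto


section \<open>The linear system as three conservation laws\<close>

definition momentum1_field :: "complex \<times> complex \<Rightarrow> stpoint" where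
  "momentum1_field Y = (Re (fst Y), vector [Re (snd Y), Im (snd Y)])"

text \<open>The flux is the second row of the symmetric trace-free matrix whose first row is (Re
  \<zeta>, Im \<zeta>).\<close>

definition momentum2_field :: "complex \<times> complex \<Rightarrow> stpoint" where
  "momentum2_field Y = (Im (fst Y), vector [Im (snd Y), - Re (snd Y)])"

text \<open>A zero density turns the conservation law into div u = 0, with no initial term.\<close>

definition velocity_field :: "complex \<times> complex \<Rightarrow> stpoint" where
  "velocity_field Y = (0, vector [Re (fst Y), Im (fst Y)])"

lemma linear_fields: "linear momentum1_field" "linear momentum2_field" "linear velocity_field"
  unfolding linear_iff momentum1_field_def momentum2_field_def velocity_field_def
  by (auto simp: vec_eq_iff forall_2)

lemma inner_stpoint: "(y::stpoint) \<bullet> z = fst y * fst z + snd y $ 1 * snd z $ 1 + snd y $ 2 * snd z $ 2"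
  by (simp add: inner_prod_def inner_vec_def sum_2)

text \<open>Orthogonality of a field to the frequency is the Fourier form of its conservation law,
  so \<open>wave\<close> solves the whole linear system at every frequency.\<close>

lemma wave_div_free: "momentum1_field (wave \<eta>) \<bullet> \<eta> = 0" "momentum2_field (wave \<eta>) \<bullet> \<eta> = 0" "velocity_field (wave \<eta>) \<bullet> \<eta> = 0"
  by (simp_all add: inner_stpoint momentum1_field_def momentum2_field_def velocity_field_def wave_def Let_def power2_eq_square algebra_simps)

definition div_free_state :: "(stpoint \<Rightarrow> complex \<times> complex) \<Rightarrow> bool" where
  "div_free_state Z \<longleftrightarrow> weakly_div_free (\<lambda>z. momentum1_field (Z z)) \<and> weakly_div_free (\<lambda>z. momentum2_field (Z z))
     \<and> weakly_div_free (\<lambda>z. velocity_field (Z z))"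

lemma div_free_state_0: "div_free_state (\<lambda>z. 0)"
  using linear_fields[THEN linear_0] weakly_div_free_0 by (simp add: div_free_state_def)

lemma div_free_state_lincomb:
  "div_free_state Z \<Longrightarrow> div_free_state W \<Longrightarrow> div_free_state (\<lambda>z. Z z + r *\<^sub>R W z)"
  unfolding div_free_state_def
  by (simp add: linear_fields[THEN linear_add] linear_fields[THEN linear_scale] weakly_div_free_lincomb)

lemma div_free_state_sum:
  assumes "finite I" "\<And>i. i \<in> I \<Longrightarrow> div_free_state (W i)" "div_free_state Z"
  shows "div_free_state (\<lambda>z. Z z + (\<Sum>i\<in>I. r i *\<^sub>R W i z))"
  using assms(1,2)
proof (induction I rule: finite_induct)
  case empty
  then show ?case using assms(3) by simp
next
  case (insert i I)
  then have "div_free_state (\<lambda>z. (Z z + (\<Sum>i\<in>I. r i *\<^sub>R W i z)) + r i *\<^sub>R W i z)"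
    by (intro div_free_state_lincomb) auto
  then show ?case using insert.hyps by (simp add: add_ac)
qed

lemma fourth_diff_zero_linear:
  assumes "linear L" "fourth_diff_zero P"
  shows "fourth_diff_zero (\<lambda>\<eta>. L (P \<eta>))"
  unfolding fourth_diff_zero_def
proof (intro allI)
  fix \<eta> \<delta>
  have "L (P (\<eta> - 2 *\<^sub>R \<delta>) - 4 *\<^sub>R P (\<eta> - \<delta>) + 6 *\<^sub>R P \<eta> - 4 *\<^sub>R P (\<eta> + \<delta>) + P (\<eta> + 2 *\<^sub>R \<delta>)) = L 0"
    using assms(2) unfolding fourth_diff_zero_def by simp
  then show "L (P (\<eta> - 2 *\<^sub>R \<delta>)) - 4 *\<^sub>R L (P (\<eta> - \<delta>)) + 6 *\<^sub>R L (P \<eta>) - 4 *\<^sub>R L (P (\<eta> + \<delta>)) + L (P (\<eta> + 2 *\<^sub>R \<delta>)) = 0"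
    by (simp add: linear_add[OF assms(1)] linear_diff[OF assms(1)] linear_scale[OF assms(1)] linear_0[OF assms(1)])
qed

lemma fourth_diff_zero_wave: "fourth_diff_zero wave"
  unfolding fourth_diff_zero_def using wave_fourth_difference by blast

text \<open>Localization only averages over frequencies, so it commutes with linear maps; a block of
  states thus yields blocks for the three conservation laws.\<close>

lemma block_linear:
  assumes "linear L"
  shows "L (block P a b \<xi> N z) = block (\<lambda>\<eta>. L (P \<eta>)) a b \<xi> N z"
  by (simp add: block_def packet_def avg4_linear[OF assms] linear_scale[OF assms] linear_0[OF assms])

lemma div_free_state_block:
  assumes "box a b \<noteq> {}" "N \<noteq> 0"
  shows "div_free_state (block wave a b \<xi> N)"
  unfolding div_free_state_def block_linear[OF linear_fields(1)] block_linear[OF linear_fields(2)] block_linear[OF linear_fields(3)]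
  using weakly_div_free_block[OF assms(1) fourth_diff_zero_linear[OF linear_fields(1) fourth_diff_zero_wave] wave_div_free(1) assms(2)]
    weakly_div_free_block[OF assms(1) fourth_diff_zero_linear[OF linear_fields(2) fourth_diff_zero_wave] wave_div_free(2) assms(2)]
    weakly_div_free_block[OF assms(1) fourth_diff_zero_linear[OF linear_fields(3) fourth_diff_zero_wave] wave_div_free(3) assms(2)]
  by blast

lemma continuous_block:
  fixes P :: "stpoint \<Rightarrow> 'v::real_normed_vector"
  assumes "box a b \<noteq> {}" "fourth_diff_zero P"
  shows "continuous_on UNIV (block P a b \<xi> N)"
  using block_lipschitz[OF assms] lipschitz_on_continuous_on by blast

section \<open>High-frequency limits of localized waves\<close>

lemma uniform_integral_tendsto_0:
  fixes h :: "nat \<Rightarrow> 'a::euclidean_space \<Rightarrow> real"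
  assumes i: "\<And>n. integrable lborel (h n)" and s: "\<And>n z. z \<notin> cbox a b \<Longrightarrow> h n z = 0"
    and u: "\<And>\<epsilon>. \<epsilon> > 0 \<Longrightarrow> \<forall>\<^sub>F n in sequentially. \<forall>z. \<bar>h n z\<bar> \<le> \<epsilon>"
  shows "(\<lambda>n. LINT z|lborel. h n z) \<longlonglongrightarrow> 0"
proof (rule tendstoI)
  fix \<epsilon> :: real assume \<epsilon>: "\<epsilon> > 0"
  define V where "V = measure lborel (cbox a b)"
  have V: "V \<ge> 0" by (simp add: V_def)
  have "\<epsilon> / (V + 1) > 0" using V \<epsilon> by simp
  from u[OF this] show "\<forall>\<^sub>F n in sequentially. dist (LINT z|lborel. h n z) 0 < \<epsilon>"
  proof (rule eventually_mono)
    fix n assume b: "\<forall>z. \<bar>h n z\<bar> \<le> \<epsilon> / (V + 1)"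
    have ii: "integrable lborel (\<lambda>z::'a. indicator (cbox a b) z * (\<epsilon> / (V + 1)))"
      using emeasure_bounded_finite[of "cbox a b"] by (intro integrable_mult_left integrable_real_indicator) auto
    have "norm (LINT z|lborel. h n z) \<le> (LINT z|lborel. indicator (cbox a b) z * (\<epsilon> / (V + 1)))"
    proof (rule Bochner_Integration.integral_norm_bound_integral[OF i ii])
      fix z show "norm (h n z) \<le> indicator (cbox a b) z * (\<epsilon> / (V + 1))"
        using b s[of z n] by (cases "z \<in> cbox a b") auto
    qed
    also have "\<dots> = V * (\<epsilon> / (V + 1))" by (simp add: V_def)
    also have "\<dots> = \<epsilon> * (V / (V + 1))" by simp
    also have "\<dots> < \<epsilon> * 1" using V \<epsilon> by (intro mult_strict_left_mono) auto
    finally show "dist (LINT z|lborel. h n z) 0 < \<epsilon>" by simp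
  qed
qed

lemma norm_fst_diff_le: "norm (fst X - fst Y) \<le> norm (X - Y)"
proof -
  have "norm (fst (X - Y)) \<le> norm (fst (X - Y), snd (X - Y))" by (rule norm_fst_le)
  then show ?thesis unfolding prod.collapse unfolding fst_diff .
qed

lemma bump_outside: "z \<notin> cbox a b \<Longrightarrow> bump a b z = 0"
  by (simp add: bump_def)

text \<open>The concentric box of half the side lengths has 1 / 8 of the volume, and the envelope is
  at least 1 / 64 on it; 8 times 64^2 is 32768.\<close>

lemma bump_integral:
  assumes "box a b \<noteq> {}"
  shows "(LINT z|lborel. (bump a b z)\<^sup>2) \<ge> measure lborel (cbox a b) / 32768"
proof -
  define a' b' where "a' = (1/4) *\<^sub>R (3 *\<^sub>R a + b)" and "b' = (1/4) *\<^sub>R (a + 3 *\<^sub>R b)"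
  have ab: "a \<bullet> v \<le> b \<bullet> v" if "v \<in> Basis" for v using assms that by (force simp: box_ne_empty)
  have ab': "a' \<bullet> v \<le> b' \<bullet> v" if "v \<in> Basis" for v
    using ab[OF that] by (simp add: a'_def b'_def inner_add_left)
  have "measure lborel (cbox a' b') = (\<Prod>v\<in>Basis. (1/2) * (b \<bullet> v - a \<bullet> v))"
    using ab' by (subst content_cbox) (auto simp: a'_def b'_def inner_add_left inner_diff_left algebra_simps intro!: prod.cong)
  also have "\<dots> = (1/2) ^ 3 * measure lborel (cbox a b)"
  proof -
    have "card (Basis :: stpoint set) = 3" using DIM_prod[where 'a = real and 'b = "real^2"] by simp
    then show ?thesis using ab by (subst content_cbox) (blast, simp only: inner_diff_left prod.distrib prod_constant)
  qed
  finally have c: "measure lborel (cbox a' b') = measure lborel (cbox a b) / 8" by (simp add: power3_eq_cube)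
  have "integrable lborel (\<lambda>z. indicator (cbox a' b') z * ((1/64)\<^sup>2 :: real))"
    using emeasure_bounded_finite[of "cbox a' b'"] by (intro integrable_mult_left integrable_real_indicator) auto
  moreover have "integrable lborel (\<lambda>z. (bump a b z)\<^sup>2)"
    by (rule integrable_continuous_bounded_support[of _ "cbox a b"])
      (auto intro!: continuous_intros continuous_bump[OF assms] simp: bump_outside)
  ultimately have "(LINT z|lborel. indicator (cbox a' b') z * ((1/64)\<^sup>2 :: real)) \<le> (LINT z|lborel. (bump a b z)\<^sup>2)"
  proof (rule integral_mono)
    fix z show "indicator (cbox a' b') z * ((1/64)\<^sup>2 :: real) \<le> (bump a b z)\<^sup>2"
    proof (cases "z \<in> cbox a' b'")
      case True
      then have "bump a b z \<ge> 1/64" using bump_inner(2)[OF assms] unfolding a'_def b'_def by blast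
      then have "(1/64)\<^sup>2 \<le> (bump a b z)\<^sup>2" by (intro power_mono) auto
      then show ?thesis using True by simp
    qed simp
  qed
  then show ?thesis using c by (simp add: measure_lborel_cbox_eq power2_eq_square)
qed

text \<open>Up to a uniformly small error the velocity has the size of the envelope times a sine.
  Half of the squared envelope is the mean of its square, and the remaining half oscillates with the
  doubled frequency and tends to zero.\<close>

lemma block_energy_tendsto:
  assumes b: "box a b \<noteq> {}" and \<xi>: "norm (fst (wave \<xi>)) = 1" "\<xi> \<noteq> 0"
  shows "(\<lambda>n. LINT z|lborel. (norm (fst (block wave a b \<xi> (real n) z)))\<^sup>2) \<longlonglongrightarrow> (LINT z|lborel. (bump a b z)\<^sup>2) / 2"
proof -
  define c where "c = (1/2) *\<^sub>R (a + b)"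
  define w where "w = (\<lambda>n z. bump a b z * sin (real n * (\<xi> \<bullet> (z - c))))"
  define B where "B = (\<lambda>n::nat. block wave a b \<xi> (real n))"
  have cB: "continuous_on UNIV (B n)" for n unfolding B_def by (rule continuous_block[OF b fourth_diff_zero_wave])
  have cbump: "continuous_on UNIV (bump a b)" by (rule continuous_bump[OF b])
  have cw: "continuous_on UNIV (w n)" for n unfolding w_def by (intro continuous_intros cbump)
  have sB: "B n z = 0" and sw: "w n z = 0" if "z \<notin> cbox a b" for n z
    using that by (auto simp: B_def block_def w_def bump_def)
  have iB: "integrable lborel (\<lambda>z. (norm (fst (B n z)))\<^sup>2)" for n
    by (rule integrable_continuous_bounded_support[of _ "cbox a b"]) (auto intro!: continuous_intros cB simp: sB)
  have iw: "integrable lborel (\<lambda>z. (w n z)\<^sup>2)" for n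
    by (rule integrable_continuous_bounded_support[of _ "cbox a b"]) (auto intro!: continuous_intros cw simp: sw)
  have ib: "integrable lborel (\<lambda>z. (bump a b z)\<^sup>2)"
    by (rule integrable_continuous_bounded_support[of _ "cbox a b"]) (auto intro!: continuous_intros cbump simp: bump_outside)
  have "(\<lambda>n. LINT z|lborel. (norm (fst (B n z)))\<^sup>2 - (w n z)\<^sup>2) \<longlonglongrightarrow> 0"
  proof (rule uniform_integral_tendsto_0[of _ a b])
    show "integrable lborel (\<lambda>z. (norm (fst (B n z)))\<^sup>2 - (w n z)\<^sup>2)" for n using iB iw by (rule Bochner_Integration.integrable_diff)
    show "(norm (fst (B n z)))\<^sup>2 - (w n z)\<^sup>2 = 0" if "z \<notin> cbox a b" for n z using sB[OF that] sw[OF that] by simp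
    fix \<epsilon> :: real assume \<epsilon>: "\<epsilon> > 0"
    \<comment> \<open>The limiting profile is at most 1 and the block at most 1 + \<eta> \<le> 2 in
      norm, so the squares differ by at most 3 \<eta>.\<close>
    define \<eta> where "\<eta> = min 1 (\<epsilon> / 3)"
    have \<eta>: "\<eta> > 0" "\<eta> \<le> 1" "3 * \<eta> \<le> \<epsilon>" using \<epsilon> by (auto simp: \<eta>_def)
    show "\<forall>\<^sub>F n in sequentially. \<forall>z. \<bar>(norm (fst (B n z)))\<^sup>2 - (w n z)\<^sup>2\<bar> \<le> \<epsilon>"
      using block_approx[OF continuous_wave \<eta>(1), of a b \<xi>]
    proof (rule eventually_mono, intro allI)
      fix n z assume "\<forall>z. norm (block wave a b \<xi> (real n) z - (bump a b z * sin (real n * (\<xi> \<bullet> (z - (1/2) *\<^sub>R (a + b))))) *\<^sub>R wave \<xi>) \<le> \<eta>"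
      from this[THEN spec, of z] have "norm (B n z - w n z *\<^sub>R wave \<xi>) \<le> \<eta>" by (simp only: B_def w_def c_def)
      then have 1: "norm (fst (B n z) - w n z *\<^sub>R fst (wave \<xi>)) \<le> \<eta>"
        using norm_fst_diff_le[of "B n z" "w n z *\<^sub>R wave \<xi>"] by simp
      have nw: "norm (w n z *\<^sub>R fst (wave \<xi>)) = \<bar>w n z\<bar>" using \<xi>(1) by simp
      have 2: "\<bar>norm (fst (B n z)) - \<bar>w n z\<bar>\<bar> \<le> \<eta>"
        using norm_triangle_ineq3[of "fst (B n z)" "w n z *\<^sub>R fst (wave \<xi>)"] 1 unfolding nw by linarith
      have "\<bar>w n z\<bar> \<le> 1 * 1" unfolding w_def abs_mult using bump_nonneg[of a b z] bump_le_1[of a b z]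
        by (intro mult_mono) auto
      then have 3: "\<bar>norm (fst (B n z)) + \<bar>w n z\<bar>\<bar> \<le> 3" using 2 \<eta>(2) by linarith
      have "(norm (fst (B n z)))\<^sup>2 - (w n z)\<^sup>2 = (norm (fst (B n z)) - \<bar>w n z\<bar>) * (norm (fst (B n z)) + \<bar>w n z\<bar>)"
        by (simp add: power2_eq_square algebra_simps)
      then have "\<bar>(norm (fst (B n z)))\<^sup>2 - (w n z)\<^sup>2\<bar> = \<bar>norm (fst (B n z)) - \<bar>w n z\<bar>\<bar> * \<bar>norm (fst (B n z)) + \<bar>w n z\<bar>\<bar>"
        by (simp only: abs_mult)
      also have "\<dots> \<le> \<eta> * 3" using 2 3 \<eta>(1) by (intro mult_mono) auto
      finally show "\<bar>(norm (fst (B n z)))\<^sup>2 - (w n z)\<^sup>2\<bar> \<le> \<epsilon>" using \<eta>(3) by linarith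
    qed
  qed
  then have 1: "(\<lambda>n. (LINT z|lborel. (norm (fst (B n z)))\<^sup>2) - (LINT z|lborel. (w n z)\<^sup>2)) \<longlonglongrightarrow> 0"
    using iB iw by simp
  \<comment> \<open>The phase pi / 2 turns the sine at the doubled frequency into the cosine of the
    double angle, and the shift depending on n accounts for the centre c.\<close>
  have "(\<lambda>n. LINT z|lborel. (bump a b z)\<^sup>2 * sin (real n * ((2 *\<^sub>R \<xi>) \<bullet> z) + (pi / 2 - real n * ((2 *\<^sub>R \<xi>) \<bullet> c)))) \<longlonglongrightarrow> 0"
    by (rule riemann_lebesgue[of _ "cbox a b"]) (use \<xi>(2) in \<open>auto intro!: continuous_intros cbump simp: bump_outside\<close>)
  moreover have "(bump a b z)\<^sup>2 * sin (real n * ((2 *\<^sub>R \<xi>) \<bullet> z) + (pi / 2 - real n * ((2 *\<^sub>R \<xi>) \<bullet> c))) = (bump a b z)\<^sup>2 - 2 * (w n z)\<^sup>2" for n z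
  proof -
    define \<theta> where "\<theta> = real n * (\<xi> \<bullet> (z - c))"
    have e: "real n * ((2 *\<^sub>R \<xi>) \<bullet> z) + (pi / 2 - real n * ((2 *\<^sub>R \<xi>) \<bullet> c)) = pi / 2 + 2 * \<theta>"
      unfolding \<theta>_def by (simp add: inner_diff_right algebra_simps)
    have "sin (pi / 2 + 2 * \<theta>) = cos (2 * \<theta>)" by (simp add: sin_add)
    also have "\<dots> = 1 - 2 * (sin \<theta>)\<^sup>2" by (rule cos_double_sin)
    finally have F: "sin (pi / 2 + 2 * \<theta>) = 1 - 2 * (sin \<theta>)\<^sup>2" .
    have W: "w n z = bump a b z * sin \<theta>" by (simp only: w_def \<theta>_def)
    show ?thesis unfolding e F W by (simp add: power_mult_distrib right_diff_distrib)
  qed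
  ultimately have "(\<lambda>n. (LINT z|lborel. (bump a b z)\<^sup>2 - 2 * (w n z)\<^sup>2)) \<longlonglongrightarrow> 0" by simp
  moreover have "(LINT z|lborel. (bump a b z)\<^sup>2 - 2 * (w n z)\<^sup>2) = (LINT z|lborel. (bump a b z)\<^sup>2) - 2 * (LINT z|lborel. (w n z)\<^sup>2)" for n
    using ib iw[of n] by simp
  ultimately have 2: "(\<lambda>n. (LINT z|lborel. (bump a b z)\<^sup>2) - 2 * (LINT z|lborel. (w n z)\<^sup>2)) \<longlonglongrightarrow> 0" by simp
  have "(\<lambda>n. ((LINT z|lborel. (norm (fst (B n z)))\<^sup>2) - (LINT z|lborel. (w n z)\<^sup>2))
      - ((LINT z|lborel. (bump a b z)\<^sup>2) - 2 * (LINT z|lborel. (w n z)\<^sup>2)) / 2 + (LINT z|lborel. (bump a b z)\<^sup>2) / 2)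
      \<longlonglongrightarrow> 0 - 0 / 2 + (LINT z|lborel. (bump a b z)\<^sup>2) / 2"
    by (intro tendsto_intros 1 2) simp
  then show ?thesis unfolding B_def by (simp add: field_simps)
qed

text \<open>This is what makes a new oscillation almost orthogonal to the earlier velocities: up to
  a uniformly small error it is a fixed profile times a fast sine, whose pairing with a continuous
  field tends to zero.\<close>

lemma block_weak_tendsto:
  fixes g :: "stpoint \<Rightarrow> complex"
  assumes b: "box a b \<noteq> {}" and \<xi>: "\<xi> \<noteq> 0" and g: "continuous_on UNIV g"
  shows "(\<lambda>n. LINT z|lborel. fst (block wave a b \<xi> (real n) z) \<bullet> g z) \<longlonglongrightarrow> 0"
proof -
  define c where "c = (1/2) *\<^sub>R (a + b)"
  define w where "w = (\<lambda>n z. (bump a b z * sin (real n * (\<xi> \<bullet> (z - c)))) *\<^sub>R fst (wave \<xi>))"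
  define B where "B = (\<lambda>n::nat. block wave a b \<xi> (real n))"
  have cB: "continuous_on UNIV (B n)" for n unfolding B_def by (rule continuous_block[OF b fourth_diff_zero_wave])
  have cbump: "continuous_on UNIV (bump a b)" by (rule continuous_bump[OF b])
  have cw: "continuous_on UNIV (w n)" for n unfolding w_def by (intro continuous_intros cbump)
  have sB: "B n z = 0" and sw: "w n z = 0" if "z \<notin> cbox a b" for n z
    using that by (auto simp: B_def block_def w_def bump_def)
  have iB: "integrable lborel (\<lambda>z. fst (B n z) \<bullet> g z)" for n
    by (rule integrable_continuous_bounded_support[of _ "cbox a b"]) (auto intro!: continuous_intros cB g simp: sB)
  have iw: "integrable lborel (\<lambda>z. w n z \<bullet> g z)" for n
    by (rule integrable_continuous_bounded_support[of _ "cbox a b"]) (auto intro!: continuous_intros cw g simp: sw)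
  have "compact (g ` cbox a b)" by (intro compact_continuous_image continuous_on_subset[OF g] compact_cbox) auto
  then obtain M where M: "M > 0" "\<And>z. z \<in> cbox a b \<Longrightarrow> norm (g z) \<le> M"
    using bounded_pos[THEN iffD1, OF compact_imp_bounded] by (metis imageI)
  have "(\<lambda>n. LINT z|lborel. fst (B n z) \<bullet> g z - w n z \<bullet> g z) \<longlonglongrightarrow> 0"
  proof (rule uniform_integral_tendsto_0[of _ a b])
    show "integrable lborel (\<lambda>z. fst (B n z) \<bullet> g z - w n z \<bullet> g z)" for n using iB iw by (rule Bochner_Integration.integrable_diff)
    show out: "fst (B n z) \<bullet> g z - w n z \<bullet> g z = 0" if "z \<notin> cbox a b" for n z using sB[OF that] sw[OF that] by simp
    fix \<epsilon> :: real assume \<epsilon>: "\<epsilon> > 0"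
    then have "\<epsilon> / M > 0" using M by simp
    from block_approx[OF continuous_wave this, of a b \<xi>]
    show "\<forall>\<^sub>F n in sequentially. \<forall>z. \<bar>fst (B n z) \<bullet> g z - w n z \<bullet> g z\<bar> \<le> \<epsilon>"
    proof (rule eventually_mono, intro allI)
      fix n z assume a: "\<forall>z. norm (block wave a b \<xi> (real n) z - (bump a b z * sin (real n * (\<xi> \<bullet> (z - (1/2) *\<^sub>R (a + b))))) *\<^sub>R wave \<xi>) \<le> \<epsilon> / M"
      show "\<bar>fst (B n z) \<bullet> g z - w n z \<bullet> g z\<bar> \<le> \<epsilon>"
      proof (cases "z \<in> cbox a b")
        case True
        have "norm (B n z - (bump a b z * sin (real n * (\<xi> \<bullet> (z - c)))) *\<^sub>R wave \<xi>) \<le> \<epsilon> / M"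
          using a[THEN spec, of z] by (simp only: B_def c_def)
        then have 1: "norm (fst (B n z) - w n z) \<le> \<epsilon> / M"
          using norm_fst_diff_le[of "B n z" "(bump a b z * sin (real n * (\<xi> \<bullet> (z - c)))) *\<^sub>R wave \<xi>"]
          by (simp add: w_def)
        have "\<bar>fst (B n z) \<bullet> g z - w n z \<bullet> g z\<bar> \<le> norm (fst (B n z) - w n z) * norm (g z)"
          unfolding inner_diff_left[symmetric] by (rule Cauchy_Schwarz_ineq2)
        also have "\<dots> \<le> (\<epsilon> / M) * M" using 1 M True \<epsilon> by (intro mult_mono) auto
        finally show ?thesis using M(1) by simp
      qed (use out \<epsilon> in auto)
    qed
  qed
  then have 1: "(\<lambda>n. (LINT z|lborel. fst (B n z) \<bullet> g z) - (LINT z|lborel. w n z \<bullet> g z)) \<longlonglongrightarrow> 0"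
    using iB iw by simp
  have "(\<lambda>n. LINT z|lborel. (bump a b z * (fst (wave \<xi>) \<bullet> g z)) * sin (real n * (\<xi> \<bullet> z) + (- real n * (\<xi> \<bullet> c)))) \<longlonglongrightarrow> 0"
    by (rule riemann_lebesgue[of _ "cbox a b"]) (use \<xi> in \<open>auto intro!: continuous_intros cbump g simp: bump_outside\<close>)
  moreover have "(bump a b z * (fst (wave \<xi>) \<bullet> g z)) * sin (real n * (\<xi> \<bullet> z) + (- real n * (\<xi> \<bullet> c))) = w n z \<bullet> g z" for n z
    by (simp add: w_def inner_diff_right algebra_simps)
  ultimately have 2: "(\<lambda>n. LINT z|lborel. w n z \<bullet> g z) \<longlonglongrightarrow> 0" by simp
  from tendsto_add[OF 1 2] show ?thesis by (simp add: B_def)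
qed

text \<open>The states reached for |\<tau>| \<le> 1 form a compact segment in an open set, so a
  whole \<delta>-neighbourhood is admissible. This margin absorbs both the variation of a
  subsolution over a box and the error of a packet.\<close>

lemma gen_energy_wave_open:
  assumes "gen_energy Y < e"
  shows "\<exists>\<xi> \<delta>. norm (fst (wave \<xi>)) = 1 \<and> \<xi> \<noteq> 0 \<and> \<delta> > 0 \<and>
    (\<forall>\<tau> X. \<bar>\<tau>\<bar> \<le> 1 \<longrightarrow> norm (X - (Y + (\<tau> * ((e - (norm (fst Y))\<^sup>2 / 2) / (4 * sqrt (2 * e)))) *\<^sub>R wave \<xi>)) < \<delta> \<longrightarrow> gen_energy X < e)"
proof -
  define A where "A = (e - (norm (fst Y))\<^sup>2 / 2) / (4 * sqrt (2 * e))"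
  obtain \<xi> where \<xi>: "norm (fst (wave \<xi>)) = 1" "\<xi> \<noteq> 0"
    "\<And>\<tau>. \<bar>\<tau>\<bar> \<le> 1 \<Longrightarrow> gen_energy (Y + (\<tau> * A) *\<^sub>R wave \<xi>) < e"
    using gen_energy_wave[OF assms] unfolding A_def by metis
  define K where "K = (\<lambda>\<tau>. Y + (\<tau> * A) *\<^sub>R wave \<xi>) ` {-1..1}"
  have "compact K" unfolding K_def by (intro compact_continuous_image continuous_intros compact_Icc)
  moreover have "open {X. gen_energy X < e}"
    by (intro open_Collect_less continuous_gen_energy continuous_intros)
  moreover have "K \<subseteq> {X. gen_energy X < e}" using \<xi>(3) unfolding K_def by auto
  ultimately obtain \<delta> where \<delta>: "\<delta> > 0" "(\<Union>x\<in>K. ball x \<delta>) \<subseteq> {X. gen_energy X < e}"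
    by (rule compact_subset_open_imp_ball_epsilon_subset)
  have "gen_energy X < e" if "\<bar>\<tau>\<bar> \<le> 1" "norm (X - (Y + (\<tau> * A) *\<^sub>R wave \<xi>)) < \<delta>" for \<tau> X
  proof -
    have "Y + (\<tau> * A) *\<^sub>R wave \<xi> \<in> K" using that(1) unfolding K_def by (intro imageI) auto
    moreover have "X \<in> ball (Y + (\<tau> * A) *\<^sub>R wave \<xi>) \<delta>"
      using that(2) unfolding mem_ball dist_norm by (subst norm_minus_commute)
    ultimately show ?thesis using \<delta>(2) by blast
  qed
  then show ?thesis using \<xi>(1,2) \<delta>(1) unfolding A_def[symmetric] by blast
qed


subsection \<open>Convex integration\<close>

text \<open>The whole state, not just the velocity, vanishes outside D; together with the identities
  on the whole space this encodes zero flux through the boundary of D.\<close>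

definition subsolution :: "real \<Rightarrow> stpoint set \<Rightarrow> (stpoint \<Rightarrow> complex \<times> complex) \<Rightarrow> bool" where
  "subsolution e D Z \<longleftrightarrow> continuous_on UNIV Z \<and> (\<forall>z. z \<notin> D \<longrightarrow> Z z = 0) \<and>
     (\<forall>z. gen_energy (Z z) < e) \<and> div_free_state Z"

text \<open>Quadratic in the gap, since the admissible amplitude is proportional to the gap and the
  energy gained by a wave to the squared amplitude.\<close>

definition deficit :: "real \<Rightarrow> stpoint set \<Rightarrow> (stpoint \<Rightarrow> complex \<times> complex) \<Rightarrow> real" where
  "deficit e D Z = (LINT z|lborel. indicator D z * (e - (norm (fst (Z z)))\<^sup>2 / 2)\<^sup>2)"

text \<open>Meant for waves in disjoint boxes: at each point at most one summand survives. So
  energies add up, and pointwise constraints can be checked for one wave at a time.\<close>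

lemma norm_sum_orthogonal:
  fixes f :: "'i \<Rightarrow> 'v::real_normed_vector"
  assumes "finite I" "\<And>i j. i \<in> I \<Longrightarrow> j \<in> I \<Longrightarrow> i \<noteq> j \<Longrightarrow> f i = 0 \<or> f j = 0"
  shows "(norm (sum f I))\<^sup>2 = (\<Sum>i\<in>I. (norm (f i))\<^sup>2)"
    "sum f I = 0 \<or> (\<exists>i\<in>I. sum f I = f i)"
proof -
  have "(norm (sum f I))\<^sup>2 = (\<Sum>i\<in>I. (norm (f i))\<^sup>2) \<and> (sum f I = 0 \<or> (\<exists>i\<in>I. sum f I = f i))"
  proof (cases "\<exists>i\<in>I. f i \<noteq> 0")
    case True
    then obtain i where i: "i \<in> I" "f i \<noteq> 0" by blast
    then have 0: "f j = 0" if "j \<in> I - {i}" for j using assms(2)[of i j] that by blast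
    have "sum f I = f i + sum f (I - {i})" using assms(1) i(1) by (rule sum.remove)
    moreover have "(\<Sum>j\<in>I. (norm (f j))\<^sup>2) = (norm (f i))\<^sup>2 + (\<Sum>j\<in>I - {i}. (norm (f j))\<^sup>2)"
      using assms(1) i(1) by (rule sum.remove)
    ultimately show ?thesis using 0 i(1) by auto
  qed auto
  then show "(norm (sum f I))\<^sup>2 = (\<Sum>i\<in>I. (norm (f i))\<^sup>2)"
    "sum f I = 0 \<or> (\<exists>i\<in>I. sum f I = f i)" by auto
qed

lemma deficit_integrable:
  assumes "subsolution e D Z" "open D" "bounded D"
  shows "integrable lborel (\<lambda>z. indicator D z * (e - (norm (fst (Z z)))\<^sup>2 / 2)\<^sup>2)"
proof -
  have c: "continuous_on UNIV (\<lambda>z. (e - (norm (fst (Z z)))\<^sup>2 / 2)\<^sup>2)"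
    using assms(1) unfolding subsolution_def by (intro continuous_intros) auto
  obtain R where R: "D \<subseteq> cball 0 R" using bounded_subset_ballD[OF assms(3), of 0] ball_subset_cball by blast
  have "integrable lborel (\<lambda>z. indicator (cball 0 R) z *\<^sub>R (e - (norm (fst (Z z)))\<^sup>2 / 2)\<^sup>2)"
    by (intro borel_integrable_compact continuous_on_subset[OF c]) auto
  then have "integrable lborel (\<lambda>z. indicator D z *\<^sub>R (indicator (cball 0 R) z *\<^sub>R (e - (norm (fst (Z z)))\<^sup>2 / 2)\<^sup>2))"
    by (rule integrable_mult_indicator[rotated]) (use assms(2) in auto)
  moreover have "indicator D z *\<^sub>R (indicator (cball 0 R) z *\<^sub>R y) = indicator D z * y" for z and y :: real
    using R by (cases "z \<in> D") auto
  ultimately show ?thesis by (simp only:)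
qed

text \<open>
  The gauge of a tagged division makes the subsolution nearly constant on each box; the
  division then supplies disjoint boxes on which independent oscillations can be added.
\<close>

lemma subsolution_step:
  fixes G :: "(stpoint \<Rightarrow> complex) set"
  assumes D: "open D" "bounded D" and Z: "subsolution e D Z"
    and G: "finite G" "\<And>g. g \<in> G \<Longrightarrow> continuous_on UNIV g" and \<epsilon>: "\<epsilon> > 0"
  shows "\<exists>Z'. subsolution e D Z' \<and>
    (\<forall>g\<in>G. \<bar>LINT z|lborel. (fst (Z' z) - fst (Z z)) \<bullet> g z\<bar> < \<epsilon>) \<and>
    deficit e D Z / (2 ^ 23 * e) \<le> (LINT z|lborel. (norm (fst (Z' z) - fst (Z z)))\<^sup>2)"
proof -
  have cZ: "continuous_on UNIV Z" and outZ: "\<And>z. z \<notin> D \<Longrightarrow> Z z = 0" and HZ: "\<And>z. gen_energy (Z z) < e"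
    and dZ: "div_free_state Z" using Z by (auto simp: subsolution_def)
  have e0: "e > 0" by (rule le_less_trans[OF _ HZ[of 0]]) (simp add: gen_energy_def)
  define f where "f = (\<lambda>z. (e - (norm (fst (Z z)))\<^sup>2 / 2)\<^sup>2)"
  define I where "I = deficit e D Z"
  show ?thesis
  proof (cases "I > 0")
    case False
    then have "I / (2 ^ 23 * e) \<le> 0" using e0 by (simp add: divide_nonpos_pos)
    then show ?thesis using Z \<epsilon> unfolding I_def by (intro exI[of _ Z]) simp
  next
    case True
    define A where "A = (\<lambda>z. (e - (norm (fst (Z z)))\<^sup>2 / 2) / (4 * sqrt (2 * e)))"
    have "\<forall>z. \<exists>\<xi> \<delta>. norm (fst (wave \<xi>)) = 1 \<and> \<xi> \<noteq> 0 \<and> \<delta> > 0 \<and>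
      (\<forall>\<tau> X. \<bar>\<tau>\<bar> \<le> 1 \<longrightarrow> norm (X - (Z z + (\<tau> * A z) *\<^sub>R wave \<xi>)) < \<delta> \<longrightarrow> gen_energy X < e)"
      unfolding A_def using gen_energy_wave_open[OF HZ] by blast
    then obtain \<xi> \<delta> where \<xi>: "\<And>z. norm (fst (wave (\<xi> z))) = 1" "\<And>z. \<xi> z \<noteq> 0" and \<delta>: "\<And>z. \<delta> z > 0"
      and stay: "\<And>z \<tau> X. \<bar>\<tau>\<bar> \<le> 1 \<Longrightarrow> norm (X - (Z z + (\<tau> * A z) *\<^sub>R wave (\<xi> z))) < \<delta> z \<Longrightarrow> gen_energy X < e"
      by metis
    have A0: "A z \<ge> 0" for z
      using HZ[of z] e0 norm_ge_zero[of "snd (Z z) - (fst (Z z))\<^sup>2 / 2"] unfolding A_def gen_energy_def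
      by (intro divide_nonneg_nonneg; linarith?) simp
    have A2: "(A z)\<^sup>2 = f z / (32 * e)" for z
      using e0 by (simp add: A_def f_def power_divide power_mult_distrib)
    have "\<exists>r>0. (z \<in> D \<longrightarrow> ball z r \<subseteq> D) \<and> (\<forall>y\<in>ball z r. norm (Z y - Z z) < \<delta> z / 2)" for z
    proof -
      have "isCont Z z" using cZ unfolding continuous_on_eq_continuous_at[OF open_UNIV] by blast
      then obtain r1 where r1: "r1 > 0" "\<And>y. dist y z < r1 \<Longrightarrow> dist (Z y) (Z z) < \<delta> z / 2"
        unfolding continuous_at_eps_delta using half_gt_zero[OF \<delta>] by meson
      obtain r2 where r2: "r2 > 0" "z \<in> D \<longrightarrow> ball z r2 \<subseteq> D"
        using D(1) open_contains_ball zero_less_one by metis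
      show ?thesis
      proof (intro exI[of _ "min r1 r2"] conjI ballI impI)
        show "norm (Z y - Z z) < \<delta> z / 2" if "y \<in> ball z (min r1 r2)" for y
          using r1(2)[of y] that by (simp add: dist_norm norm_minus_commute)
        show "ball z (min r1 r2) \<subseteq> D" if "z \<in> D"
          using r2(2) that by (meson min.cobounded2 subset_ball subset_trans)
      qed (use r1 r2 in auto)
    qed
    then obtain r where r: "\<And>z. r z > 0" "\<And>z. z \<in> D \<Longrightarrow> ball z (r z) \<subseteq> D"
      "\<And>z y. y \<in> ball z (r z) \<Longrightarrow> norm (Z y - Z z) < \<delta> z / 2" by metis
    obtain c where c: "D \<subseteq> cbox (- c) c" using bounded_subset_cbox_symmetric[OF D(2)] by blast
    define F where "F = (\<lambda>z. indicator D z * f z)"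
    have iF: "integrable lborel F" unfolding F_def f_def using deficit_integrable[OF Z D] .
    have "(F has_integral I) UNIV"
      using has_integral_integral_lborel[OF iF] unfolding I_def deficit_def F_def f_def .
    moreover have "(\<lambda>x. if x \<in> cbox (- c) c then F x else 0) = F"
      using c by (auto simp: F_def indicator_def fun_eq_iff)
    ultimately have "(F has_integral I) (cbox (- c) c)"
      using has_integral_restrict_UNIV[of "cbox (- c) c" F I] by simp
    \<comment> \<open>Accuracy I / 2 guarantees that every sufficiently fine Riemann sum keeps at
      least half of the deficit.\<close>
    then obtain \<gamma> where \<gamma>: "gauge \<gamma>" "\<And>p. p tagged_division_of (cbox (- c) c) \<Longrightarrow> \<gamma> fine p \<Longrightarrow>
        norm ((\<Sum>(x, K)\<in>p. measure lborel K *\<^sub>R F x) - I) < I / 2"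
      unfolding has_integral using half_gt_zero[OF True] by meson
    have "gauge (\<lambda>z. \<gamma> z \<inter> ball z (r z))"
      by (intro gauge_Int \<gamma>(1) gauge_ball_dependent) (use r(1) in blast)
    then obtain p where p: "p tagged_division_of (cbox (- c) c)" "(\<lambda>z. \<gamma> z \<inter> ball z (r z)) fine p"
      by (rule fine_division_exists)
    \<comment> \<open>Tags outside D and boxes of zero content contribute nothing to the Riemann
      sum. The remaining boxes are nondegenerate and lie in D, because the gauge keeps each of them
      inside a ball around its tag.\<close>
    define q where "q = {(x, K)\<in>p. x \<in> D \<and> measure lborel K > 0}"
    have fp: "finite p" using p(1) by (rule tagged_division_of_finite)
    have fq: "finite q" unfolding q_def by (rule finite_subset[OF _ fp]) auto
    have "\<gamma> fine p" using p(2) by (auto simp: fine_def)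
    from \<gamma>(2)[OF p(1) this] have "(\<Sum>(x, K)\<in>p. measure lborel K *\<^sub>R F x) \<ge> I / 2"
      unfolding real_norm_def by linarith
    also have "(\<Sum>(x, K)\<in>p. measure lborel K *\<^sub>R F x) = (\<Sum>(x, K)\<in>q. measure lborel K *\<^sub>R F x)"
    proof (rule sum.mono_neutral_right[OF fp])
      show "q \<subseteq> p" by (auto simp: q_def)
      show "\<forall>i\<in>p - q. (case i of (x, K) \<Rightarrow> measure lborel K *\<^sub>R F x) = 0"
        using measure_nonneg[of lborel] by (auto simp: q_def F_def indicator_def less_le)
    qed
    also have "\<dots> = (\<Sum>k\<in>q. measure lborel (snd k) * f (fst k))"
      by (intro sum.cong) (auto simp: q_def F_def)
    finally have qI: "(\<Sum>k\<in>q. measure lborel (snd k) * f (fst k)) \<ge> I / 2" .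
    have "\<forall>k\<in>q. \<exists>a b. snd k = cbox a b"
      using tagged_division_ofD(4)[OF p(1)] unfolding q_def by fastforce
    then obtain lo hi where lohi: "\<And>k. k \<in> q \<Longrightarrow> snd k = cbox (lo k) (hi k)" by metis
    have nd: "box (lo k) (hi k) \<noteq> {}" if "k \<in> q" for k
    proof -
      have "measure lborel (cbox (lo k) (hi k)) > 0" using that lohi[OF that] by (auto simp: q_def)
      then show ?thesis by (simp only: content_pos_lt_eq box_ne_empty)
    qed
    have tag: "fst k \<in> D" if "k \<in> q" for k using that by (auto simp: q_def)
    have small: "cbox (lo k) (hi k) \<subseteq> ball (fst k) (r (fst k))" if "k \<in> q" for k
    proof -
      have "(fst k, snd k) \<in> p" using that by (auto simp: q_def)
      then show ?thesis using fineD[OF p(2)] lohi[OF that] by blast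
    qed
    have disj: "box (lo k) (hi k) \<inter> box (lo k') (hi k') = {}" if "k \<in> q" "k' \<in> q" "k \<noteq> k'" for k k'
      using tagged_division_ofD(5)[OF p(1), of "fst k" "snd k" "fst k'" "snd k'"] that lohi[OF that(1)] lohi[OF that(2)]
      by (auto simp: q_def prod_eq_iff)
    define B where "B = (\<lambda>k n. block wave (lo k) (hi k) (\<xi> (fst k)) (real n))"
    define W where "W = (\<lambda>n z. \<Sum>k\<in>q. A (fst k) *\<^sub>R B k n z)"
    have cB: "continuous_on UNIV (B k n)" if "k \<in> q" for k n
      unfolding B_def by (rule continuous_block[OF nd[OF that] fourth_diff_zero_wave])
    have B0: "B k n z = 0" if "k \<in> q" "z \<notin> box (lo k) (hi k)" for k n z
      unfolding B_def by (rule block_face[OF nd[OF that(1)] fourth_diff_zero_wave that(2)])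
    have Bdisj: "A (fst k) *\<^sub>R B k n z = 0 \<or> A (fst k') *\<^sub>R B k' n z = 0" if "k \<in> q" "k' \<in> q" "k \<noteq> k'" for k k' n z
      using B0[OF that(1)] B0[OF that(2)] disj[OF that] by (metis disjoint_iff scaleR_zero_right)
    have Wcases: "W n z = 0 \<or> (\<exists>k\<in>q. z \<in> box (lo k) (hi k) \<and> W n z = A (fst k) *\<^sub>R B k n z)" for n z
    proof -
      have "W n z = 0 \<or> (\<exists>k\<in>q. W n z = A (fst k) *\<^sub>R B k n z)"
        unfolding W_def by (rule norm_sum_orthogonal(2)[OF fq]) (rule Bdisj)
      then show ?thesis using B0 by (metis scaleR_zero_right)
    qed
    have Wnorm: "(norm (fst (W n z)))\<^sup>2 = (\<Sum>k\<in>q. (A (fst k))\<^sup>2 * (norm (fst (B k n z)))\<^sup>2)" for n z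
    proof -
      have "fst (W n z) = (\<Sum>k\<in>q. A (fst k) *\<^sub>R fst (B k n z))"
        unfolding W_def fst_sum by simp
      moreover have "A (fst k) *\<^sub>R fst (B k n z) = 0 \<or> A (fst k') *\<^sub>R fst (B k' n z) = 0"
        if "k \<in> q" "k' \<in> q" "k \<noteq> k'" for k k'
        using Bdisj[OF that, of n z] by (auto simp: prod_eq_iff)
      ultimately show ?thesis
        using norm_sum_orthogonal(1)[OF fq, of "\<lambda>k. A (fst k) *\<^sub>R fst (B k n z)"]
        by (simp add: power_mult_distrib)
    qed
    have iB2: "integrable lborel (\<lambda>z. (norm (fst (B k n z)))\<^sup>2)" if "k \<in> q" for k n
      by (rule integrable_continuous_bounded_support[of _ "box (lo k) (hi k)"])
        (auto intro!: continuous_intros cB that simp: B0[OF that])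
    have iBg: "integrable lborel (\<lambda>z. fst (B k n z) \<bullet> g z)" if "k \<in> q" "g \<in> G" for k n g
      by (rule integrable_continuous_bounded_support[of _ "box (lo k) (hi k)"])
        (auto intro!: continuous_intros cB[OF that(1)] G(2)[OF that(2)] simp: B0[OF that(1)])
    have energy: "\<forall>\<^sub>F n in sequentially. (LINT z|lborel. (norm (fst (W n z)))\<^sup>2) > I / (2 ^ 23 * e)"
    proof -
      have E: "(LINT z|lborel. (norm (fst (W n z)))\<^sup>2) = (\<Sum>k\<in>q. (A (fst k))\<^sup>2 * (LINT z|lborel. (norm (fst (B k n z)))\<^sup>2))" for n
        unfolding Wnorm by (subst Bochner_Integration.integral_sum) (use iB2 in auto)
      have lim: "(\<lambda>n. LINT z|lborel. (norm (fst (W n z)))\<^sup>2) \<longlonglongrightarrow> (\<Sum>k\<in>q. (A (fst k))\<^sup>2 * ((LINT z|lborel. (bump (lo k) (hi k) z)\<^sup>2) / 2))"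
        unfolding E B_def by (intro tendsto_sum tendsto_mult_left block_energy_tendsto nd \<xi>)
      \<comment> \<open>Origin of the constant: 2^5 from the squared amplitude, 2^15 from
        \<open>bump_integral\<close>, and a factor 2 each from the mean of the squared sine, from
        the Riemann sum and from making the inequality strict.\<close>
      have "I / (2 ^ 23 * e) < I / (2 ^ 22 * e)" using True e0 by (simp add: field_simps)
      also have "\<dots> = (I / 2) / (2 ^ 21 * e)" by simp
      also have "\<dots> \<le> (\<Sum>k\<in>q. measure lborel (snd k) * f (fst k)) / (2 ^ 21 * e)"
        using qI e0 by (intro divide_right_mono) auto
      also have "\<dots> = (\<Sum>k\<in>q. (A (fst k))\<^sup>2 * ((measure lborel (snd k) / 32768) / 2))"
        unfolding sum_divide_distrib A2 by (intro sum.cong) auto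
      also have "\<dots> \<le> (\<Sum>k\<in>q. (A (fst k))\<^sup>2 * ((LINT z|lborel. (bump (lo k) (hi k) z)\<^sup>2) / 2))"
        using bump_integral[OF nd] lohi by (intro sum_mono mult_left_mono divide_right_mono) auto
      finally show ?thesis by (rule order_tendstoD(1)[OF lim])
    qed
    have weak: "\<forall>\<^sub>F n in sequentially. \<forall>g\<in>G. \<bar>LINT z|lborel. fst (W n z) \<bullet> g z\<bar> < \<epsilon>"
      unfolding eventually_ball_finite_distrib[OF G(1)]
    proof
      fix g assume g: "g \<in> G"
      have E: "(LINT z|lborel. fst (W n z) \<bullet> g z) = (\<Sum>k\<in>q. A (fst k) * (LINT z|lborel. fst (B k n z) \<bullet> g z))" for n
      proof -
        have "fst (W n z) \<bullet> g z = (\<Sum>k\<in>q. A (fst k) * (fst (B k n z) \<bullet> g z))" for z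
          unfolding W_def fst_sum inner_sum_left by simp
        then show ?thesis by (simp add: Bochner_Integration.integral_sum iBg[OF _ g])
      qed
      have "(\<lambda>n. LINT z|lborel. fst (W n z) \<bullet> g z) \<longlonglongrightarrow> (\<Sum>k\<in>q. A (fst k) * 0)"
        unfolding E B_def by (intro tendsto_sum tendsto_mult_left block_weak_tendsto nd \<xi> G g)
      then show "\<forall>\<^sub>F n in sequentially. \<bar>LINT z|lborel. fst (W n z) \<bullet> g z\<bar> < \<epsilon>"
        using \<epsilon> by (auto simp: tendsto_iff)
    qed
    \<comment> \<open>Multiplied by the amplitude this error is at most \<delta> / 2; the summand 1
      covers amplitudes equal to zero.\<close>
    have close: "\<forall>\<^sub>F n in sequentially. \<forall>k\<in>q. \<forall>z.
        norm (B k n z - (bump (lo k) (hi k) z * sin (real n * (\<xi> (fst k) \<bullet> (z - (1/2) *\<^sub>R (lo k + hi k))))) *\<^sub>R wave (\<xi> (fst k)))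
          \<le> \<delta> (fst k) / (2 * (A (fst k) + 1))"
      unfolding eventually_ball_finite_distrib[OF fq]
    proof
      fix k assume "k \<in> q"
      have "\<delta> (fst k) / (2 * (A (fst k) + 1)) > 0" using \<delta>[of "fst k"] A0[of "fst k"] by simp
      from block_approx[OF continuous_wave this, of "lo k" "hi k" "\<xi> (fst k)"]
      show "\<forall>\<^sub>F n in sequentially. \<forall>z.
        norm (B k n z - (bump (lo k) (hi k) z * sin (real n * (\<xi> (fst k) \<bullet> (z - (1/2) *\<^sub>R (lo k + hi k))))) *\<^sub>R wave (\<xi> (fst k)))
          \<le> \<delta> (fst k) / (2 * (A (fst k) + 1))" unfolding B_def .
    qed
    from eventually_conj[OF eventually_conj[OF energy weak] eventually_conj[OF close eventually_gt_at_top[of 0]]]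
    obtain n where n: "(LINT z|lborel. (norm (fst (W n z)))\<^sup>2) > I / (2 ^ 23 * e)"
      "\<forall>g\<in>G. \<bar>LINT z|lborel. fst (W n z) \<bullet> g z\<bar> < \<epsilon>"
      "\<And>k z. k \<in> q \<Longrightarrow> norm (B k n z - (bump (lo k) (hi k) z * sin (real n * (\<xi> (fst k) \<bullet> (z - (1/2) *\<^sub>R (lo k + hi k))))) *\<^sub>R wave (\<xi> (fst k)))
          \<le> \<delta> (fst k) / (2 * (A (fst k) + 1))" "n > 0"
      using eventually_happens'[OF sequentially_bot] by blast
    define Z' where "Z' = (\<lambda>z. Z z + W n z)"
    have "subsolution e D Z'"
      unfolding subsolution_def
    proof (intro conjI allI impI)
      show "continuous_on UNIV Z'" unfolding Z'_def W_def by (intro continuous_intros cZ cB)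
      show "div_free_state Z'" unfolding Z'_def W_def
        by (rule div_free_state_sum[OF fq _ dZ]) (use n(4) nd in \<open>simp add: B_def div_free_state_block\<close>)
      fix z
      show "Z' z = 0" if "z \<notin> D"
      proof -
        have "W n z = 0"
          using Wcases[of n z] small r(2)[OF tag] that box_subset_cbox by blast
        then show ?thesis using outZ[OF that] by (simp add: Z'_def)
      qed
      show "gen_energy (Z' z) < e"
      proof (cases "W n z = 0")
        case True
        then show ?thesis using HZ by (simp add: Z'_def)
      next
        case False
        \<comment> \<open>Exactly one wave is active at z. Half of the margin \<delta> at its tag
          pays for the distance of Z z from the value at the tag, the other half for the packet
          error.\<close>
        then obtain k where k: "k \<in> q" "z \<in> box (lo k) (hi k)" "W n z = A (fst k) *\<^sub>R B k n z"
          using Wcases[of n z] by blast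
        define x \<tau> where "x = fst k" and "\<tau> = bump (lo k) (hi k) z * sin (real n * (\<xi> (fst k) \<bullet> (z - (1/2) *\<^sub>R (lo k + hi k))))"
        have \<tau>: "\<bar>\<tau>\<bar> \<le> 1"
        proof -
          have "\<bar>\<tau>\<bar> \<le> 1 * 1" unfolding \<tau>_def abs_mult using bump_nonneg bump_le_1 by (intro mult_mono) auto
          then show ?thesis by simp
        qed
        have "z \<in> ball x (r x)" using small[OF k(1)] k(2) box_subset_cbox unfolding x_def by blast
        then have 1: "norm (Z z - Z x) < \<delta> x / 2" by (rule r(3))
        have "norm (A x *\<^sub>R (B k n z - \<tau> *\<^sub>R wave (\<xi> x))) \<le> A x * (\<delta> x / (2 * (A x + 1)))"
          unfolding norm_scaleR abs_of_nonneg[OF A0] x_def \<tau>_def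
          by (rule mult_left_mono[OF n(3)[OF k(1)] A0])
        also have "\<dots> = (\<delta> x / 2) * (A x / (A x + 1))" by simp
        also have "\<dots> \<le> (\<delta> x / 2) * 1" using A0[of x] \<delta>[of x] by (intro mult_left_mono) auto
        finally have 2: "norm (A x *\<^sub>R (B k n z - \<tau> *\<^sub>R wave (\<xi> x))) \<le> \<delta> x / 2" by simp
        have Q: "Z' z - (Z x + (\<tau> * A x) *\<^sub>R wave (\<xi> x)) = (Z z - Z x) + A x *\<^sub>R (B k n z - \<tau> *\<^sub>R wave (\<xi> x))"
          unfolding Z'_def k(3) x_def[symmetric] by (simp add: scaleR_diff_right mult.commute)
        have "norm (Z' z - (Z x + (\<tau> * A x) *\<^sub>R wave (\<xi> x))) < \<delta> x"
          unfolding Q by (rule norm_triangle_lt) (use 1 2 in linarith)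
        then show ?thesis by (rule stay[OF \<tau>])
      qed
    qed
    moreover have "fst (Z' z) - fst (Z z) = fst (W n z)" for z by (simp add: Z'_def)
    ultimately show ?thesis using n(1,2) unfolding I_def by (intro exI[of _ Z']) auto
  qed
qed


text \<open>The last bound is the decisive one: the distance of the matrix part from half the
  squared velocity is controlled by the energy gap, so a closing gap enforces the quadratic
  constraint in the limit.\<close>

lemma subsolution_D:
  assumes "subsolution e D Z"
  shows "continuous_on UNIV (\<lambda>z. fst (Z z))" "\<And>z. z \<notin> D \<Longrightarrow> fst (Z z) = 0"
    "\<And>z. (norm (fst (Z z)))\<^sup>2 < 2 * e" "\<And>z. norm (snd (Z z) - (fst (Z z))\<^sup>2 / 2) \<le> e - (norm (fst (Z z)))\<^sup>2 / 2"
proof -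
  show "continuous_on UNIV (\<lambda>z. fst (Z z))" using assms unfolding subsolution_def by (intro continuous_intros) auto
  show "\<And>z. z \<notin> D \<Longrightarrow> fst (Z z) = 0"
    using assms unfolding subsolution_def by (simp del: split_paired_All)
  have H: "(norm (fst (Z z)))\<^sup>2 / 2 + norm (snd (Z z) - (fst (Z z))\<^sup>2 / 2) < e" for z
    using assms unfolding subsolution_def gen_energy_def by blast
  show "(norm (fst (Z z)))\<^sup>2 < 2 * e" for z using H[of z] norm_ge_zero[of "snd (Z z) - (fst (Z z))\<^sup>2 / 2"] by linarith
  show "norm (snd (Z z) - (fst (Z z))\<^sup>2 / 2) \<le> e - (norm (fst (Z z)))\<^sup>2 / 2" for z using H[of z] by linarith
qed

text \<open>The recursion also carries the finite set of all velocities so far, so each new step can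
  be made almost orthogonal to every earlier stage, with errors halved at each step to be
  summable.\<close>

lemma subsolution_sequence:
  assumes D: "open D" "bounded D" and Z0: "subsolution e D Z0" and \<epsilon>: "\<epsilon> > 0"
  obtains Z where "Z 0 = Z0" "\<And>n. subsolution e D (Z n)"
    "\<And>n k. k \<le> n \<Longrightarrow> \<bar>LINT z|lborel. (fst (Z (Suc n) z) - fst (Z n z)) \<bullet> fst (Z k z)\<bar> < \<epsilon> / 2 ^ Suc n"
    "\<And>n. deficit e D (Z n) / (2 ^ 23 * e) \<le> (LINT z|lborel. (norm (fst (Z (Suc n) z) - fst (Z n z)))\<^sup>2)"
proof -
  define P where "P = (\<lambda>n::nat. \<lambda>(Z, G). subsolution e D Z \<and> finite G \<and> (\<forall>g\<in>G. continuous_on UNIV g) \<and>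
    (\<lambda>z. fst (Z z)) \<in> G \<and> (n = 0 \<longrightarrow> Z = Z0))"
  \<comment> \<open>Keeping G inside G' preserves the velocity of stage k as a test field for all
    steps n \<ge> k.\<close>
  define Q where "Q = (\<lambda>n::nat. \<lambda>(Z :: stpoint \<Rightarrow> complex \<times> complex, G) (Z' :: stpoint \<Rightarrow> complex \<times> complex, G'). G \<subseteq> G' \<and>
    (\<forall>g\<in>G. \<bar>LINT z|lborel. (fst (Z' z) - fst (Z z)) \<bullet> g z\<bar> < \<epsilon> / 2 ^ Suc n) \<and>
    deficit e D Z / (2 ^ 23 * e) \<le> (LINT z|lborel. (norm (fst (Z' z) - fst (Z z)))\<^sup>2))"
  have "\<exists>f. \<forall>n. P n (f n) \<and> Q n (f n) (f (Suc n))"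
  proof (rule dependent_nat_choice)
    show "\<exists>x. P 0 x"
      using Z0 subsolution_D(1)[OF Z0] by (intro exI[of _ "(Z0, {\<lambda>z. fst (Z0 z)})"]) (simp add: P_def)
  next
    fix x n assume "P n x"
    then obtain Z G where x: "x = (Z, G)" and Z: "subsolution e D Z" and G: "finite G" "\<And>g. g \<in> G \<Longrightarrow> continuous_on UNIV g"
      by (auto simp: P_def split: prod.splits)
    have "\<epsilon> / 2 ^ Suc n > 0" using \<epsilon> by simp
    from subsolution_step[OF D Z G this] obtain Z' where Z': "subsolution e D Z'"
      "\<forall>g\<in>G. \<bar>LINT z|lborel. (fst (Z' z) - fst (Z z)) \<bullet> g z\<bar> < \<epsilon> / 2 ^ Suc n"
      "deficit e D Z / (2 ^ 23 * e) \<le> (LINT z|lborel. (norm (fst (Z' z) - fst (Z z)))\<^sup>2)"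
      by blast
    show "\<exists>y. P (Suc n) y \<and> Q n x y"
      using Z' G subsolution_D(1)[OF Z'(1)]
      by (intro exI[of _ "(Z', insert (\<lambda>z. fst (Z' z)) G)"]) (auto simp: P_def Q_def x)
  qed
  then obtain f where f: "\<And>n. P n (f n)" "\<And>n. Q n (f n) (f (Suc n))" by blast
  define Z G where "Z = (\<lambda>n. fst (f n))" and "G = (\<lambda>n. snd (f n))"
  have fe: "f n = (Z n, G n)" for n by (simp add: Z_def G_def)
  have "G n \<subseteq> G (Suc n)" for n using f(2)[of n] unfolding Q_def fe by simp
  then have mono: "G k \<subseteq> G n" if "k \<le> n" for k n using that by (rule lift_Suc_mono_le)
  show ?thesis
  proof (rule that[of Z])
    show "Z 0 = Z0" using f(1)[of 0] unfolding P_def fe by simp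
    show "subsolution e D (Z n)" for n using f(1)[of n] unfolding P_def fe by simp
    show "\<bar>LINT z|lborel. (fst (Z (Suc n) z) - fst (Z n z)) \<bullet> fst (Z k z)\<bar> < \<epsilon> / 2 ^ Suc n" if "k \<le> n" for n k
    proof -
      have "(\<lambda>z. fst (Z k z)) \<in> G k" using f(1)[of k] unfolding P_def fe by simp
      then have "(\<lambda>z. fst (Z k z)) \<in> G n" using mono[OF that] by blast
      then show ?thesis using f(2)[of n] unfolding Q_def fe by force
    qed
    show "deficit e D (Z n) / (2 ^ 23 * e) \<le> (LINT z|lborel. (norm (fst (Z (Suc n) z) - fst (Z n z)))\<^sup>2)" for n
      using f(2)[of n] unfolding Q_def fe by simp
  qed
qed

text \<open>
  By near-orthogonality the squared norms are increasing up to a summable error and control the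
  distances between stages, so boundedness of the energy yields strong convergence.
\<close>

lemma convex_integration:
  assumes D: "open D" "bounded D" and Z0: "subsolution e D Z0" and \<epsilon>: "\<epsilon> > 0"
  obtains Z u where "\<And>n. subsolution e D (Z n)" "u \<in> borel_measurable lborel" "\<And>z. z \<notin> D \<Longrightarrow> u z = 0"
    "AE z in lborel. (\<lambda>n. Z n z) \<longlonglongrightarrow> (u z, (u z)\<^sup>2 / 2)"
    "AE z in lborel. z \<in> D \<longrightarrow> (norm (u z))\<^sup>2 = 2 * e"
    "\<bar>LINT z|lborel. (u z - fst (Z0 z)) \<bullet> fst (Z0 z)\<bar> \<le> \<epsilon>"
proof -
  obtain Z where Z00: "Z 0 = Z0" and Z: "\<And>n. subsolution e D (Z n)"
    and orth: "\<And>n k. k \<le> n \<Longrightarrow> \<bar>LINT z|lborel. (fst (Z (Suc n) z) - fst (Z n z)) \<bullet> fst (Z k z)\<bar> < \<epsilon> / 2 ^ Suc n"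
    and gain: "\<And>n. deficit e D (Z n) / (2 ^ 23 * e) \<le> (LINT z|lborel. (norm (fst (Z (Suc n) z) - fst (Z n z)))\<^sup>2)"
    using subsolution_sequence[OF D Z0 \<epsilon>] by blast
  define U where "U = (\<lambda>n z. fst (Z n z))"
  have cU: "continuous_on UNIV (U n)" and outU: "z \<notin> D \<Longrightarrow> U n z = 0" and U2: "(norm (U n z))\<^sup>2 \<le> 2 * e" for n z
    using subsolution_D[OF Z[of n]] by (auto simp: U_def less_imp_le)
  have e0: "e > 0"
  proof -
    have "0 \<le> (norm (fst (Z 0 0)))\<^sup>2" by simp
    with subsolution_D(3)[OF Z[of 0], of 0] show ?thesis by linarith
  qed
  define V where "V = measure lborel D"
  have V0: "V \<ge> 0" by (simp add: V_def)
  have emD: "emeasure lborel D < \<infinity>" by (rule emeasure_bounded_finite[OF D(2)])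
  have mD: "D \<in> sets lborel" using D(1) by simp
  have icD: "integrable lborel (\<lambda>z. indicator D z * (r::real))" for r
    using emD mD by (intro integrable_mult_left integrable_real_indicator) auto
  have ii: "integrable lborel (\<lambda>z. U n z \<bullet> U m z)" for n m
    by (rule integrable_continuous_bounded_support[OF _ D(2)]) (auto intro!: continuous_intros cU simp: outU)
  have id: "integrable lborel (\<lambda>z. (U n z - U m z) \<bullet> U k z)" for n m k
    by (rule integrable_continuous_bounded_support[OF _ D(2)]) (auto intro!: continuous_intros cU simp: outU)
  have id2: "integrable lborel (\<lambda>z. (norm (U n z - U m z))\<^sup>2)" for n m
    by (rule integrable_continuous_bounded_support[OF _ D(2)]) (auto intro!: continuous_intros cU simp: outU)
  have id1: "integrable lborel (\<lambda>z. norm (U n z - U m z))" for n m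
    by (rule integrable_continuous_bounded_support[OF _ D(2)]) (auto intro!: continuous_intros cU simp: outU)
  have iU: "integrable lborel (U n)" for n
    by (rule integrable_continuous_bounded_support[OF cU D(2)]) (auto simp: outU)
  define a where "a = (\<lambda>n. LINT z|lborel. U n z \<bullet> U n z)"
  have aM: "a n \<le> 2 * e * V" for n
  proof -
    have "a n \<le> (LINT z|lborel. indicator D z * (2 * e))"
      unfolding a_def
    proof (rule integral_mono[OF ii icD])
      show "U n z \<bullet> U n z \<le> indicator D z * (2 * e)" for z
        using U2[of n z] outU[of z n] by (cases "z \<in> D") (auto simp: power2_norm_eq_inner)
    qed
    also have "\<dots> = 2 * e * V" by (simp add: V_def)
    finally show ?thesis .
  qed
  \<comment> \<open>The errors \<epsilon> / 2^(i+1) for k \<le> i < m sum to exactly \<epsilon> /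
    2^k - \<epsilon> / 2^m.\<close>
  have prod: "\<bar>LINT z|lborel. (U m z - U k z) \<bullet> U j z\<bar> \<le> \<epsilon> / 2 ^ k - \<epsilon> / 2 ^ m" if "j \<le> k" "k \<le> m" for m k j
    using that(2)
  proof (induction m rule: dec_induct)
    case base
    then show ?case by simp
  next
    case (step m)
    have "(LINT z|lborel. (U (Suc m) z - U k z) \<bullet> U j z) = (LINT z|lborel. (U (Suc m) z - U m z) \<bullet> U j z + (U m z - U k z) \<bullet> U j z)"
      by (intro Bochner_Integration.integral_cong) (auto simp: inner_diff_left)
    also have "\<dots> = (LINT z|lborel. (U (Suc m) z - U m z) \<bullet> U j z) + (LINT z|lborel. (U m z - U k z) \<bullet> U j z)"
      by (rule Bochner_Integration.integral_add[OF id id])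
    finally have "\<bar>LINT z|lborel. (U (Suc m) z - U k z) \<bullet> U j z\<bar> \<le> \<epsilon> / 2 ^ Suc m + (\<epsilon> / 2 ^ k - \<epsilon> / 2 ^ m)"
      using orth[of j m, folded U_def] step that(1) unfolding U_def by linarith
    then show ?case by simp
  qed
  have dist2: "(LINT z|lborel. (norm (U m z - U k z))\<^sup>2) = a m - a k - 2 * (LINT z|lborel. (U m z - U k z) \<bullet> U k z)" for m k
  proof -
    have "(norm (U m z - U k z))\<^sup>2 = U m z \<bullet> U m z - U k z \<bullet> U k z - 2 * ((U m z - U k z) \<bullet> U k z)" for z
      by (simp add: power2_norm_eq_inner inner_diff_left inner_diff_right inner_commute)
    then show ?thesis unfolding a_def by (simp add: ii id)
  qed
  \<comment> \<open>Twice the orthogonality error of one step is 2 \<epsilon> / 2^(n+1), exactly the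
    increment of the correction term. So b is increasing although a need not be.\<close>
  define b where "b = (\<lambda>n. a n - 2 * \<epsilon> / 2 ^ n)"
  have bstep: "b n + deficit e D (Z n) / (2 ^ 23 * e) \<le> b (Suc n)" for n
  proof -
    have "\<bar>LINT z|lborel. (U (Suc n) z - U n z) \<bullet> U n z\<bar> \<le> \<epsilon> / 2 ^ Suc n"
      using orth[of n n] by (simp add: U_def less_imp_le)
    then have "a (Suc n) \<ge> a n + deficit e D (Z n) / (2 ^ 23 * e) - 2 * (\<epsilon> / 2 ^ Suc n)"
      using gain[of n] dist2[of "Suc n" n] unfolding U_def by linarith
    then show ?thesis by (simp add: b_def)
  qed
  have def0: "deficit e D (Z n) / (2 ^ 23 * e) \<ge> 0" for n
    unfolding deficit_def using e0 by (intro divide_nonneg_nonneg Bochner_Integration.integral_nonneg) auto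
  have "incseq b" by (intro incseq_SucI order_trans[OF _ bstep]) (use def0 in simp)
  moreover have "b n \<le> 2 * e * V" for n
  proof -
    have "2 * \<epsilon> / 2 ^ n \<ge> 0" using \<epsilon> by simp
    then show ?thesis using aM[of n] unfolding b_def by linarith
  qed
  ultimately obtain B where B: "b \<longlonglongrightarrow> B" using incseq_convergent by blast
  have "(\<lambda>n. deficit e D (Z n) / (2 ^ 23 * e)) \<longlonglongrightarrow> 0"
  proof (rule tendsto_sandwich[of "\<lambda>_. 0" _ _ "\<lambda>n. b (Suc n) - b n"])
    show "(\<lambda>n. b (Suc n) - b n) \<longlonglongrightarrow> 0" using tendsto_diff[OF LIMSEQ_Suc[OF B] B] by simp
    show "\<forall>\<^sub>F n in sequentially. deficit e D (Z n) / (2 ^ 23 * e) \<le> b (Suc n) - b n"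
      using bstep by (intro always_eventually allI) (simp add: algebra_simps)
  qed (use def0 in auto)
  from tendsto_mult[OF this tendsto_const[of "2 ^ 23 * e"]]
  have deflim: "(\<lambda>n. deficit e D (Z n)) \<longlonglongrightarrow> 0" using e0 by simp
  \<comment> \<open>Squared L^2 distances are bounded by increments of b, so the stages are Cauchy
    in L^2. On the set D of finite measure the inequality x \<le> \<delta> / 2 + x^2 / (2 \<delta>)
    turns this into the Cauchy property in L^1.\<close>
  have L1: "\<exists>N. \<forall>i\<ge>N. \<forall>j\<ge>N. (LINT z|lborel. norm (U i z - U j z)) < \<eta>" if \<eta>: "\<eta> > 0" for \<eta>
  proof -
    define \<delta> where "\<delta> = \<eta> / (V + 1)"
    have \<delta>: "\<delta> > 0" "\<delta> * V < \<eta>" using \<eta> V0 by (auto simp: \<delta>_def field_simps)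
    have "Cauchy b" using B by (rule LIMSEQ_imp_Cauchy)
    then obtain N1 where N1: "\<And>i j. i \<ge> N1 \<Longrightarrow> j \<ge> N1 \<Longrightarrow> dist (b i) (b j) < \<eta> * \<delta>"
      unfolding Cauchy_def using \<eta> \<delta>(1) by (meson mult_pos_pos)
    have main: "(LINT z|lborel. norm (U m z - U k z)) < \<eta>" if mk: "k \<le> m" "k \<ge> N1" for m k
    proof -
      have "(LINT z|lborel. (norm (U m z - U k z))\<^sup>2) \<le> a m - a k + 2 * (\<epsilon> / 2 ^ k - \<epsilon> / 2 ^ m)"
      proof -
        have gen: "x - 2 * J \<le> x + 2 * R" if "\<bar>J\<bar> \<le> R" for x J R :: real using that by linarith
        show ?thesis unfolding dist2 by (rule gen[OF prod[OF order_refl mk(1)]])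
      qed
      also have "\<dots> = b m - b k" by (simp add: b_def)
      also have "\<dots> < \<eta> * \<delta>"
        using N1[of m k] mk by (simp add: dist_real_def)
      finally have sq: "(LINT z|lborel. (norm (U m z - U k z))\<^sup>2) < \<eta> * \<delta>" .
      have "(LINT z|lborel. norm (U m z - U k z)) \<le> (LINT z|lborel. (indicator D z * (\<delta> / 2) + (norm (U m z - U k z))\<^sup>2 / (2 * \<delta>)))"
      proof (rule integral_mono[OF id1])
        show "integrable lborel (\<lambda>z. indicator D z * (\<delta> / 2) + (norm (U m z - U k z))\<^sup>2 / (2 * \<delta>))"
          by (intro Bochner_Integration.integrable_add icD integrable_divide id2)
        show "norm (U m z - U k z) \<le> indicator D z * (\<delta> / 2) + (norm (U m z - U k z))\<^sup>2 / (2 * \<delta>)" for z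
        proof (cases "z \<in> D")
          case True
          define x where "x = norm (U m z - U k z)"
          have "0 \<le> (x - \<delta>)\<^sup>2" by simp
          then have "x \<le> \<delta> / 2 + x\<^sup>2 / (2 * \<delta>)" using \<delta>(1) by (simp add: power2_eq_square field_simps)
          then show ?thesis using True by (simp add: x_def)
        qed (simp add: outU)
      qed
      also have "\<dots> = (LINT z|lborel. indicator D z * (\<delta> / 2)) + (LINT z|lborel. (norm (U m z - U k z))\<^sup>2 / (2 * \<delta>))"
        by (intro Bochner_Integration.integral_add icD integrable_divide id2)
      also have "\<dots> = V * (\<delta> / 2) + (LINT z|lborel. (norm (U m z - U k z))\<^sup>2) / (2 * \<delta>)"
        by (simp add: V_def)
      also have "\<dots> < \<eta> / 2 + \<eta> * \<delta> / (2 * \<delta>)"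
        using \<delta> sq by (intro add_strict_mono divide_strict_right_mono) (auto simp: mult.commute)
      finally show ?thesis using \<delta>(1) by simp
    qed
    have "(LINT z|lborel. norm (U i z - U j z)) < \<eta>" if "i \<ge> N1" "j \<ge> N1" for i j
    proof (cases "j \<le> i")
      case True
      then show ?thesis using main that by blast
    next
      case False
      then have "(LINT z|lborel. norm (U j z - U i z)) < \<eta>" using main[of i j] that by simp
      then show ?thesis by (simp add: norm_minus_commute)
    qed
    then show ?thesis by blast
  qed
  \<comment> \<open>A subsequence converges almost everywhere. The deficits of the full sequence
    tend to zero, hence also those along it, and dominated convergence gives a limit without
    deficit.\<close>
  obtain r where r: "strict_mono r" "AE z in lborel. Cauchy (\<lambda>i. U (r i) z)"
    using cauchy_L1_AE_cauchy_subseq[of lborel U] iU L1 by blast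
  define u where "u = (\<lambda>z. if z \<in> D then lim (\<lambda>i. U (r i) z) else 0)"
  have Um: "U n \<in> borel_measurable lborel" for n using iU by (rule borel_measurable_integrable)
  have um: "u \<in> borel_measurable lborel"
  proof -
    have "(\<lambda>z. lim (\<lambda>i. U (r i) z)) \<in> borel_measurable lborel"
      by (rule borel_measurable_lim_metric[OF Um])
    then show ?thesis unfolding u_def using mD by (intro measurable_If_set) auto
  qed
  have lim: "AE z in lborel. (\<lambda>i. U (r i) z) \<longlonglongrightarrow> u z"
    using r(2)
  proof (rule eventually_mono)
    fix z assume "Cauchy (\<lambda>i. U (r i) z)"
    then have "(\<lambda>i. U (r i) z) \<longlonglongrightarrow> lim (\<lambda>i. U (r i) z)"
      unfolding Cauchy_convergent_iff convergent_LIMSEQ_iff .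
    then show "(\<lambda>i. U (r i) z) \<longlonglongrightarrow> u z" by (cases "z \<in> D") (auto simp: u_def outU)
  qed
  have gap: "\<bar>e - (norm (U n z))\<^sup>2 / 2\<bar> \<le> e" for n z
    using U2[of n z] zero_le_power2[of "norm (U n z)"] unfolding abs_le_iff by linarith
  have "(\<lambda>i. deficit e D (Z (r i))) \<longlonglongrightarrow> (LINT z|lborel. indicator D z * (e - (norm (u z))\<^sup>2 / 2)\<^sup>2)"
    unfolding deficit_def
  proof (rule integral_dominated_convergence[where w = "\<lambda>z. indicator D z * e\<^sup>2"])
    show "(\<lambda>z. indicator D z * (e - (norm (u z))\<^sup>2 / 2)\<^sup>2) \<in> borel_measurable lborel"
      using um mD by measurable
    show "(\<lambda>z. indicator D z * (e - (norm (fst (Z (r i) z)))\<^sup>2 / 2)\<^sup>2) \<in> borel_measurable lborel" for i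
      using deficit_integrable[OF Z D] by (rule borel_measurable_integrable)
    show "integrable lborel (\<lambda>z. indicator D z * e\<^sup>2)" by (rule icD)
    show "AE z in lborel. (\<lambda>i. indicator D z * (e - (norm (fst (Z (r i) z)))\<^sup>2 / 2)\<^sup>2) \<longlonglongrightarrow> indicator D z * (e - (norm (u z))\<^sup>2 / 2)\<^sup>2"
      using lim by (rule eventually_mono) (unfold U_def, intro tendsto_intros, auto)
    show "AE z in lborel. norm (indicator D z * (e - (norm (fst (Z (r i) z)))\<^sup>2 / 2)\<^sup>2) \<le> indicator D z * e\<^sup>2" for i
    proof (rule AE_I2)
      fix z
      have "(e - (norm (fst (Z (r i) z)))\<^sup>2 / 2)\<^sup>2 \<le> e\<^sup>2"
        using gap[of "r i" z] e0 unfolding U_def by (metis abs_le_square_iff abs_of_pos)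
      then show "norm (indicator D z * (e - (norm (fst (Z (r i) z)))\<^sup>2 / 2)\<^sup>2) \<le> indicator D z * e\<^sup>2"
        by (cases "z \<in> D") auto
    qed
  qed
  moreover have "(\<lambda>i. deficit e D (Z (r i))) \<longlonglongrightarrow> 0"
    using LIMSEQ_subseq_LIMSEQ[OF deflim r(1)] by (simp add: o_def)
  ultimately have zero: "(LINT z|lborel. indicator D z * (e - (norm (u z))\<^sup>2 / 2)\<^sup>2) = 0"
    using LIMSEQ_unique by blast
  have u2: "AE z in lborel. (norm (u z))\<^sup>2 \<le> 2 * e"
    using lim
  proof (rule eventually_mono)
    fix z assume "(\<lambda>i. U (r i) z) \<longlonglongrightarrow> u z"
    then have "(\<lambda>i. (norm (U (r i) z))\<^sup>2) \<longlonglongrightarrow> (norm (u z))\<^sup>2" by (intro tendsto_intros)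
    then show "(norm (u z))\<^sup>2 \<le> 2 * e" by (rule LIMSEQ_le_const2) (use U2 in auto)
  qed
  have iu: "integrable lborel (\<lambda>z. indicator D z * (e - (norm (u z))\<^sup>2 / 2)\<^sup>2)"
  proof (rule Bochner_Integration.integrable_bound[OF icD[of "e\<^sup>2"]])
    show "(\<lambda>z. indicator D z * (e - (norm (u z))\<^sup>2 / 2)\<^sup>2) \<in> borel_measurable lborel"
      using um mD by measurable
    show "AE z in lborel. norm (indicator D z * (e - (norm (u z))\<^sup>2 / 2)\<^sup>2) \<le> norm (indicator D z * e\<^sup>2)"
      using u2
    proof (rule eventually_mono)
      fix z assume "(norm (u z))\<^sup>2 \<le> 2 * e"
      then have "\<bar>e - (norm (u z))\<^sup>2 / 2\<bar> \<le> \<bar>e\<bar>" using zero_le_power2[of "norm (u z)"] e0 by (simp add: abs_le_iff)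
      then show "norm (indicator D z * (e - (norm (u z))\<^sup>2 / 2)\<^sup>2) \<le> norm (indicator D z * e\<^sup>2)"
        by (cases "z \<in> D") (simp_all add: abs_le_square_iff)
    qed
  qed
  have full: "AE z in lborel. z \<in> D \<longrightarrow> (norm (u z))\<^sup>2 = 2 * e"
    using integral_nonneg_eq_0_iff_AE[OF iu] zero
    by (auto elim!: eventually_mono)
  show ?thesis
  proof (rule that[of "\<lambda>i. Z (r i)" u])
    show "AE z in lborel. (\<lambda>i. Z (r i) z) \<longlonglongrightarrow> (u z, (u z)\<^sup>2 / 2)"
      using lim full
    proof eventually_elim
      case (elim z)
      have "(\<lambda>i. snd (Z (r i) z)) \<longlonglongrightarrow> (u z)\<^sup>2 / 2"
      proof (cases "z \<in> D")
        case False
        then have "snd (Z (r i) z) = 0" for i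
          using Z[of "r i"] unfolding subsolution_def by (simp del: split_paired_All)
        then show ?thesis using False by (simp add: u_def)
      next
        case True
        have "(\<lambda>i. e - (norm (U (r i) z))\<^sup>2 / 2) \<longlonglongrightarrow> e - (norm (u z))\<^sup>2 / 2"
          using elim(1) by (intro tendsto_intros) auto
        then have "(\<lambda>i. e - (norm (U (r i) z))\<^sup>2 / 2) \<longlonglongrightarrow> 0" using elim(2) True by simp
        then have "(\<lambda>i. snd (Z (r i) z) - (U (r i) z)\<^sup>2 / 2) \<longlonglongrightarrow> 0"
          by (rule Lim_null_comparison[rotated]) (use subsolution_D(4)[OF Z] in \<open>auto simp: U_def\<close>)
        moreover have "(\<lambda>i. (U (r i) z)\<^sup>2 / 2) \<longlonglongrightarrow> (u z)\<^sup>2 / 2" using elim(1) by (intro tendsto_intros) auto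
        ultimately have "(\<lambda>i. (snd (Z (r i) z) - (U (r i) z)\<^sup>2 / 2) + (U (r i) z)\<^sup>2 / 2) \<longlonglongrightarrow> 0 + (u z)\<^sup>2 / 2" by (rule tendsto_add)
        then show ?thesis by simp
      qed
      with elim(1) have "(\<lambda>i. (fst (Z (r i) z), snd (Z (r i) z))) \<longlonglongrightarrow> (u z, (u z)\<^sup>2 / 2)"
        unfolding U_def by (rule tendsto_Pair)
      then show ?case by simp
    qed
    show "\<bar>LINT z|lborel. (u z - fst (Z0 z)) \<bullet> fst (Z0 z)\<bar> \<le> \<epsilon>"
    proof -
      have "(\<lambda>i. LINT z|lborel. (U (r i) z - U 0 z) \<bullet> U 0 z) \<longlonglongrightarrow> (LINT z|lborel. (u z - U 0 z) \<bullet> U 0 z)"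
      proof (rule integral_dominated_convergence[where w = "\<lambda>z. indicator D z * (4 * e)"])
        show "(\<lambda>z. (u z - U 0 z) \<bullet> U 0 z) \<in> borel_measurable lborel" using um Um by measurable
        show "(\<lambda>z. (U (r i) z - U 0 z) \<bullet> U 0 z) \<in> borel_measurable lborel" for i using Um by measurable
        show "integrable lborel (\<lambda>z. indicator D z * (4 * e))" by (rule icD)
        show "AE z in lborel. (\<lambda>i. (U (r i) z - U 0 z) \<bullet> U 0 z) \<longlonglongrightarrow> (u z - U 0 z) \<bullet> U 0 z"
          using lim by (rule eventually_mono) (intro tendsto_intros)
        show "AE z in lborel. norm ((U (r i) z - U 0 z) \<bullet> U 0 z) \<le> indicator D z * (4 * e)" for i
        proof (rule AE_I2)
          fix z
          show "norm ((U (r i) z - U 0 z) \<bullet> U 0 z) \<le> indicator D z * (4 * e)"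
          proof (cases "z \<in> D")
            case True
            have n: "norm (U n z) \<le> sqrt (2 * e)" for n using U2[of n z] by (rule real_le_rsqrt)
            have "\<bar>(U (r i) z - U 0 z) \<bullet> U 0 z\<bar> \<le> norm (U (r i) z - U 0 z) * norm (U 0 z)" by (rule Cauchy_Schwarz_ineq2)
            also have "\<dots> \<le> (sqrt (2 * e) + sqrt (2 * e)) * sqrt (2 * e)"
              using n[of "r i"] n[of 0] e0 norm_triangle_ineq4[of "U (r i) z" "U 0 z"]
              by (intro mult_mono) auto
            also have "\<dots> = 4 * e" using e0 by (simp add: algebra_simps)
            finally show ?thesis using True by simp
          qed (simp add: outU)
        qed
      qed
      then have "(\<lambda>i. \<bar>LINT z|lborel. (U (r i) z - U 0 z) \<bullet> U 0 z\<bar>) \<longlonglongrightarrow> \<bar>LINT z|lborel. (u z - U 0 z) \<bullet> U 0 z\<bar>"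
        by (rule tendsto_rabs)
      \<comment> \<open>The telescoped bound starting from stage 0 is uniform in m, hence survives
        the limit.\<close>
      moreover have "\<bar>LINT z|lborel. (U m z - U 0 z) \<bullet> U 0 z\<bar> \<le> \<epsilon>" for m
      proof -
        have "\<epsilon> / 2 ^ m \<ge> 0" using \<epsilon> by simp
        then show ?thesis using prod[of 0 0 m] by simp
      qed
      ultimately have "\<bar>LINT z|lborel. (u z - U 0 z) \<bullet> U 0 z\<bar> \<le> \<epsilon>"
        by (intro LIMSEQ_le_const2) auto
      then show ?thesis by (simp add: U_def Z00)
    qed
  qed (use Z um full in \<open>auto simp: u_def\<close>)
qed


subsection \<open>Wild initial data\<close>

lemma AE_lborel_shift:
  fixes c :: "'a::euclidean_space"
  assumes "AE z in lborel. P z"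
  shows "AE z in lborel. P (z + c)"
proof -
  obtain N where N: "{z. \<not> P z} \<subseteq> N" "N \<in> sets borel" "emeasure lborel N = 0"
    using assms by (auto elim!: AE_E)
  have "emeasure lborel ((\<lambda>z. c + z) -` N) = emeasure (distr lborel borel ((+) c)) N"
    using N(2) by (subst emeasure_distr) auto
  also have "\<dots> = 0" using N(3) by (simp only: lborel_distr_plus)
  finally have "emeasure lborel ((\<lambda>z. c + z) -` N) = 0" .
  moreover have "(\<lambda>z. c + z) -` N \<in> sets borel"
    using measurable_sets_borel[of "\<lambda>z. c + z" borel N] N(2) by simp
  ultimately have "(\<lambda>z. c + z) -` N \<in> null_sets lborel" by auto
  then have "AE z in lborel. z \<notin> (\<lambda>z. c + z) -` N" by (rule AE_not_in)
  then show ?thesis by (rule eventually_mono) (use N(1) in \<open>auto simp: add.commute\<close>)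
qed

lemma AE_fst_neq: "AE z::stpoint in lborel. fst z \<noteq> c"
proof -
  have "negligible {z::stpoint. z \<bullet> (1, 0) = c}"
    by (rule negligible_standard_hyperplane) (simp add: Basis_prod_def)
  moreover have "closed {z::stpoint. z \<bullet> (1, 0) = c}"
    by (intro closed_Collect_eq continuous_intros)
  ultimately have "{z::stpoint. z \<bullet> (1, 0) = c} \<in> null_sets lborel"
    unfolding negligible_iff_null_sets by (subst (asm) null_sets_completion_iff) auto
  then have "AE z::stpoint in lborel. z \<notin> {z. z \<bullet> (1, 0) = c}" by (rule AE_not_in)
  then show ?thesis by (rule eventually_mono) (auto simp: inner_prod_def)
qed

text \<open>The datum is a separate argument, because a limit defined almost everywhere has no
  distinguished time slice.\<close>

definition weak_identity :: "(stpoint \<Rightarrow> stpoint) \<Rightarrow> (real^2 \<Rightarrow> stpoint) \<Rightarrow> bool" where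
  "weak_identity F F0 \<longleftrightarrow> (\<forall>\<phi> \<phi>'. c1_test \<phi> \<phi>' \<longrightarrow>
     (LINT z|lborel. indicator half_space z * \<phi>' z (F z)) + (LINT x|lborel. fst (F0 x) * \<phi> (0, x)) = 0)"

text \<open>Dominated convergence in both integrals. Convergence on the slice at time s is a
  hypothesis of its own, since convergence almost everywhere in space-time does not see a single
  time; after the shift the limit starts at s.\<close>

lemma weak_identity_limit:
  assumes F: "\<And>n. weakly_div_free (F n)" and B: "\<And>n z. norm (F n z) \<le> B"
    and lim: "AE z in lborel. (\<lambda>n. F n (z + (s, 0))) \<longlonglongrightarrow> G z" and G: "G \<in> borel_measurable lborel"
    and lim0: "AE x in lborel. (\<lambda>n. F n (s, x)) \<longlonglongrightarrow> G0 x" and G0: "G0 \<in> borel_measurable lborel"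
  shows "weak_identity G G0"
  unfolding weak_identity_def
proof (intro allI impI)
  fix \<phi> \<phi>' assume t: "c1_test \<phi> \<phi>'"
  obtain R where R: "\<And>z. z \<in> half_space \<Longrightarrow> norm z > R \<Longrightarrow> \<phi> z = 0 \<and> (\<forall>v. \<phi>' z v = 0)"
    using t unfolding c1_test_def by blast
  define c where "c = (\<lambda>v z. indicator half_space z * \<phi>' z v)"
  have i': "integrable lborel (c v)" for v
    unfolding c_def by (rule integrable_half_space[OF c1_test_D(4)[OF t]]) (use R in blast)
  have i0: "integrable lborel (\<lambda>x. \<phi> (0, x))"
  proof (rule integrable_continuous_bounded_support[of _ "cball 0 R"])
    show "continuous_on UNIV (\<lambda>x. \<phi> (0, x))"
      by (intro continuous_intros continuous_on_compose2[OF c1_test_D(1)[OF t]]) auto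
    show "\<phi> (0, x) = 0" if "x \<notin> cball 0 R" for x using R[of "(0, x)"] that by (simp add: norm_Pair)
  qed auto
  have B0: "B \<ge> 0" using B[of 0 0] norm_ge_zero[of "F 0 0"] by linarith
  have e: "indicator half_space z * \<phi>' z y = (\<Sum>v\<in>Basis. (y \<bullet> v) * c v z)" for z y
    using c1_test_pairing[OF t, of z y] by (cases "z \<in> half_space") (auto simp: c_def mult_ac)
  have "(\<lambda>n. LINT z|lborel. indicator half_space z * \<phi>' z (F n (z + (s, 0)))) \<longlonglongrightarrow> (LINT z|lborel. indicator half_space z * \<phi>' z (G z))"
  proof (rule integral_dominated_convergence[where w = "\<lambda>z. \<Sum>v\<in>Basis. B * \<bar>c v z\<bar>"])
    show "(\<lambda>z. indicator half_space z * \<phi>' z (G z)) \<in> borel_measurable lborel"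
      unfolding e using G borel_measurable_integrable[OF i'] by measurable
    show "(\<lambda>z. indicator half_space z * \<phi>' z (F n (z + (s, 0)))) \<in> borel_measurable lborel" for n
      by (rule borel_measurable_integrable[OF weakly_div_free_integrable(1)[OF F t]])
    show "integrable lborel (\<lambda>z. \<Sum>v\<in>Basis. B * \<bar>c v z\<bar>)"
      by (intro Bochner_Integration.integrable_sum integrable_mult_right integrable_abs i')
    show "AE z in lborel. (\<lambda>n. indicator half_space z * \<phi>' z (F n (z + (s, 0)))) \<longlonglongrightarrow> indicator half_space z * \<phi>' z (G z)"
      using lim by (rule eventually_mono) (unfold e, intro tendsto_intros)
    show "AE z in lborel. norm (indicator half_space z * \<phi>' z (F n (z + (s, 0)))) \<le> (\<Sum>v\<in>Basis. B * \<bar>c v z\<bar>)" for n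
    proof (rule AE_I2)
      fix z
      show "norm (indicator half_space z * \<phi>' z (F n (z + (s, 0)))) \<le> (\<Sum>v\<in>Basis. B * \<bar>c v z\<bar>)"
        unfolding e
      proof (rule sum_norm_le)
        fix v :: stpoint assume "v \<in> Basis"
        then have "\<bar>F n (z + (s, 0)) \<bullet> v\<bar> \<le> B" using Basis_le_norm B order_trans by blast
        then show "norm ((F n (z + (s, 0)) \<bullet> v) * c v z) \<le> B * \<bar>c v z\<bar>"
          unfolding real_norm_def abs_mult[of "F n (z + (s, 0)) \<bullet> v"] by (rule mult_right_mono) simp
      qed
    qed
  qed
  moreover have "(\<lambda>n. LINT x|lborel. fst (F n (s, x)) * \<phi> (0, x)) \<longlonglongrightarrow> (LINT x|lborel. fst (G0 x) * \<phi> (0, x))"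
  proof (rule integral_dominated_convergence[where w = "\<lambda>x. B * \<bar>\<phi> (0, x)\<bar>"])
    have "(fst :: stpoint \<Rightarrow> real) \<in> borel_measurable borel"
      by (intro borel_measurable_continuous_onI continuous_intros)
    from measurable_compose[OF G0 this] have "(\<lambda>x. fst (G0 x)) \<in> borel_measurable lborel" .
    then show "(\<lambda>x. fst (G0 x) * \<phi> (0, x)) \<in> borel_measurable lborel"
      using borel_measurable_integrable[OF i0] by measurable
    show "(\<lambda>x. fst (F n (s, x)) * \<phi> (0, x)) \<in> borel_measurable lborel" for n
      by (rule borel_measurable_integrable[OF weakly_div_free_integrable(2)[OF F t]])
    show "integrable lborel (\<lambda>x. B * \<bar>\<phi> (0, x)\<bar>)" by (intro integrable_mult_right integrable_abs i0)
    show "AE x in lborel. (\<lambda>n. fst (F n (s, x)) * \<phi> (0, x)) \<longlonglongrightarrow> fst (G0 x) * \<phi> (0, x)"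
      using lim0 by (rule eventually_mono) (intro tendsto_intros)
    show "AE x in lborel. norm (fst (F n (s, x)) * \<phi> (0, x)) \<le> B * \<bar>\<phi> (0, x)\<bar>" for n
    proof (rule AE_I2)
      fix x
      have "norm (fst (F n (s, x))) \<le> norm (F n (s, x))" by (metis norm_fst_le prod.collapse)
      then have "norm (fst (F n (s, x))) \<le> B" using B order_trans by blast
      then show "norm (fst (F n (s, x)) * \<phi> (0, x)) \<le> B * \<bar>\<phi> (0, x)\<bar>"
        unfolding real_norm_def abs_mult by (rule mult_right_mono) simp
    qed
  qed
  ultimately have "(\<lambda>n. (LINT z|lborel. indicator half_space z * \<phi>' z (F n (z + (s, 0)))) + (LINT x|lborel. fst (F n (s, x)) * \<phi> (0, x)))
      \<longlonglongrightarrow> (LINT z|lborel. indicator half_space z * \<phi>' z (G z)) + (LINT x|lborel. fst (G0 x) * \<phi> (0, x))"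
    by (rule tendsto_add)
  moreover have "(LINT z|lborel. indicator half_space z * \<phi>' z (F n (z + (s, 0)))) + (LINT x|lborel. fst (F n (s, x)) * \<phi> (0, x)) = 0" for n
    using F[of n] t unfolding weakly_div_free_def by blast
  ultimately show "(LINT z|lborel. indicator half_space z * \<phi>' z (G z)) + (LINT x|lborel. fst (G0 x) * \<phi> (0, x)) = 0"
    by (simp add: LIMSEQ_const_iff)
qed

text \<open>With half the complex square as the trace-free part of the tensor square, this is the
  incompressible Euler system with the isotropic stress left out; that stress is restored only when
  all pieces are joined.\<close>

definition weak_euler :: "(stpoint \<Rightarrow> complex) \<Rightarrow> (real^2 \<Rightarrow> complex) \<Rightarrow> bool" where
  "weak_euler u u0 \<longleftrightarrow>
     weak_identity (\<lambda>z. momentum1_field (u z, (u z)\<^sup>2 / 2)) (\<lambda>x. momentum1_field (u0 x, (u0 x)\<^sup>2 / 2)) \<and>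
     weak_identity (\<lambda>z. momentum2_field (u z, (u z)\<^sup>2 / 2)) (\<lambda>x. momentum2_field (u0 x, (u0 x)\<^sup>2 / 2)) \<and>
     weak_identity (\<lambda>z. velocity_field (u z, (u z)\<^sup>2 / 2)) (\<lambda>x. velocity_field (u0 x, (u0 x)\<^sup>2 / 2))"

lemma subsolution_norm_le:
  assumes "subsolution e D Z"
  shows "norm (Z z) \<le> sqrt (2 * e) + e"
proof -
  have "norm (fst (Z z)) \<le> sqrt (2 * e)"
    using subsolution_D(3)[OF assms, of z] by (intro real_le_rsqrt) simp
  moreover have "norm (snd (Z z)) \<le> e"
  proof -
    have "norm (snd (Z z)) \<le> norm (snd (Z z) - (fst (Z z))\<^sup>2 / 2) + norm ((fst (Z z))\<^sup>2 / 2)"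
      using norm_triangle_ineq[of "snd (Z z) - (fst (Z z))\<^sup>2 / 2" "(fst (Z z))\<^sup>2 / 2"] by simp
    also have "norm ((fst (Z z))\<^sup>2 / 2) = (norm (fst (Z z)))\<^sup>2 / 2" by (simp add: norm_divide norm_power)
    finally show ?thesis using subsolution_D(4)[OF assms, of z] by linarith
  qed
  moreover have "norm (Z z) \<le> norm (fst (Z z)) + norm (snd (Z z))"
    by (metis norm_Pair_le prod.collapse)
  ultimately show ?thesis by linarith
qed

text \<open>Each of the three fields is a linear image of the state, so bounds and convergence pass
  through. The stages satisfy linear identities only; the quadratic relation enters with the limit
  state.\<close>

lemma weak_euler_limit:
  assumes Z: "\<And>n. div_free_state (Z n)" and B: "\<And>n z. norm (Z n z) \<le> B"
    and lim: "AE z in lborel. (\<lambda>n. Z n (z + (s, 0))) \<longlonglongrightarrow> (u z, (u z)\<^sup>2 / 2)" and u: "u \<in> borel_measurable lborel"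
    and lim0: "AE x in lborel. (\<lambda>n. Z n (s, x)) \<longlonglongrightarrow> (u0 x, (u0 x)\<^sup>2 / 2)" and u0: "u0 \<in> borel_measurable lborel"
  shows "weak_euler u u0"
proof -
  have *: "weak_identity (\<lambda>z. L (u z, (u z)\<^sup>2 / 2)) (\<lambda>x. L (u0 x, (u0 x)\<^sup>2 / 2))"
    if L: "linear L" and d: "\<And>n. weakly_div_free (\<lambda>z. L (Z n z))" for L
  proof (rule weak_identity_limit[where F = "\<lambda>n z. L (Z n z)"])
    have bl: "bounded_linear L" using L by (simp add: linear_conv_bounded_linear)
    have cL: "continuous_on UNIV L" using bl by (rule linear_continuous_on)
    have Lm: "L \<in> borel_measurable borel" using cL by (rule borel_measurable_continuous_onI)
    show "norm (L (Z n z)) \<le> onorm L * B" for n z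
      using onorm[OF bl, of "Z n z"] mult_left_mono[OF B onorm_pos_le[OF bl], of n z] by linarith
    show "AE z in lborel. (\<lambda>n. L (Z n (z + (s, 0)))) \<longlonglongrightarrow> L (u z, (u z)\<^sup>2 / 2)"
      using lim by (rule eventually_mono) (rule bounded_linear.tendsto[OF bl])
    show "AE x in lborel. (\<lambda>n. L (Z n (s, x))) \<longlonglongrightarrow> L (u0 x, (u0 x)\<^sup>2 / 2)"
      using lim0 by (rule eventually_mono) (rule bounded_linear.tendsto[OF bl])
    have "(\<lambda>z. (u z, (u z)\<^sup>2 / 2)) \<in> borel_measurable lborel"
      using u by (intro borel_measurable_Pair borel_measurable_divide borel_measurable_power) auto
    then show "(\<lambda>z. L (u z, (u z)\<^sup>2 / 2)) \<in> borel_measurable lborel"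
      by (rule measurable_compose[OF _ Lm])
    have "(\<lambda>z. (u0 z, (u0 z)\<^sup>2 / 2)) \<in> borel_measurable lborel"
      using u0 by (intro borel_measurable_Pair borel_measurable_divide borel_measurable_power) auto
    then show "(\<lambda>z. L (u0 z, (u0 z)\<^sup>2 / 2)) \<in> borel_measurable lborel"
      by (rule measurable_compose[OF _ Lm])
  qed (rule d)
  show ?thesis unfolding weak_euler_def
    using *[OF linear_fields(1)] *[OF linear_fields(2)] *[OF linear_fields(3)] Z unfolding div_free_state_def by blast
qed

lemma subsolution_zero: "e > 0 \<Longrightarrow> subsolution e D (\<lambda>z. 0)"
  unfolding subsolution_def by (auto simp: gen_energy_def div_free_state_0)

lemma subsolution_scale:
  assumes "subsolution e D Z" "0 < s" "s \<le> 1"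
  shows "subsolution e D (\<lambda>z. s *\<^sub>R Z z)"
  unfolding subsolution_def
proof (intro conjI allI impI)
  show "continuous_on UNIV (\<lambda>z. s *\<^sub>R Z z)" using assms(1) unfolding subsolution_def by (intro continuous_intros) auto
  show "s *\<^sub>R Z z = 0" if "z \<notin> D" for z
    using assms(1) that unfolding subsolution_def by (simp del: split_paired_All)
  show "div_free_state (\<lambda>z. s *\<^sub>R Z z)"
    using div_free_state_lincomb[OF div_free_state_0, of Z s] assms(1) unfolding subsolution_def by simp
  fix z
  have H: "gen_energy (Z z) < e" using assms(1) unfolding subsolution_def by blast
  have "0 \<le> gen_energy (Z z)" unfolding gen_energy_def by simp
  have "gen_energy (s *\<^sub>R Z z) \<le> s * gen_energy (Z z)" by (rule gen_energy_scale) (use assms in auto)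
  also have "\<dots> \<le> 1 * gen_energy (Z z)" using assms \<open>0 \<le> gen_energy (Z z)\<close> by (intro mult_right_mono) auto
  finally show "gen_energy (s *\<^sub>R Z z) < e" using H by linarith
qed

lemma open_cylinder: "open Q \<Longrightarrow> open ({a<..<b::real} \<times> (Q :: (real^2) set))"
  by (intro open_Times) auto

lemma bounded_cylinder: "bounded Q \<Longrightarrow> bounded ({a<..<b::real} \<times> (Q :: (real^2) set))"
  by (intro bounded_Times) auto

text \<open>
  A solution on a cylinder has full energy on almost every time slice, and it is the limit of
  divergence-free states that vanish near the ends of the time interval.  So it can be started at
  a generic slice and continued after the end of the interval by any other such solution.
\<close>

lemma wild_slice:
  fixes Q :: "(real^2) set"
  assumes Q: "open Q" "bounded Q" and e: "e > 0" and T: "T > 0"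
  obtains t0 Z u where "0 < t0" "t0 < T" "\<And>n. subsolution e ({0<..<T} \<times> Q) (Z n)" "u \<in> borel_measurable lborel"
    "\<And>z. z \<notin> {0<..<T} \<times> Q \<Longrightarrow> u z = 0"
    "AE z in lborel. (\<lambda>n. Z n z) \<longlonglongrightarrow> (u z, (u z)\<^sup>2 / 2)"
    "AE z in lborel. z \<in> {0<..<T} \<times> Q \<longrightarrow> (norm (u z))\<^sup>2 = 2 * e"
    "AE x in lborel. (\<lambda>n. Z n (t0, x)) \<longlonglongrightarrow> (u (t0, x), (u (t0, x))\<^sup>2 / 2)"
    "AE x in lborel. x \<in> Q \<longrightarrow> (norm (u (t0, x)))\<^sup>2 = 2 * e"
    "(\<lambda>x. u (t0, x)) \<in> borel_measurable lborel"
proof -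
  obtain Z u where Z: "\<And>n. subsolution e ({0<..<T} \<times> Q) (Z n)" and u: "u \<in> borel_measurable lborel"
    "\<And>z. z \<notin> {0<..<T} \<times> Q \<Longrightarrow> u z = 0"
    and l: "AE z in lborel. (\<lambda>n. Z n z) \<longlonglongrightarrow> (u z, (u z)\<^sup>2 / 2)"
    and f: "AE z in lborel. z \<in> {0<..<T} \<times> Q \<longrightarrow> (norm (u z))\<^sup>2 = 2 * e"
    by (rule convex_integration[OF open_cylinder[OF Q(1)] bounded_cylinder[OF Q(2)] subsolution_zero[OF e] zero_less_one]) blast
  have "AE z in lborel \<Otimes>\<^sub>M lborel. (\<lambda>n. Z n z) \<longlonglongrightarrow> (u z, (u z)\<^sup>2 / 2) \<and> (z \<in> {0<..<T} \<times> Q \<longrightarrow> (norm (u z))\<^sup>2 = 2 * e)"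
    using l f unfolding lborel_prod by eventually_elim blast
  note pair = lborel_pair.AE_pair[OF this]
  define P where "P = (\<lambda>t. AE x in lborel. (\<lambda>n. Z n (t, x)) \<longlonglongrightarrow> (u (t, x), (u (t, x))\<^sup>2 / 2) \<and>
    ((t, x) \<in> {0<..<T} \<times> Q \<longrightarrow> (norm (u (t, x)))\<^sup>2 = 2 * e))"
  have "AE t in lborel. P t" using pair unfolding P_def .
  then obtain N where "N \<in> null_sets lborel" "{t \<in> space lborel. \<not> P t} \<subseteq> N"
    unfolding eventually_ae_filter by blast
  then have N: "N \<in> null_sets lborel" "\<And>t. t \<notin> N \<Longrightarrow> P t" by auto
  \<comment> \<open>The exceptional times form a null set, which cannot contain an interval; any
    other time in it is a valid start.\<close>
  have "\<not> {0<..<T} \<subseteq> N"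
  proof
    assume "{0<..<T} \<subseteq> N"
    then have "{0<..<T} \<in> null_sets lborel" by (intro null_sets_subset[OF N(1)]) auto
    then show False using T by auto
  qed
  then obtain t0 where t0: "t0 \<in> {0<..<T}" "t0 \<notin> N" by blast
  have s: "AE x in lborel. (\<lambda>n. Z n (t0, x)) \<longlonglongrightarrow> (u (t0, x), (u (t0, x))\<^sup>2 / 2)"
    "AE x in lborel. x \<in> Q \<longrightarrow> (norm (u (t0, x)))\<^sup>2 = 2 * e"
    using N(2)[OF t0(2)] t0(1) unfolding P_def by (auto elim!: eventually_mono)
  have "u \<in> borel_measurable (lborel \<Otimes>\<^sub>M lborel)" using u(1) unfolding lborel_prod .
  then have "(\<lambda>x. u (t0, x)) \<in> borel_measurable lborel" by (rule measurable_compose_Pair1[rotated]) simp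
  then show ?thesis using t0(1) by (intro that[OF _ _ Z u l f s]) auto
qed

text \<open>
  Starting from the multiples \<open>4\<^sup>-\<^sup>j Y\<close> of one nonzero subsolution makes the limits distinct: their inner
  products with the velocity of \<open>Y\<close> remain close to those of the starting points.
\<close>

lemma tail_family:
  fixes Q :: "(real^2) set"
  assumes Q: "open Q" "bounded Q" and e: "e > 0" and ab: "a < b"
  obtains Z u where "\<And>j n. subsolution e ({a<..<b} \<times> Q) (Z j n)" "\<And>j::nat. u j \<in> borel_measurable lborel"
    "\<And>j z. z \<notin> {a<..<b} \<times> Q \<Longrightarrow> u j z = 0"
    "\<And>j. AE z in lborel. (\<lambda>n. Z j n z) \<longlonglongrightarrow> (u j z, (u j z)\<^sup>2 / 2)"
    "\<And>j. AE z in lborel. z \<in> {a<..<b} \<times> Q \<longrightarrow> (norm (u j z))\<^sup>2 = 2 * e"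
    "\<And>i j. Q \<noteq> {} \<Longrightarrow> i \<noteq> j \<Longrightarrow> \<not> (AE z in lborel. u i z = u j z)"
proof -
  define D where "D = {a<..<b} \<times> Q"
  have D: "open D" "bounded D" unfolding D_def using Q by (auto intro: open_cylinder bounded_cylinder)
  \<comment> \<open>One step from the zero subsolution, whose deficit is positive if Q is nonempty,
    yields a starting point with nonzero velocity in that case.\<close>
  obtain Y where Y: "subsolution e D Y"
    "deficit e D (\<lambda>z. 0) / (2 ^ 23 * e) \<le> (LINT z|lborel. (norm (fst (Y z) - fst (0::complex\<times>complex)))\<^sup>2)"
    using subsolution_step[OF D subsolution_zero[OF e], of "{}" 1] by auto
  define g where "g = (\<lambda>z. fst (Y z))"
  define N where "N = (LINT z|lborel. (norm (g z))\<^sup>2)"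
  have N0: "N > 0" if "Q \<noteq> {}"
  proof -
    have "deficit e D (\<lambda>z. 0) = (LINT z|lborel. indicator D z * e\<^sup>2)" by (simp add: deficit_def)
    also have "\<dots> = measure lborel D * e\<^sup>2" by simp
    also have "\<dots> > 0"
    proof -
      have "D \<noteq> {}" using that ab dense by (auto simp: D_def)
      then have "\<not> negligible D" by (rule open_not_negligible[OF D(1)])
      then have "D \<notin> null_sets lborel" unfolding negligible_iff_null_sets using null_sets_completionI by blast
      then have "emeasure lborel D \<noteq> 0" using D(1) by (simp add: null_sets_def)
      then have "measure lborel D > 0"
        using emeasure_bounded_finite[OF D(2)] by (simp add: measure_def enn2real_positive_iff less_top zero_less_iff_neq_zero)
      then show ?thesis using e by simp
    qed
    finally have "deficit e D (\<lambda>z. 0) / (2 ^ 23 * e) > 0" using e by simp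
    then show ?thesis using Y(2) by (simp add: N_def g_def)
  qed
  \<comment> \<open>With s = (1/4)^j, division by s shows that the inner product with the velocity
    of Y lies within s N / 4 of s N. For empty Q the value 1 merely keeps the tolerance
    positive.\<close>
  define \<epsilon> where "\<epsilon> = (\<lambda>j::nat. (1/4) ^ j * ((1/4) ^ j * (if Q = {} then 1 else N / 4)))"
  have \<epsilon>: "\<epsilon> j > 0" for j using N0 by (auto simp: \<epsilon>_def)
  have s: "0 < (1/4::real) ^ j" "(1/4::real) ^ j \<le> 1" for j by (auto intro: power_le_one)
  define R where "R = (\<lambda>j Z u. (\<forall>n. subsolution e D (Z n)) \<and> u \<in> borel_measurable lborel \<and> (\<forall>z. z \<notin> D \<longrightarrow> u z = 0) \<and>
    (AE z in lborel. (\<lambda>n. Z n z) \<longlonglongrightarrow> (u z, (u z)\<^sup>2 / 2)) \<and>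
    (AE z in lborel. z \<in> D \<longrightarrow> (norm (u z))\<^sup>2 = 2 * e) \<and>
    \<bar>LINT z|lborel. (u z - fst ((1/4) ^ j *\<^sub>R Y z)) \<bullet> fst ((1/4) ^ j *\<^sub>R Y z)\<bar> \<le> \<epsilon> j)"
  have "\<exists>Z u. R j Z u" for j
    unfolding R_def by (rule convex_integration[OF D subsolution_scale[OF Y(1) s[of j]] \<epsilon>[of j]]) blast
  then obtain Z u where "\<And>j. R j (Z j) (u j)" by metis
  then have Zu: "\<And>j n. subsolution e D (Z j n)" "\<And>j. u j \<in> borel_measurable lborel"
    "\<And>j z. z \<notin> D \<Longrightarrow> u j z = 0" "\<And>j. AE z in lborel. (\<lambda>n. Z j n z) \<longlonglongrightarrow> (u j z, (u j z)\<^sup>2 / 2)"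
    "\<And>j. AE z in lborel. z \<in> D \<longrightarrow> (norm (u j z))\<^sup>2 = 2 * e"
    "\<And>j. \<bar>LINT z|lborel. (u j z - fst ((1/4) ^ j *\<^sub>R Y z)) \<bullet> fst ((1/4) ^ j *\<^sub>R Y z)\<bar> \<le> \<epsilon> j"
    unfolding R_def by blast+
  define x where "x = (\<lambda>j. LINT z|lborel. u j z \<bullet> g z)"
  have cg: "continuous_on UNIV g" and og: "z \<notin> D \<Longrightarrow> g z = 0" and g2: "(norm (g z))\<^sup>2 < 2 * e" for z
    unfolding g_def using subsolution_D[OF Y(1)] by auto
  have gm: "g \<in> borel_measurable lborel" using borel_measurable_continuous_onI[OF cg] by simp
  have ig: "integrable lborel (\<lambda>z. (norm (g z))\<^sup>2)"
    by (rule integrable_continuous_bounded_support[OF _ D(2)]) (auto intro!: continuous_intros cg simp: og)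
  have ix: "integrable lborel (\<lambda>z. u j z \<bullet> g z)" for j
  proof (rule Bochner_Integration.integrable_bound)
    show "integrable lborel (\<lambda>z. indicator D z * (2 * e))"
      using emeasure_bounded_finite[OF D(2)] D(1) by (intro integrable_mult_left integrable_real_indicator) auto
    show "(\<lambda>z. u j z \<bullet> g z) \<in> borel_measurable lborel" using Zu(2)[of j] gm by measurable
    show "AE z in lborel. norm (u j z \<bullet> g z) \<le> norm (indicator D z * (2 * e))"
      using Zu(5)[of j]
    proof (rule eventually_mono)
      fix z assume h: "z \<in> D \<longrightarrow> (norm (u j z))\<^sup>2 = 2 * e"
      show "norm (u j z \<bullet> g z) \<le> norm (indicator D z * (2 * e))"
      proof (cases "z \<in> D")
        case True
        have "norm (u j z) \<le> sqrt (2 * e)" using h True by (intro real_le_rsqrt) simp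
        moreover have "norm (g z) \<le> sqrt (2 * e)" using g2[of z] by (intro real_le_rsqrt) simp
        ultimately have "norm (u j z) * norm (g z) \<le> sqrt (2 * e) * sqrt (2 * e)" using e by (intro mult_mono) auto
        then show ?thesis using True e Cauchy_Schwarz_ineq2[of "u j z" "g z"] by simp
      qed (simp add: og)
    qed
  qed
  have xN: "\<bar>x j - (1/4) ^ j * N\<bar> \<le> (1/4) ^ j * (N / 4)" if "Q \<noteq> {}" for j
  proof -
    define s where "s = (1/4::real) ^ j"
    have s0: "s > 0" by (simp add: s_def)
    have "(LINT z|lborel. (u j z - fst (s *\<^sub>R Y z)) \<bullet> fst (s *\<^sub>R Y z)) = (LINT z|lborel. s * (u j z \<bullet> g z) - s * (s * (norm (g z))\<^sup>2))"
      by (intro Bochner_Integration.integral_cong) (auto simp: g_def inner_diff_left power2_norm_eq_inner algebra_simps)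
    also have "\<dots> = s * (x j - s * N)" using ix[of j] ig by (simp add: x_def N_def right_diff_distrib)
    finally have "\<bar>s * (x j - s * N)\<bar> \<le> s * (s * (N / 4))" using Zu(6)[of j] that by (simp add: \<epsilon>_def s_def)
    then show ?thesis using s0 by (simp add: abs_mult s_def)
  qed
  \<comment> \<open>With M = (1/4)^j N the estimates give x j \<ge> 3 M / 4 and x (Suc j) \<le> 5 M
    / 16.\<close>
  have xdec: "x (Suc j) < x j" if "Q \<noteq> {}" for j
  proof -
    define M where "M = (1/4) ^ j * N"
    have "M > 0" using N0[OF that] by (simp add: M_def)
    moreover have "\<bar>x j - M\<bar> \<le> M / 4" using xN[OF that, of j] by (simp add: M_def)
    moreover have "\<bar>x (Suc j) - M / 4\<bar> \<le> M / 16" using xN[OF that, of "Suc j"] by (simp add: M_def)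
    ultimately show ?thesis by linarith
  qed
  show ?thesis
  proof (rule that[of Z u, folded D_def])
    show "\<not> (AE z in lborel. u i z = u j z)" if "Q \<noteq> {}" "i \<noteq> j" for i j
    proof
      assume a: "AE z in lborel. u i z = u j z"
      have "x i = x j"
        unfolding x_def
      proof (rule integral_cong_AE)
        show "AE z in lborel. u i z \<bullet> g z = u j z \<bullet> g z" using a by (rule eventually_mono) simp
      qed (use ix borel_measurable_integrable in blast)+
      have "strict_mono (\<lambda>j. - x j)" using xdec[OF that(1)] by (simp add: strict_mono_Suc_iff)
      from strict_mono_eq[OF this, of i j] show False using \<open>x i = x j\<close> that(2) by simp
    qed
  qed (use Zu in auto)
qed

text \<open>All members follow one solution from the generic time t0 up to T and differ only in the
  continuation on (T, T + t0). The shift by t0 moves these intervals onto [0, T) up to one slice, so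
  the datum, the slice of that solution at t0, is shared.\<close>

lemma wild_euler_family:
  fixes Q :: "(real^2) set"
  assumes Q: "open Q" "bounded Q" and e: "e > 0" and T: "T > 0"
  obtains u0 and v :: "nat \<Rightarrow> stpoint \<Rightarrow> complex"
  where "u0 \<in> borel_measurable lborel" "\<And>x. x \<notin> Q \<Longrightarrow> u0 x = 0" "AE x in lborel. x \<in> Q \<longrightarrow> (norm (u0 x))\<^sup>2 = 2 * e"
    "\<And>j. v j \<in> borel_measurable lborel" "\<And>j z. snd z \<notin> Q \<or> T \<le> fst z \<Longrightarrow> v j z = 0"
    "\<And>j. AE z in lborel. 0 \<le> fst z \<and> fst z < T \<and> snd z \<in> Q \<longrightarrow> (norm (v j z))\<^sup>2 = 2 * e"
    "\<And>j. weak_euler (v j) u0"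
    "\<And>i j. Q \<noteq> {} \<Longrightarrow> i \<noteq> j \<Longrightarrow> \<not> (AE z in lborel. z \<in> {0..<T} \<times> Q \<longrightarrow> v i z = v j z)"
proof -
  obtain t0 Z u where t0: "0 < t0" "t0 < T" and Z: "\<And>n. subsolution e ({0<..<T} \<times> Q) (Z n)"
    and u: "u \<in> borel_measurable lborel" "\<And>z. z \<notin> {0<..<T} \<times> Q \<Longrightarrow> u z = 0"
    "AE z in lborel. (\<lambda>n. Z n z) \<longlonglongrightarrow> (u z, (u z)\<^sup>2 / 2)"
    "AE z in lborel. z \<in> {0<..<T} \<times> Q \<longrightarrow> (norm (u z))\<^sup>2 = 2 * e"
    and s: "AE x in lborel. (\<lambda>n. Z n (t0, x)) \<longlonglongrightarrow> (u (t0, x), (u (t0, x))\<^sup>2 / 2)"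
    "AE x in lborel. x \<in> Q \<longrightarrow> (norm (u (t0, x)))\<^sup>2 = 2 * e"
    "(\<lambda>x. u (t0, x)) \<in> borel_measurable lborel"
    by (rule wild_slice[OF Q e T]) blast
  have "T < T + t0" using t0 by simp
  then obtain Y w where Y: "\<And>j n. subsolution e ({T<..<T + t0} \<times> Q) (Y j n)" and w: "\<And>j::nat. w j \<in> borel_measurable lborel"
    "\<And>j z. z \<notin> {T<..<T + t0} \<times> Q \<Longrightarrow> w j z = 0"
    "\<And>j. AE z in lborel. (\<lambda>n. Y j n z) \<longlonglongrightarrow> (w j z, (w j z)\<^sup>2 / 2)"
    "\<And>j. AE z in lborel. z \<in> {T<..<T + t0} \<times> Q \<longrightarrow> (norm (w j z))\<^sup>2 = 2 * e"
    "\<And>i j. Q \<noteq> {} \<Longrightarrow> i \<noteq> j \<Longrightarrow> \<not> (AE z in lborel. w i z = w j z)"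
    by (rule tail_family[OF Q e]) blast
  define v where "v = (\<lambda>j z. u (z + (t0, 0)) + w j (z + (t0, 0)))"
  have sm: "(\<lambda>z::stpoint. z + (t0, 0)) \<in> measurable lborel lborel"
    unfolding measurable_lborel1 measurable_lborel2 by (intro borel_measurable_continuous_onI continuous_intros)
  show ?thesis
  proof (rule that[of "\<lambda>x. u (t0, x)" v])
    show "(\<lambda>x. u (t0, x)) \<in> borel_measurable lborel" by (rule s(3))
    show "u (t0, x) = 0" if "x \<notin> Q" for x using u(2)[of "(t0, x)"] that by simp
    show "AE x in lborel. x \<in> Q \<longrightarrow> (norm (u (t0, x)))\<^sup>2 = 2 * e" by (rule s(2))
    show vm: "v j \<in> borel_measurable lborel" for j
      unfolding v_def by (intro borel_measurable_add measurable_compose[OF sm] u(1) w(1))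
    show "v j z = 0" if "snd z \<notin> Q \<or> T \<le> fst z" for j z
      using u(2)[of "z + (t0, 0)"] w(2)[of "z + (t0, 0)" j] that t0 by (auto simp: v_def mem_Times_iff)
    \<comment> \<open>The joint at time T - t0 belongs to neither shifted cylinder; it is a null
      slice.\<close>
    show "AE z in lborel. 0 \<le> fst z \<and> fst z < T \<and> snd z \<in> Q \<longrightarrow> (norm (v j z))\<^sup>2 = 2 * e" for j
      using AE_lborel_shift[OF u(4), of "(t0, 0)"] AE_lborel_shift[OF w(4)[of j], of "(t0, 0)"] AE_fst_neq[of "T - t0"]
    proof eventually_elim
      case (elim z)
      show ?case
      proof
        assume z: "0 \<le> fst z \<and> fst z < T \<and> snd z \<in> Q"
        show "(norm (v j z))\<^sup>2 = 2 * e"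
        proof (cases "fst z < T - t0")
          case True
          then have "z + (t0, 0) \<in> {0<..<T} \<times> Q" "z + (t0, 0) \<notin> {T<..<T + t0} \<times> Q"
            using z t0 by (auto simp: mem_Times_iff)
          then show ?thesis using elim(1) w(2) by (simp add: v_def)
        next
          case False
          then have "z + (t0, 0) \<notin> {0<..<T} \<times> Q" "z + (t0, 0) \<in> {T<..<T + t0} \<times> Q"
            using z t0 elim(3) by (auto simp: mem_Times_iff)
          then show ?thesis using elim(2) u(2) by (simp add: v_def)
        qed
      qed
    qed
    show "weak_euler (v j) (\<lambda>x. u (t0, x))" for j
    proof (rule weak_euler_limit[where Z = "\<lambda>n z. Z n z + 1 *\<^sub>R Y j n z" and s = t0])
      show "div_free_state (\<lambda>z. Z n z + 1 *\<^sub>R Y j n z)" for n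
        using Z[of n] Y[of j n] unfolding subsolution_def by (intro div_free_state_lincomb) auto
      show "norm (Z n z + 1 *\<^sub>R Y j n z) \<le> (sqrt (2 * e) + e) + (sqrt (2 * e) + e)" for n z
        using norm_triangle_ineq[of "Z n z" "Y j n z"] subsolution_norm_le[OF Z[of n], of z] subsolution_norm_le[OF Y[of j n], of z] by simp
      show "AE z in lborel. (\<lambda>n. Z n (z + (t0, 0)) + 1 *\<^sub>R Y j n (z + (t0, 0))) \<longlonglongrightarrow> (v j z, (v j z)\<^sup>2 / 2)"
        using AE_lborel_shift[OF u(3), of "(t0, 0)"] AE_lborel_shift[OF w(3)[of j], of "(t0, 0)"]
      proof eventually_elim
        case (elim z)
        \<comment> \<open>The two cylinders are disjoint, so the square of the sum is the sum of the
          squares and the quadratic relation survives the gluing.\<close>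
        have "u (z + (t0, 0)) = 0 \<or> w j (z + (t0, 0)) = 0"
          using u(2)[of "z + (t0, 0)"] w(2)[of "z + (t0, 0)" j] by (force simp: mem_Times_iff)
        then have E: "(v j z, (v j z)\<^sup>2 / 2) = (u (z + (t0, 0)), (u (z + (t0, 0)))\<^sup>2 / 2) + (w j (z + (t0, 0)), (w j (z + (t0, 0)))\<^sup>2 / 2)"
          by (auto simp: v_def)
        show ?case unfolding scaleR_one E by (rule tendsto_add[OF elim])
      qed
      show "AE x in lborel. (\<lambda>n. Z n (t0, x) + 1 *\<^sub>R Y j n (t0, x)) \<longlonglongrightarrow> (u (t0, x), (u (t0, x))\<^sup>2 / 2)"
      proof -
        \<comment> \<open>The tail stages vanish at time t0 < T, so the initial slice does not
          depend on j.\<close>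
        have "Y j n (t0, x) = 0" for n x
        proof -
          have "(t0, x) \<notin> {T<..<T + t0} \<times> Q" using t0 by auto
          then show ?thesis using Y[of j n] unfolding subsolution_def by blast
        qed
        then show ?thesis using s(1) by simp
      qed
    qed (rule vm s(3))+
    show "\<not> (AE z in lborel. z \<in> {0..<T} \<times> Q \<longrightarrow> v i z = v j z)" if "Q \<noteq> {}" "i \<noteq> j" for i j
    proof
      assume a: "AE z in lborel. z \<in> {0..<T} \<times> Q \<longrightarrow> v i z = v j z"
      have "AE z in lborel. w i z = w j z"
        using AE_lborel_shift[OF a, of "(- t0, 0)"]
      proof (rule eventually_mono)
        fix z assume h: "z + (- t0, 0) \<in> {0..<T} \<times> Q \<longrightarrow> v i (z + (- t0, 0)) = v j (z + (- t0, 0))"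
        show "w i z = w j z"
        proof (cases "z \<in> {T<..<T + t0} \<times> Q")
          case True
          then have m: "z + (- t0, 0) \<in> {0..<T} \<times> Q" using t0 by (auto simp: mem_Times_iff)
          have E: "z + (- t0, 0) + (t0, 0) = z" by (simp add: prod_eq_iff)
          have "u z + w i z = u z + w j z" using h m unfolding v_def E by blast
          then show ?thesis by simp
        qed (simp add: w(2))
      qed
      then show False using w(5) that by blast
    qed
  qed
qed


subsection \<open>The divergence of tangential fields on arbitrary domains\<close>

lemma bounded_of_support:
  fixes g :: "'a::euclidean_space \<Rightarrow> 'b::real_normed_vector"
  assumes "continuous_on UNIV g" "\<And>x. norm x > R \<Longrightarrow> g x = 0"
  obtains C where "C \<ge> 0" "\<And>x. norm (g x) \<le> C"
proof -
  have "bounded (g ` cball 0 R)"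
    by (intro compact_imp_bounded compact_continuous_image continuous_on_subset[OF assms(1)] compact_cball) auto
  then obtain C where C: "\<forall>y\<in>g ` cball 0 R. norm y \<le> C" unfolding bounded_iff by blast
  have "norm (g x) \<le> \<bar>C\<bar>" for x
  proof (cases "norm x > R")
    case True
    then show ?thesis using assms(2) by simp
  next
    case False
    then have "norm (g x) \<le> C" using C by simp
    then show ?thesis by simp
  qed
  then show ?thesis using that[of "\<bar>C\<bar>"] by simp
qed

text \<open>The ball around x whose radius is the distance to the complement lies in \<Omega> and
  touches the frontier at y. So nearest points always carry a normal in the sense of
  \<open>outward_unit_normal\<close>, whatever the regularity of the boundary.\<close>

lemma nearest_point_normal:
  fixes \<Omega> :: "(real^2) set"
  assumes \<Omega>: "open \<Omega>" and x: "x \<in> \<Omega>" and y: "y \<notin> \<Omega>" "dist x y = infdist x (- \<Omega>)"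
  shows "outward_unit_normal \<Omega> y ((1 / dist x y) *\<^sub>R (y - x))"
proof -
  define d where "d = dist x y"
  have d: "d > 0" using x y(1) by (auto simp: d_def)
  have sub: "ball x d \<subseteq> \<Omega>"
  proof
    fix w assume w: "w \<in> ball x d"
    show "w \<in> \<Omega>"
    proof (rule ccontr)
      assume "w \<notin> \<Omega>"
      then have "infdist x (- \<Omega>) \<le> dist x w" by (intro infdist_le) simp
      then show False using w y(2) by (simp add: d_def)
    qed
  qed
  have "y \<in> closure (ball x d)" using d by (simp add: closure_ball d_def)
  then have "y \<in> closure \<Omega>" using closure_mono[OF sub] by blast
  then have "y \<in> frontier \<Omega>" using y(1) \<Omega> by (simp add: frontier_def interior_open)
  moreover have "norm ((1 / d) *\<^sub>R (y - x)) = 1" using d by (simp add: d_def dist_norm norm_minus_commute)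
  moreover have "y - d *\<^sub>R ((1 / d) *\<^sub>R (y - x)) = x" using d by simp
  ultimately show ?thesis using sub d unfolding outward_unit_normal_def d_def[symmetric] by (intro conjI exI[of _ d]) simp_all
qed

lemma det_id_plus:
  fixes f :: "real^2 \<Rightarrow> real^2"
  shows "det (matrix (\<lambda>v. v + h *\<^sub>R f v)) = 1 + h * (f (axis 1 1) $ 1 + f (axis 2 1) $ 2)
     + h\<^sup>2 * (f (axis 1 1) $ 1 * f (axis 2 1) $ 2 - f (axis 2 1) $ 1 * f (axis 1 1) $ 2)"
  by (simp add: det_2 matrix_def axis_def power2_eq_square algebra_simps)

text \<open>
  The truncated squared distance to the complement is nearly invariant under the map
  \<open>x \<mapsto> x + h \<Phi> x\<close>, because \<open>\<Phi>\<close> is almost orthogonal to the gradient of the distance near the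
  boundary.  The change of variables formula turns this into a bound on the integral of the
  divergence.
\<close>

lemma integral_divergence_nonneg:
  fixes \<Omega> :: "(real^2) set" and \<Phi> :: "real^2 \<Rightarrow> real^2"
  assumes \<Omega>: "open \<Omega>" "bounded \<Omega>"
    and der: "\<And>x. (\<Phi> has_derivative \<Phi>' x) (at x)"
    and cont: "\<And>v. continuous_on UNIV (\<lambda>x. \<Phi>' x v)"
    and supp: "\<And>x. norm x > R \<Longrightarrow> \<Phi> x = 0" "\<And>x v. norm x > R \<Longrightarrow> \<Phi>' x v = 0"
    and tang: "\<And>x \<nu>. outward_unit_normal \<Omega> x \<nu> \<Longrightarrow> \<Phi> x \<bullet> \<nu> = 0"
  shows "0 \<le> (LINT x|lborel. indicator \<Omega> x * (\<Phi>' x (axis 1 1) $ 1 + \<Phi>' x (axis 2 1) $ 2))"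
proof -
  define D where "D = (\<lambda>x. \<Phi>' x (axis 1 1) $ 1 + \<Phi>' x (axis 2 1) $ 2)"
  define J where "J = (\<lambda>x. \<Phi>' x (axis 1 1) $ 1 * \<Phi>' x (axis 2 1) $ 2 - \<Phi>' x (axis 2 1) $ 1 * \<Phi>' x (axis 1 1) $ 2)"
  have c\<Phi>: "continuous_on UNIV \<Phi>"
    using der by (intro continuous_at_imp_continuous_on ballI) (rule has_derivative_continuous)
  have cD: "continuous_on UNIV D" and cJ: "continuous_on UNIV J"
    unfolding D_def J_def by (intro continuous_intros cont)+
  have sD: "norm x > R \<Longrightarrow> D x = 0" and sJ: "norm x > R \<Longrightarrow> J x = 0" for x
    by (simp_all add: D_def J_def supp)
  obtain CD where CD: "CD \<ge> 0" "\<And>x. norm (D x) \<le> CD" by (rule bounded_of_support[OF cD sD]) (assumption, rule that)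
  obtain CJ where CJ: "CJ \<ge> 0" "\<And>x. norm (J x) \<le> CJ" by (rule bounded_of_support[OF cJ sJ]) (assumption, rule that)
  obtain M where M: "M \<ge> 0" "\<And>x. norm (\<Phi> x) \<le> M" by (rule bounded_of_support[OF c\<Phi> supp(1)]) (assumption, rule that)
  obtain C1 where C1: "C1 \<ge> 0" "\<And>x. norm (\<Phi>' x (axis 1 1)) \<le> C1" by (rule bounded_of_support[OF cont supp(2)]) (assumption, rule that)
  obtain C2 where C2: "C2 \<ge> 0" "\<And>x. norm (\<Phi>' x (axis 2 1)) \<le> C2" by (rule bounded_of_support[OF cont supp(2)]) (assumption, rule that)
  define L where "L = C1 + C2"
  have L0: "L \<ge> 0" using C1 C2 by (simp add: L_def)
  have lip: "norm (\<Phi> x - \<Phi> y) \<le> L * norm (x - y)" for x y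
  proof (rule differentiable_bound[of UNIV])
    show "onorm (\<Phi>' x) \<le> L" for x
    proof (rule onorm_le)
      fix v :: "real^2"
      have lin: "linear (\<Phi>' x)" using der by (rule has_derivative_linear)
      have "v = v $ 1 *\<^sub>R axis 1 1 + v $ 2 *\<^sub>R axis 2 1" by (simp add: vec_eq_iff forall_2 axis_def)
      then have "\<Phi>' x v = v $ 1 *\<^sub>R \<Phi>' x (axis 1 1) + v $ 2 *\<^sub>R \<Phi>' x (axis 2 1)"
        using linear_add[OF lin, of "v $ 1 *\<^sub>R axis 1 1" "v $ 2 *\<^sub>R axis 2 1"] linear_scale[OF lin] by metis
      then have "norm (\<Phi>' x v) \<le> \<bar>v $ 1\<bar> * norm (\<Phi>' x (axis 1 1)) + \<bar>v $ 2\<bar> * norm (\<Phi>' x (axis 2 1))"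
        using norm_triangle_ineq[of "v $ 1 *\<^sub>R \<Phi>' x (axis 1 1)" "v $ 2 *\<^sub>R \<Phi>' x (axis 2 1)"] by simp
      also have "\<dots> \<le> norm v * C1 + norm v * C2"
        using C1 C2 component_le_norm_cart[of v] by (intro add_mono mult_mono) auto
      finally show "norm (\<Phi>' x v) \<le> L * norm v" by (simp add: L_def algebra_simps)
    qed
    show "(\<Phi> has_derivative \<Phi>' x) (at x within UNIV)" for x using der by simp
  qed auto
  define F where "F = - \<Omega>"
  have "\<Omega> \<noteq> UNIV" using \<Omega>(2) not_bounded_UNIV by metis
  then have F: "closed F" "F \<noteq> {}" using \<Omega>(1) unfolding F_def by (simp add: closed_Compl, blast)
  define d where "d = (\<lambda>x. infdist x F)"
  have d0: "d x \<ge> 0" for x by (simp add: d_def infdist_nonneg)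
  have dF: "d x = 0 \<longleftrightarrow> x \<notin> \<Omega>" for x
    using in_closed_iff_infdist_zero[OF F, of x] by (auto simp: d_def F_def)
  have cd: "continuous_on UNIV d" unfolding d_def by (intro continuous_intros)
  \<comment> \<open>At the nearest complement point y the field is orthogonal to x - y, so the
    first-order change only sees \<Phi> x - \<Phi> y, which is at most L times d x in norm. This
    makes the first-order term quadratic in d x.\<close>
  have near: "(d (x + h *\<^sub>R \<Phi> x))\<^sup>2 \<le> (d x)\<^sup>2 + 2 * h * L * (d x)\<^sup>2 + h\<^sup>2 * M\<^sup>2" if h: "h \<ge> 0" for x h
  proof -
    obtain y where y: "y \<in> F" "dist x y = d x"
      using infdist_attains_inf[OF F, of x] unfolding d_def by metis
    have orth: "\<Phi> y \<bullet> (x - y) = 0"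
    proof (cases "x \<in> \<Omega>")
      case True
      have "\<Phi> y \<bullet> ((1 / dist x y) *\<^sub>R (y - x)) = 0"
      proof (rule tang, rule nearest_point_normal[OF \<Omega>(1) True])
        show "y \<notin> \<Omega>" "dist x y = infdist x (- \<Omega>)" using y unfolding d_def F_def by auto
      qed
      moreover have "dist x y \<noteq> 0" using True y(1) by (auto simp: F_def)
      ultimately have "\<Phi> y \<bullet> (y - x) = 0" by simp
      then show ?thesis by (simp add: inner_diff_right)
    next
      case False
      then have "dist x y = 0" using dF[of x] y(2) by simp
      then show ?thesis by simp
    qed
    have "d (x + h *\<^sub>R \<Phi> x) \<le> dist (x + h *\<^sub>R \<Phi> x) y" unfolding d_def by (rule infdist_le[OF y(1)])
    then have "(d (x + h *\<^sub>R \<Phi> x))\<^sup>2 \<le> (norm ((x - y) + h *\<^sub>R \<Phi> x))\<^sup>2"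
      using d0 by (intro power_mono) (auto simp: dist_norm algebra_simps)
    also have "\<dots> = (norm (x - y))\<^sup>2 + 2 * h * ((x - y) \<bullet> \<Phi> x) + h\<^sup>2 * (norm (\<Phi> x))\<^sup>2"
      unfolding power2_norm_eq_inner by (simp add: inner_add_left inner_add_right inner_commute power2_eq_square algebra_simps)
    also have "(x - y) \<bullet> \<Phi> x = (x - y) \<bullet> (\<Phi> x - \<Phi> y)" using orth by (simp add: inner_diff_right inner_commute)
    also have "(norm (x - y))\<^sup>2 + 2 * h * ((x - y) \<bullet> (\<Phi> x - \<Phi> y)) + h\<^sup>2 * (norm (\<Phi> x))\<^sup>2
        \<le> (d x)\<^sup>2 + 2 * h * (L * (d x)\<^sup>2) + h\<^sup>2 * M\<^sup>2"
    proof (intro add_mono mult_left_mono power_mono)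
      have "(x - y) \<bullet> (\<Phi> x - \<Phi> y) \<le> norm (x - y) * norm (\<Phi> x - \<Phi> y)" by (rule norm_cauchy_schwarz)
      also have "\<dots> \<le> norm (x - y) * (L * norm (x - y))" by (intro mult_left_mono lip) auto
      finally show "(x - y) \<bullet> (\<Phi> x - \<Phi> y) \<le> L * (d x)\<^sup>2" using y(2) by (simp add: dist_norm power2_eq_square algebra_simps)
    qed (use h M y(2) d0 in \<open>auto simp: dist_norm\<close>)
    finally show ?thesis by (simp add: algebra_simps)
  qed
  \<comment> \<open>By \<open>near\<close> the first-order growth of the squared distance is
    proportional to the squared distance itself. After division by \<epsilon>^2 it therefore stays
    bounded in the layer d < \<epsilon>, uniformly in \<epsilon>.\<close>
  define cf where "cf = (\<lambda>\<epsilon> x. min 1 ((d x)\<^sup>2 / \<epsilon>\<^sup>2))"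
  define m where "m = (\<lambda>\<epsilon>. LINT x|lborel. indicator {x\<in>\<Omega>. d x < \<epsilon>} x :: real)"
  have md: "{x \<in> \<Omega>. d x < \<epsilon>} \<in> sets lborel" for \<epsilon>
  proof -
    have "open (\<Omega> \<inter> {x. d x < \<epsilon>})" by (intro open_Int \<Omega>(1) open_Collect_less cd continuous_intros)
    moreover have "{x \<in> \<Omega>. d x < \<epsilon>} = \<Omega> \<inter> {x. d x < \<epsilon>}" by blast
    ultimately show ?thesis by simp
  qed
  have im: "integrable lborel (\<lambda>x. indicator {x\<in>\<Omega>. d x < \<epsilon>} x :: real)" for \<epsilon>
  proof (rule integrable_real_indicator[OF md])
    have "bounded {x \<in> \<Omega>. d x < \<epsilon>}" by (rule bounded_subset[OF \<Omega>(2)]) blast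
    then show "emeasure lborel {x \<in> \<Omega>. d x < \<epsilon>} < \<infinity>" by (rule emeasure_bounded_finite)
  qed
  have iD: "integrable lborel (\<lambda>x. \<bar>D x\<bar>)"
    by (rule integrable_continuous_bounded_support[of _ "cball 0 R"]) (auto intro!: continuous_intros cD simp: sD)
  have Dm: "D \<in> borel_measurable borel" using cD by (rule borel_measurable_continuous_onI)
  have step: "- (2 * L * m \<epsilon>) \<le> (LINT x|lborel. cf \<epsilon> x * D x)" if \<epsilon>: "\<epsilon> > 0" for \<epsilon>
  proof -
    have ccf: "continuous_on UNIV (cf \<epsilon>)" unfolding cf_def using \<epsilon> by (intro continuous_intros cd) auto
    have cf01: "0 \<le> cf \<epsilon> x" "cf \<epsilon> x \<le> 1" for x by (auto simp: cf_def)
    have cfout: "cf \<epsilon> x = 0" if "x \<notin> \<Omega>" for x using that dF[of x] by (simp add: cf_def)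
    obtain R1 where R1: "R1 > 0" "\<Omega> \<subseteq> ball 0 R1" using bounded_subset_ballD[OF \<Omega>(2), of 0] by blast
    define R2 where "R2 = max R R1"
    define V where "V = (LINT x|lborel. indicator (cball (0::real^2) R2) x :: real)"
    have iV: "integrable lborel (indicator (cball (0::real^2) R2) :: _ \<Rightarrow> real)"
      using emeasure_bounded_finite[of "cball (0::real^2) R2"] by (intro integrable_real_indicator) auto
    have V0: "V \<ge> 0" unfolding V_def by (rule Bochner_Integration.integral_nonneg) simp
    \<comment> \<open>Collects the errors of second order in h: M^2 / \<epsilon>^2 from
      \<open>near\<close> and CJ from the quadratic term of the Jacobian determinant.\<close>
    define K where "K = M\<^sup>2 / \<epsilon>\<^sup>2 * V + CJ * V"
    have far: "x + h *\<^sub>R \<Phi> x = x" "x \<notin> \<Omega>" if "x \<notin> cball 0 R2" for x h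
    proof -
      have "norm x > R" "norm x > R1" using that by (auto simp: R2_def)
      then show "x + h *\<^sub>R \<Phi> x = x" using supp(1) by simp
      show "x \<notin> \<Omega>" using R1(2) \<open>norm x > R1\<close> by force
    qed
    \<comment> \<open>The bound h L < 1 makes x \<mapsto> x + h \<Phi> x onto, and the last two
      bounds keep its Jacobian determinant nonnegative.\<close>
    have pre: "- (2 * L * m \<epsilon>) - h * K \<le> (LINT x|lborel. cf \<epsilon> (x + h *\<^sub>R \<Phi> x) * D x)"
      if h: "h > 0" "h * L < 1" "h * CD \<le> 1/2" "h\<^sup>2 * CJ \<le> 1/2" for h
    proof -
      define g where "g = (\<lambda>x. x + h *\<^sub>R \<Phi> x)"
      have cg: "continuous_on UNIV g" unfolding g_def by (intro continuous_intros c\<Phi>)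
      have ccfg: "continuous_on UNIV (\<lambda>x. cf \<epsilon> (g x))" by (rule continuous_on_compose2[OF ccf cg]) simp
      have sg: "cf \<epsilon> (g x) = 0" if "x \<notin> cball 0 R2" for x
        unfolding g_def far(1)[OF that] by (rule cfout[OF far(2)[OF that]])
      have i1: "integrable lborel (cf \<epsilon>)"
        by (rule integrable_continuous_bounded_support[OF ccf \<Omega>(2)]) (rule cfout)
      have i2: "integrable lborel (\<lambda>x. cf \<epsilon> (g x))"
        by (rule integrable_continuous_bounded_support[OF ccfg, of "cball 0 R2"]) (auto simp: sg)
      have i3: "integrable lborel (\<lambda>x. cf \<epsilon> (g x) * D x)"
        by (rule integrable_continuous_bounded_support[of _ "cball 0 R2"]) (auto intro!: continuous_intros ccfg cD simp: sg)
      have i4: "integrable lborel (\<lambda>x. cf \<epsilon> (g x) * J x)"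
        by (rule integrable_continuous_bounded_support[of _ "cball 0 R2"]) (auto intro!: continuous_intros ccfg cJ simp: sg)
      \<comment> \<open>A preimage of y is a fixed point of the contraction x \<mapsto> y - h \<Phi>
        x. The change of variables enters below only as an inequality for the image, for which
        surjectivity is the right input.\<close>
      have surj: "g ` UNIV = UNIV"
      proof (intro equalityI subsetI UNIV_I)
        fix y
        have "\<exists>!x. y - h *\<^sub>R \<Phi> x = x"
        proof (rule banach_fix_type[of "h * L"])
          show "\<forall>x z. dist (y - h *\<^sub>R \<Phi> x) (y - h *\<^sub>R \<Phi> z) \<le> h * L * dist x z"
          proof (intro allI)
            fix x z
            have "dist (y - h *\<^sub>R \<Phi> x) (y - h *\<^sub>R \<Phi> z) = norm (h *\<^sub>R (\<Phi> z - \<Phi> x))"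
              by (simp add: dist_norm scaleR_diff_right)
            also have "\<dots> = h * norm (\<Phi> z - \<Phi> x)" using h(1) by simp
            also have "\<dots> \<le> h * (L * norm (z - x))" using h(1) by (intro mult_left_mono lip) auto
            finally show "dist (y - h *\<^sub>R \<Phi> x) (y - h *\<^sub>R \<Phi> z) \<le> h * L * dist x z"
              by (simp add: dist_norm norm_minus_commute mult.assoc)
          qed
        qed (use h L0 in auto)
        then obtain x where "y - h *\<^sub>R \<Phi> x = x" by blast
        then have "y = g x" unfolding g_def by (metis diff_eq_eq)
        then show "y \<in> g ` UNIV" by blast
      qed
      have detg: "\<bar>det (matrix (\<lambda>v. v + h *\<^sub>R \<Phi>' x v))\<bar> = 1 + h * D x + h\<^sup>2 * J x" for x
      proof -
        have "\<bar>h * D x\<bar> = h * norm (D x)" "\<bar>h\<^sup>2 * J x\<bar> = h\<^sup>2 * norm (J x)"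
          using h(1) by (simp_all add: abs_mult)
        moreover have "h * norm (D x) \<le> h * CD" "h\<^sup>2 * norm (J x) \<le> h\<^sup>2 * CJ"
          using h(1) by (intro mult_left_mono CD CJ; simp)+
        moreover note h(3,4)
        ultimately have "0 \<le> 1 + h * D x + h\<^sup>2 * J x" by linarith
        moreover have "det (matrix (\<lambda>v. v + h *\<^sub>R \<Phi>' x v)) = 1 + h * D x + h\<^sup>2 * J x"
          unfolding det_id_plus D_def J_def ..
        ultimately show ?thesis by simp
      qed
      have ij: "integrable lborel (\<lambda>x. (1 + h * D x + h\<^sup>2 * J x) * cf \<epsilon> (g x))"
        by (rule integrable_continuous_bounded_support[of _ "cball 0 R2"]) (auto intro!: continuous_intros ccfg cD cJ simp: sg)
      have "integral (g ` UNIV) (cf \<epsilon>) \<le> integral UNIV (\<lambda>x. \<bar>det (matrix (\<lambda>v. v + h *\<^sub>R \<Phi>' x v))\<bar> * cf \<epsilon> (g x))"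
      proof (rule integral_on_image_ubound)
        show "(g has_derivative (\<lambda>v. v + h *\<^sub>R \<Phi>' x v)) (at x within UNIV)" for x
          unfolding g_def using der[of x] by (auto intro!: derivative_eq_intros)
        show "(\<lambda>x. \<bar>det (matrix (\<lambda>v. v + h *\<^sub>R \<Phi>' x v))\<bar> * cf \<epsilon> (g x)) integrable_on UNIV"
          unfolding detg using has_integral_integral_lborel[OF ij] by (rule has_integral_integrable)
      qed (rule cf01)
      then have "(LINT x|lborel. cf \<epsilon> x) \<le> (LINT x|lborel. (1 + h * D x + h\<^sup>2 * J x) * cf \<epsilon> (g x))"
        unfolding surj detg integral_lborel[OF i1] integral_lborel[OF ij] .
      also have "\<dots> = (LINT x|lborel. cf \<epsilon> (g x) + (h * (cf \<epsilon> (g x) * D x) + h\<^sup>2 * (cf \<epsilon> (g x) * J x)))"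
        by (intro Bochner_Integration.integral_cong) (auto simp: algebra_simps)
      also have "\<dots> = (LINT x|lborel. cf \<epsilon> (g x)) + (h * (LINT x|lborel. cf \<epsilon> (g x) * D x) + h\<^sup>2 * (LINT x|lborel. cf \<epsilon> (g x) * J x))"
        using i2 i3 i4 by simp
      finally have A: "(LINT x|lborel. cf \<epsilon> x) - (LINT x|lborel. cf \<epsilon> (g x)) \<le> h * (LINT x|lborel. cf \<epsilon> (g x) * D x) + h\<^sup>2 * (LINT x|lborel. cf \<epsilon> (g x) * J x)"
        by linarith
      have B: "(LINT x|lborel. cf \<epsilon> (g x) * J x) \<le> CJ * V"
      proof -
        have "(LINT x|lborel. cf \<epsilon> (g x) * J x) \<le> (LINT x|lborel. CJ * indicator (cball (0::real^2) R2) x)"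
        proof (rule integral_mono[OF i4])
          show "integrable lborel (\<lambda>x. CJ * indicator (cball (0::real^2) R2) x)" using iV by simp
          show "cf \<epsilon> (g x) * J x \<le> CJ * indicator (cball 0 R2) x" for x
          proof (cases "x \<in> cball 0 R2")
            case True
            have "cf \<epsilon> (g x) * J x \<le> cf \<epsilon> (g x) * CJ" using cf01 CJ(2)[of x] by (intro mult_left_mono) auto
            also have "\<dots> \<le> 1 * CJ" using cf01 CJ(1) by (intro mult_right_mono) auto
            finally show ?thesis using True by simp
          qed (simp add: sg)
        qed
        also have "\<dots> = CJ * V" unfolding V_def by simp
        finally show ?thesis .
      qed
      \<comment> \<open>Where d x \<ge> \<epsilon> the cut-off already has its maximal value 1 and
        cannot grow; in the layer \<open>near\<close> bounds the growth.\<close>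
      have C: "(LINT x|lborel. cf \<epsilon> (g x)) - (LINT x|lborel. cf \<epsilon> x) \<le> 2 * h * L * m \<epsilon> + h\<^sup>2 * (M\<^sup>2 / \<epsilon>\<^sup>2) * V"
      proof -
        have "(LINT x|lborel. cf \<epsilon> (g x)) - (LINT x|lborel. cf \<epsilon> x) = (LINT x|lborel. cf \<epsilon> (g x) - cf \<epsilon> x)"
          using i1 i2 by simp
        also have "\<dots> \<le> (LINT x|lborel. 2 * h * L * indicator {x\<in>\<Omega>. d x < \<epsilon>} x + h\<^sup>2 * (M\<^sup>2 / \<epsilon>\<^sup>2) * indicator (cball 0 R2) x)"
        proof (rule integral_mono)
          show "integrable lborel (\<lambda>x. cf \<epsilon> (g x) - cf \<epsilon> x)" using i1 i2 by simp
          show "integrable lborel (\<lambda>x. 2 * h * L * indicator {x\<in>\<Omega>. d x < \<epsilon>} x + h\<^sup>2 * (M\<^sup>2 / \<epsilon>\<^sup>2) * indicator (cball 0 R2) x)"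
            using im[of \<epsilon>] iV by simp
          fix x
          have nn: "0 \<le> 2 * h * L * indicator {x\<in>\<Omega>. d x < \<epsilon>} x + h\<^sup>2 * (M\<^sup>2 / \<epsilon>\<^sup>2) * indicator (cball 0 R2) x"
            using h(1) L0 by (intro add_nonneg_nonneg mult_nonneg_nonneg) auto
          show "cf \<epsilon> (g x) - cf \<epsilon> x \<le> 2 * h * L * indicator {x\<in>\<Omega>. d x < \<epsilon>} x + h\<^sup>2 * (M\<^sup>2 / \<epsilon>\<^sup>2) * indicator (cball 0 R2) x"
          proof (cases "d x < \<epsilon> \<and> x \<in> cball 0 R2")
            case False
            then have "cf \<epsilon> (g x) \<le> cf \<epsilon> x"
            proof (cases "x \<in> cball 0 R2")
              case True
              then have "d x \<ge> \<epsilon>" using False by simp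
              then have "\<epsilon>\<^sup>2 \<le> (d x)\<^sup>2" using \<epsilon> by (intro power_mono) auto
              then have "cf \<epsilon> x = 1" using \<epsilon> by (simp add: cf_def)
              then show ?thesis using cf01(2) by simp
            qed (simp add: sg cf01)
            then show ?thesis using nn by linarith
          next
            case True
            have lt: "(d x)\<^sup>2 / \<epsilon>\<^sup>2 \<le> 1" using True d0[of x] \<epsilon> by (simp add: power_mono)
            have "cf \<epsilon> (g x) - cf \<epsilon> x \<le> (d (g x))\<^sup>2 / \<epsilon>\<^sup>2 - (d x)\<^sup>2 / \<epsilon>\<^sup>2"
              using lt by (simp add: cf_def min_def)
            also have "\<dots> = ((d (g x))\<^sup>2 - (d x)\<^sup>2) / \<epsilon>\<^sup>2" by (simp add: diff_divide_distrib)
            also have "\<dots> \<le> (2 * h * L * (d x)\<^sup>2 + h\<^sup>2 * M\<^sup>2) / \<epsilon>\<^sup>2"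
              using near[of h x] h(1) unfolding g_def by (intro divide_right_mono) auto
            also have "\<dots> = 2 * h * L * ((d x)\<^sup>2 / \<epsilon>\<^sup>2) + h\<^sup>2 * (M\<^sup>2 / \<epsilon>\<^sup>2)" by (simp add: add_divide_distrib)
            also have "2 * h * L * ((d x)\<^sup>2 / \<epsilon>\<^sup>2) \<le> 2 * h * L * indicator {x\<in>\<Omega>. d x < \<epsilon>} x"
            proof (cases "x \<in> \<Omega>")
              case xO: True
              then show ?thesis using True lt h(1) L0 mult_left_mono[OF lt, of "2 * h * L"] by simp
            next
              case False
              then show ?thesis using dF[of x] by simp
            qed
            finally show ?thesis using True by simp
          qed
        qed
        also have "\<dots> = 2 * h * L * m \<epsilon> + h\<^sup>2 * (M\<^sup>2 / \<epsilon>\<^sup>2) * V"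
          using im[of \<epsilon>] iV unfolding m_def V_def by simp
        finally show ?thesis .
      qed
      have "h\<^sup>2 * (LINT x|lborel. cf \<epsilon> (g x) * J x) \<le> h\<^sup>2 * (CJ * V)" using B by (rule mult_left_mono) simp
      then have "h * (- (2 * L * m \<epsilon>) - h * K) \<le> h * (LINT x|lborel. cf \<epsilon> (g x) * D x)"
        using A C unfolding K_def by (simp add: power2_eq_square algebra_simps)
      then show ?thesis using h(1) unfolding g_def by simp
    qed
    define h where "h = (\<lambda>n::nat. 1 / (real n + 1))"
    have hlim: "h \<longlonglongrightarrow> 0" unfolding h_def by real_asymp
    have "(\<lambda>n. LINT x|lborel. cf \<epsilon> (x + h n *\<^sub>R \<Phi> x) * D x) \<longlonglongrightarrow> (LINT x|lborel. cf \<epsilon> x * D x)"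
    proof (rule integral_dominated_convergence[where w = "\<lambda>x. \<bar>D x\<bar>"])
      have cc: "continuous_on UNIV (\<lambda>x. cf \<epsilon> (x + h n *\<^sub>R \<Phi> x))" for n
        by (rule continuous_on_compose2[OF ccf]) (auto intro!: continuous_intros c\<Phi>)
      show "(\<lambda>x. cf \<epsilon> x * D x) \<in> borel_measurable lborel" "(\<lambda>x. cf \<epsilon> (x + h n *\<^sub>R \<Phi> x) * D x) \<in> borel_measurable lborel" for n
        unfolding measurable_lborel2 by (intro borel_measurable_continuous_onI continuous_intros ccf cc cD)+
      show "AE x in lborel. (\<lambda>n. cf \<epsilon> (x + h n *\<^sub>R \<Phi> x) * D x) \<longlonglongrightarrow> cf \<epsilon> x * D x"
      proof (rule AE_I2)
        fix x
        have "(\<lambda>n. x + h n *\<^sub>R \<Phi> x) \<longlonglongrightarrow> x + 0 *\<^sub>R \<Phi> x" by (intro tendsto_intros hlim)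
        then have "(\<lambda>n. cf \<epsilon> (x + h n *\<^sub>R \<Phi> x)) \<longlonglongrightarrow> cf \<epsilon> (x + 0 *\<^sub>R \<Phi> x)"
          using continuous_on_tendsto_compose[OF ccf] by simp
        then show "(\<lambda>n. cf \<epsilon> (x + h n *\<^sub>R \<Phi> x) * D x) \<longlonglongrightarrow> cf \<epsilon> x * D x"
          by (intro tendsto_intros) simp
      qed
      show "AE x in lborel. norm (cf \<epsilon> (x + h n *\<^sub>R \<Phi> x) * D x) \<le> \<bar>D x\<bar>" for n
        using cf01 by (intro AE_I2) (simp add: abs_mult mult_left_le_one_le)
    qed (rule iD)
    moreover have "(\<lambda>n. - (2 * L * m \<epsilon>) - h n * K) \<longlonglongrightarrow> - (2 * L * m \<epsilon>) - 0 * K"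
      by (intro tendsto_intros hlim)
    moreover have "\<forall>\<^sub>F n in sequentially. - (2 * L * m \<epsilon>) - h n * K \<le> (LINT x|lborel. cf \<epsilon> (x + h n *\<^sub>R \<Phi> x) * D x)"
    proof -
      have l1: "(\<lambda>n. h n * L) \<longlonglongrightarrow> 0 * L" "(\<lambda>n. h n * CD) \<longlonglongrightarrow> 0 * CD" "(\<lambda>n. (h n)\<^sup>2 * CJ) \<longlonglongrightarrow> 0\<^sup>2 * CJ"
        by (intro tendsto_intros hlim)+
      have "\<forall>\<^sub>F n in sequentially. h n * L < 1" "\<forall>\<^sub>F n in sequentially. h n * CD < 1/2" "\<forall>\<^sub>F n in sequentially. (h n)\<^sup>2 * CJ < 1/2"
        by (rule order_tendstoD(2)[OF l1(1)], simp, rule order_tendstoD(2)[OF l1(2)], simp, rule order_tendstoD(2)[OF l1(3)], simp)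
      then show ?thesis
        by eventually_elim (rule pre, auto simp: h_def)
    qed
    ultimately show ?thesis using tendsto_le[of sequentially] by fastforce
  qed
  \<comment> \<open>As \<epsilon> tends to zero the cut-offs converge to the indicator of \<Omega>.
    The layers lie inside the open set and shrink to the empty set, so a frontier of positive
    measure does no harm.\<close>
  define \<epsilon> where "\<epsilon> = (\<lambda>n::nat. 1 / (real n + 1))"
  have \<epsilon>0: "\<epsilon> n > 0" for n by (simp add: \<epsilon>_def)
  have \<epsilon>lim: "\<epsilon> \<longlonglongrightarrow> 0" unfolding \<epsilon>_def by real_asymp
  have ev: "\<forall>\<^sub>F n in sequentially. \<epsilon> n < d x" if "x \<in> \<Omega>" for x
  proof -
    have "d x > 0" using dF[of x] d0[of x] that by simp
    then show ?thesis by (rule order_tendstoD(2)[OF \<epsilon>lim])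
  qed
  have iO: "integrable lborel (indicator \<Omega> :: _ \<Rightarrow> real)"
    using emeasure_bounded_finite[OF \<Omega>(2)] \<Omega>(1) by (intro integrable_real_indicator) auto
  have m0: "(\<lambda>n. m (\<epsilon> n)) \<longlonglongrightarrow> (LINT x::real^2|lborel. 0)"
    unfolding m_def
  proof (rule integral_dominated_convergence[where w = "indicator \<Omega>"])
    show "(\<lambda>x. indicat_real {x \<in> \<Omega>. d x < \<epsilon> n} x) \<in> borel_measurable lborel" for n
      using im by (rule borel_measurable_integrable)
    show "AE x in lborel. (\<lambda>n. indicat_real {x \<in> \<Omega>. d x < \<epsilon> n} x) \<longlonglongrightarrow> 0"
    proof (rule AE_I2)
      fix x
      have "\<forall>\<^sub>F n in sequentially. indicat_real {x \<in> \<Omega>. d x < \<epsilon> n} x = 0"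
      proof (cases "x \<in> \<Omega>")
        case True
        from ev[OF True] show ?thesis by (rule eventually_mono) (auto simp: indicator_def)
      qed simp
      then show "(\<lambda>n. indicat_real {x \<in> \<Omega>. d x < \<epsilon> n} x) \<longlonglongrightarrow> 0" by (rule tendsto_eventually)
    qed
    show "AE x in lborel. norm (indicat_real {x \<in> \<Omega>. d x < \<epsilon> n} x) \<le> indicator \<Omega> x" for n
      by (intro AE_I2) (auto simp: indicator_def)
  qed (use iO in auto)
  have "(\<lambda>n. LINT x|lborel. cf (\<epsilon> n) x * D x) \<longlonglongrightarrow> (LINT x|lborel. indicator \<Omega> x * D x)"
  proof (rule integral_dominated_convergence[where w = "\<lambda>x. \<bar>D x\<bar>"])
    show "(\<lambda>x. indicator \<Omega> x * D x) \<in> borel_measurable lborel"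
      unfolding measurable_lborel2
      by (intro borel_measurable_times borel_measurable_indicator Dm borel_open \<Omega>(1))
    show "(\<lambda>x. cf (\<epsilon> n) x * D x) \<in> borel_measurable lborel" for n
      unfolding measurable_lborel2 cf_def using \<epsilon>0[of n]
      by (intro borel_measurable_continuous_onI continuous_intros cd cD) auto
    show "AE x in lborel. (\<lambda>n. cf (\<epsilon> n) x * D x) \<longlonglongrightarrow> indicator \<Omega> x * D x"
    proof (rule AE_I2)
      fix x
      have "\<forall>\<^sub>F n in sequentially. cf (\<epsilon> n) x * D x = indicator \<Omega> x * D x"
      proof (cases "x \<in> \<Omega>")
        case True
        from ev[OF True] show ?thesis
        proof (rule eventually_mono)
          fix n assume "\<epsilon> n < d x"
          then have "(\<epsilon> n)\<^sup>2 \<le> (d x)\<^sup>2" using \<epsilon>0[of n] by (intro power_mono) auto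
          then show "cf (\<epsilon> n) x * D x = indicator \<Omega> x * D x" using True \<epsilon>0[of n] by (simp add: cf_def)
        qed
      next
        case False
        then show ?thesis using dF[of x] by (simp add: cf_def)
      qed
      then show "(\<lambda>n. cf (\<epsilon> n) x * D x) \<longlonglongrightarrow> indicator \<Omega> x * D x" by (rule tendsto_eventually)
    qed
    show "AE x in lborel. norm (cf (\<epsilon> n) x * D x) \<le> \<bar>D x\<bar>" for n
      by (intro AE_I2) (simp add: cf_def abs_mult mult_left_le_one_le)
  qed (rule iD)
  moreover have "(\<lambda>n. - (2 * L * m (\<epsilon> n))) \<longlonglongrightarrow> - (2 * L * 0)"
    using m0 by (intro tendsto_intros) simp
  ultimately have "- (2 * L * 0) \<le> (LINT x|lborel. indicator \<Omega> x * D x)"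
    by (rule tendsto_le[OF sequentially_bot]) (use step[OF \<epsilon>0] in simp)
  then show ?thesis by (simp add: D_def)
qed

text \<open>Tangency is preserved by changing the sign of the field, so the one-sided bounds for
  \<Phi> and - \<Phi> give equality.\<close>

lemma integral_divergence_tangential:
  fixes \<Omega> :: "(real^2) set" and \<Phi> :: "real^2 \<Rightarrow> real^2"
  assumes \<Omega>: "open \<Omega>" "bounded \<Omega>"
    and der: "\<And>x. (\<Phi> has_derivative \<Phi>' x) (at x)"
    and cont: "\<And>v. continuous_on UNIV (\<lambda>x. \<Phi>' x v)"
    and supp: "\<And>x. norm x > R \<Longrightarrow> \<Phi> x = 0" "\<And>x v. norm x > R \<Longrightarrow> \<Phi>' x v = 0"
    and tang: "\<And>x \<nu>. outward_unit_normal \<Omega> x \<nu> \<Longrightarrow> \<Phi> x \<bullet> \<nu> = 0"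
  shows "(LINT x|lborel. indicator \<Omega> x * (\<Phi>' x (axis 1 1) $ 1 + \<Phi>' x (axis 2 1) $ 2)) = 0"
proof -
  have "0 \<le> (LINT x|lborel. indicator \<Omega> x * (\<Phi>' x (axis 1 1) $ 1 + \<Phi>' x (axis 2 1) $ 2))"
    by (rule integral_divergence_nonneg[OF assms])
  moreover have "0 \<le> (LINT x|lborel. indicator \<Omega> x * ((- \<Phi>' x (axis 1 1)) $ 1 + (- \<Phi>' x (axis 2 1)) $ 2))"
    by (rule integral_divergence_nonneg[OF \<Omega>, where \<Phi> = "\<lambda>x. - \<Phi> x" and R = R])
      (use supp tang in \<open>auto intro!: has_derivative_minus der continuous_intros cont\<close>)
  moreover have "indicator \<Omega> x * ((- \<Phi>' x (axis 1 1)) $ 1 + (- \<Phi>' x (axis 2 1)) $ 2)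
      = - (indicator \<Omega> x * (\<Phi>' x (axis 1 1) $ 1 + \<Phi>' x (axis 2 1) $ 2))" for x
    by (simp add: algebra_simps)
  ultimately show ?thesis by simp
qed


subsection \<open>Test functions\<close>

lemma AE_lborel_snd:
  fixes P :: "'b::euclidean_space \<Rightarrow> bool"
  assumes "AE x in lborel. P x"
  shows "AE z :: 'a::euclidean_space \<times> 'b in lborel. P (snd z)"
proof -
  obtain N where N: "{x. \<not> P x} \<subseteq> N" "N \<in> sets borel" "emeasure lborel N = 0"
    using assms by (auto elim!: AE_E)
  have "emeasure (lborel \<Otimes>\<^sub>M lborel) (UNIV \<times> N :: ('a \<times> 'b) set) = emeasure lborel (UNIV :: 'a set) * emeasure lborel N"
    using N(2) by (intro lborel.emeasure_pair_measure_Times) auto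
  then have "emeasure lborel (UNIV \<times> N :: ('a \<times> 'b) set) = 0" using N(3) by (simp add: lborel_prod)
  moreover have "(UNIV \<times> N :: ('a \<times> 'b) set) \<in> sets borel" using N(2) by (intro borel_Times) auto
  ultimately have "(UNIV \<times> N :: ('a \<times> 'b) set) \<in> null_sets lborel" by auto
  then have "AE z in lborel. z \<notin> (UNIV \<times> N :: ('a \<times> 'b) set)" by (rule AE_not_in)
  then show ?thesis by (rule eventually_mono) (use N(1) in auto)
qed

text \<open>Bridge from the Lebesgue integrals over a set in the definitions to integrals over the
  whole space with respect to \<open>lborel\<close>. Since F is compared with F' only almost
  everywhere, the interfaces between pieces disappear here.\<close>

lemma lebesgue_on_integral_AE:
  fixes F F' :: "'a::euclidean_space \<Rightarrow> real"
  assumes S: "S \<in> sets borel" and F': "integrable lborel F'"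
    and eq: "AE z in lborel. indicator S z * F z = F' z"
  shows "integrable (lebesgue_on S) F" "integral\<^sup>L (lebesgue_on S) F = integral\<^sup>L lborel F'"
proof -
  have mF': "F' \<in> borel_measurable lborel" using F' by (rule borel_measurable_integrable)
  have iF': "integrable lebesgue F'" using F' integrable_completion[OF mF'] by simp
  have ae: "AE z in lebesgue. F' z = indicator S z *\<^sub>R F z"
    unfolding AE_completion_iff using eq by (rule eventually_mono) simp
  have m: "(\<lambda>z. indicator S z *\<^sub>R F z) \<in> borel_measurable lebesgue"
    by (rule borel_measurable_AE[OF borel_measurable_integrable[OF iF'] ae])
  have S': "S \<inter> space lebesgue \<in> sets lebesgue" using S by simp
  show "integrable (lebesgue_on S) F"
    unfolding integrable_restrict_space[OF S'] by (rule integrable_cong_AE_imp[OF iF' m ae])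
  have "integral\<^sup>L (lebesgue_on S) F = (LINT z|lebesgue. indicator S z *\<^sub>R F z)"
    by (rule integral_restrict_space[OF S'])
  also have "\<dots> = integral\<^sup>L lebesgue F'"
    by (rule integral_cong_AE[OF m borel_measurable_integrable[OF iF']]) (use ae in eventually_elim, simp)
  also have "\<dots> = integral\<^sup>L lborel F'" by (rule integral_completion[OF mF'])
  finally show "integral\<^sup>L (lebesgue_on S) F = integral\<^sup>L lborel F'" .
qed

lemma space_time_borel: "open \<Omega> \<Longrightarrow> space_time T \<Omega> \<in> sets borel"
  unfolding space_time_def by (intro borel_Times) auto

lemma weak_balance_intro:
  assumes \<Omega>: "open \<Omega>" and F': "integrable lborel F'" and G': "integrable lborel G'"
    and F: "AE z in lborel. indicator (space_time T \<Omega>) z * F z = F' z"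
    and G: "AE x in lborel. indicator \<Omega> x * G x = G' x"
    and 0: "integral\<^sup>L lborel F' + integral\<^sup>L lborel G' = 0"
  shows "weak_balance T \<Omega> F G"
  unfolding weak_balance_def
  using lebesgue_on_integral_AE[OF space_time_borel[OF \<Omega>] F' F] lebesgue_on_integral_AE[OF borel_open[OF \<Omega>] G' G] 0
  by simp

section \<open>From test functions on the time strip to tests on the half space\<close>

lemma test_functionE:
  assumes "test_function T \<phi>"
  obtains \<phi>' K where "\<And>z. z \<in> space_time T UNIV \<Longrightarrow> (\<phi> has_derivative \<phi>' z) (at z within space_time T UNIV)"
    "\<And>v. continuous_on (space_time T UNIV) (\<lambda>z. \<phi>' z v)"
    "compact K" "K \<subseteq> space_time T UNIV" "\<And>z. z \<in> space_time T UNIV - K \<Longrightarrow> \<phi> z = 0"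
proof -
  have "Ck_on (Suc 0) (space_time T UNIV) \<phi>" using assms unfolding test_function_def smooth_on_def by blast
  then obtain \<phi>' where "\<forall>z\<in>space_time T UNIV. (\<phi> has_derivative \<phi>' z) (at z within space_time T UNIV)"
    "\<forall>v. continuous_on (space_time T UNIV) (\<lambda>z. \<phi>' z v)"
    by auto
  moreover obtain K where "compact K" "K \<subseteq> space_time T UNIV" "\<forall>z\<in>space_time T UNIV - K. \<phi> z = 0"
    using assms unfolding test_function_def by blast
  ultimately show ?thesis using that by blast
qed

lemma at_within_half_space:
  assumes "z \<in> space_time T UNIV"
  shows "at z within half_space = at z within space_time T UNIV"
proof (rule at_within_nhd)
  show "open {w::stpoint. fst w < T}" by (intro open_Collect_less continuous_intros)
qed (use assms in \<open>auto simp: space_time_def\<close>)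

text \<open>Every point of the strip, including those at the initial time, admits arbitrarily small
  positive steps along each basis vector that stay in the strip, and such steps determine the
  derivative.\<close>

lemma space_time_derivative_unique:
  assumes z: "z \<in> space_time T UNIV"
    and "(f has_derivative f') (at z within space_time T UNIV)" "(f has_derivative f'') (at z within space_time T UNIV)"
  shows "f' = f''"
proof (rule frechet_derivative_unique_within[OF assms(2,3)])
  fix i :: stpoint and e :: real assume i: "i \<in> Basis" "e > 0"
  define d where "d = min (e / 2) ((T - fst z) / 2)"
  have d: "0 < d" "d < e" "fst z + d < T" using z i(2) by (auto simp: d_def space_time_def mem_Times_iff min_def field_simps)
  have "fst i = 0 \<or> fst i = 1" using i(1) by (auto simp: Basis_prod_def)
  then have "z + d *\<^sub>R i \<in> space_time T UNIV" using d z by (auto simp: space_time_def mem_Times_iff)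
  then show "\<exists>d. 0 < \<bar>d\<bar> \<and> \<bar>d\<bar> < e \<and> z + d *\<^sub>R i \<in> space_time T UNIV"
    using d by (intro exI[of _ d]) auto
qed

lemma ball_avoiding_compact:
  fixes K :: "'a::metric_space set"
  assumes "compact K" "z \<notin> K"
  shows "\<exists>e>0. ball z e \<subseteq> - K"
proof -
  have "open (- K)" using compact_imp_closed[OF assms(1)] by (simp add: open_Compl)
  then show ?thesis using assms(2) unfolding open_contains_ball by blast
qed

text \<open>Near such a point the test vanishes on the strip, so zero is a derivative within it;
  uniqueness of that derivative covers the initial time as well.\<close>

lemma test_derivative_outside:
  assumes der: "\<And>z. z \<in> space_time T UNIV \<Longrightarrow> (\<phi> has_derivative \<phi>' z) (at z within space_time T UNIV)"
    and K: "compact K" and 0: "\<And>z. z \<in> space_time T UNIV - K \<Longrightarrow> \<phi> z = 0"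
    and z: "z \<in> space_time T UNIV - K"
  shows "\<phi>' z v = 0"
proof -
  obtain e where e: "e > 0" "ball z e \<subseteq> - K"
    using ball_avoiding_compact[OF K, of z] z by blast
  have "((\<lambda>_. 0) has_derivative (\<lambda>_. 0)) (at z within space_time T UNIV)" by simp
  then have "(\<phi> has_derivative (\<lambda>_. 0)) (at z within space_time T UNIV)"
  proof (rule has_derivative_transform_within[OF _ e(1)])
    fix w assume "w \<in> space_time T UNIV" "dist w z < e"
    moreover from this have "w \<in> ball z e" by (simp add: dist_commute)
    ultimately have "w \<in> space_time T UNIV - K" using e(2) by blast
    then show "0 = \<phi> w" using 0 by simp
  qed (use z in blast)
  from space_time_derivative_unique[OF _ der this] show ?thesis using z by (metis DiffD1)
qed

text \<open>The support is compact in a strip that is open at time T, hence stays away from T;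
  extension by zero remains continuously differentiable up to the initial time.\<close>

lemma c1_test_extend:
  fixes \<phi> :: "stpoint \<Rightarrow> real"
  assumes T: "T > 0"
    and der: "\<And>z. z \<in> space_time T UNIV \<Longrightarrow> (\<phi> has_derivative \<phi>' z) (at z within space_time T UNIV)"
    and cont: "\<And>v. continuous_on (space_time T UNIV) (\<lambda>z. \<phi>' z v)"
    and K: "compact K" "K \<subseteq> space_time T UNIV" and 0: "\<And>z. z \<in> space_time T UNIV - K \<Longrightarrow> \<phi> z = 0"
  shows "c1_test (\<lambda>z. if fst z < T then \<phi> z else 0) (\<lambda>z v. if fst z < T then \<phi>' z v else 0)"
proof -
  note out = test_derivative_outside[OF der K(1) 0]
  have st: "z \<in> space_time T UNIV \<longleftrightarrow> z \<in> half_space \<and> fst z < T" for z by (auto simp: space_time_def mem_Times_iff)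
  have nbhd: "\<exists>e>0. \<forall>w\<in>half_space. dist w z < e \<longrightarrow> (if fst w < T then \<phi> w else 0) = 0 \<and> (\<forall>v. (if fst w < T then \<phi>' w v else 0) = 0)"
    if zK: "z \<notin> K" for z
  proof -
    obtain e where e: "e > 0" "ball z e \<subseteq> - K"
      using ball_avoiding_compact[OF K(1) zK] by blast
    have "(if fst w < T then \<phi> w else 0) = 0 \<and> (\<forall>v. (if fst w < T then \<phi>' w v else 0) = 0)" if "w \<in> half_space" "dist w z < e" for w
    proof (cases "fst w < T")
      case True
      moreover have "w \<in> ball z e" using that by (simp add: dist_commute)
      ultimately have "w \<in> space_time T UNIV - K" using e(2) that st[of w] by blast
      then show ?thesis using 0 out by simp
    qed simp
    then show ?thesis using e(1) by blast
  qed
  have inS: "z \<in> space_time T UNIV" if "z \<in> K" for z using K(2) that by blast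
  have near: "\<exists>e>0. \<forall>w\<in>half_space. dist w z < e \<longrightarrow> fst w < T" if "z \<in> space_time T UNIV" for z
  proof -
    have "open {w::stpoint. fst w < T}" by (intro open_Collect_less continuous_intros)
    moreover have "z \<in> {w. fst w < T}" using that st by blast
    ultimately obtain e where "e > 0" "ball z e \<subseteq> {w. fst w < T}" unfolding open_contains_ball by blast
    then show ?thesis by (intro exI[of _ e]) (auto simp: dist_commute subset_iff)
  qed
  show ?thesis
    unfolding c1_test_def
  proof (intro conjI ballI allI)
    fix z assume z: "z \<in> half_space"
    show "((\<lambda>z. if fst z < T then \<phi> z else 0) has_derivative (\<lambda>v. if fst z < T then \<phi>' z v else 0)) (at z within half_space)"
    proof (cases "z \<in> K")
      case True
      then have S: "z \<in> space_time T UNIV" by (rule inS)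
      obtain e where e: "e > 0" "\<forall>w\<in>half_space. dist w z < e \<longrightarrow> fst w < T" using near[OF S] by blast
      have "(\<phi> has_derivative \<phi>' z) (at z within half_space)"
        unfolding at_within_half_space[OF S] by (rule der[OF S])
      then have "((\<lambda>z. if fst z < T then \<phi> z else 0) has_derivative \<phi>' z) (at z within half_space)"
        by (rule has_derivative_transform_within[OF _ e(1) z]) (use e(2) in auto)
      moreover have "fst z < T" using S st by blast
      ultimately show ?thesis by simp
    next
      case False
      obtain e where e: "e > 0" "\<forall>w\<in>half_space. dist w z < e \<longrightarrow> (if fst w < T then \<phi> w else 0) = 0 \<and> (\<forall>v. (if fst w < T then \<phi>' w v else 0) = 0)"
        using nbhd[OF False] by blast
      have "((\<lambda>z. 0) has_derivative (\<lambda>v. 0)) (at z within half_space)" by simp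
      then have "((\<lambda>z. if fst z < T then \<phi> z else 0) has_derivative (\<lambda>v. 0)) (at z within half_space)"
        by (rule has_derivative_transform_within[OF _ e(1) z]) (use e(2) in metis)
      moreover have "(if fst z < T then \<phi>' z v else 0) = 0" for v using e z dist_self by metis
      ultimately show ?thesis by (simp only:)
    qed
  next
    fix v
    show "continuous_on half_space (\<lambda>z. if fst z < T then \<phi>' z v else 0)"
      unfolding continuous_on_eq_continuous_within
    proof
      fix z assume z: "z \<in> half_space"
      show "continuous (at z within half_space) (\<lambda>z. if fst z < T then \<phi>' z v else 0)"
      proof (cases "z \<in> K")
        case True
        then have S: "z \<in> space_time T UNIV" by (rule inS)
        obtain e where e: "e > 0" "\<forall>w\<in>half_space. dist w z < e \<longrightarrow> fst w < T" using near[OF S] by blast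
        have "continuous (at z within half_space) (\<lambda>z. \<phi>' z v)"
          unfolding at_within_half_space[OF S] using cont[of v] S unfolding continuous_on_eq_continuous_within by blast
        then show ?thesis
          by (rule continuous_transform_within[OF _ e(1) z]) (use e(2) in auto)
      next
        case False
        obtain e where e: "e > 0" "\<forall>w\<in>half_space. dist w z < e \<longrightarrow> (if fst w < T then \<phi> w else 0) = 0 \<and> (\<forall>v. (if fst w < T then \<phi>' w v else 0) = 0)"
          using nbhd[OF False] by blast
        have "continuous (at z within half_space) (\<lambda>z. 0::real)" by simp
        then show ?thesis
          by (rule continuous_transform_within[OF _ e(1) z]) (use e(2) in metis)
      qed
    qed
  next
    obtain R where R: "K \<subseteq> cball 0 R"
      using bounded_subset_ballD[OF compact_imp_bounded[OF K(1)], of 0] ball_subset_cball by blast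
    show "\<exists>R. \<forall>z\<in>half_space. norm z > R \<longrightarrow> (if fst z < T then \<phi> z else 0) = 0 \<and> (\<forall>v. (if fst z < T then \<phi>' z v else 0) = 0)"
    proof (intro exI[of _ R] ballI impI)
      fix z assume z: "z \<in> half_space" "norm z > R"
      then have "z \<notin> K" using R by auto
      then show "(if fst z < T then \<phi> z else 0) = 0 \<and> (\<forall>v. (if fst z < T then \<phi>' z v else 0) = 0)"
        using nbhd z(1) dist_self by metis
    qed
  qed
qed

lemma time_deriv_eq:
  assumes der: "(\<phi> has_derivative \<phi>') (at z within space_time T UNIV)" and z: "z \<in> space_time T UNIV"
  shows "time_deriv T \<phi> z = \<phi>' (1, 0)"
  unfolding time_deriv_def
proof (rule vector_derivative_within)
  have t: "fst z \<in> {0..<T}" using z by (auto simp: space_time_def)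
  have "fst z islimpt {fst z<..<T}" using t by (intro islimpt_greaterThanLessThan1) auto
  then have "fst z islimpt {0..<T}" by (rule islimpt_subset) (use t in auto)
  then show "at (fst z) within {0..<T} \<noteq> bot" by (simp add: trivial_limit_within)
  have fd: "((\<lambda>s. (s, snd z)) has_derivative (\<lambda>h. (h, 0))) (at (fst z) within {0..<T})"
    by (auto intro!: derivative_eq_intros)
  have sub: "(\<lambda>s. (s, snd z)) ` {0..<T} \<subseteq> space_time T UNIV" by (auto simp: space_time_def)
  have "(\<phi> has_derivative \<phi>') (at (fst z, snd z) within (\<lambda>s. (s, snd z)) ` {0..<T})"
    using has_derivative_subset[OF der sub] by simp
  from has_derivative_in_compose[OF fd this]
  have D: "((\<lambda>s. \<phi> (s, snd z)) has_derivative (\<lambda>h. \<phi>' (h, 0))) (at (fst z) within {0..<T})" .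
  have eq: "(\<lambda>h. \<phi>' (h, 0)) = (\<lambda>h. h *\<^sub>R \<phi>' (1, 0))"
  proof
    show "\<phi>' (h, 0) = h *\<^sub>R \<phi>' (1, 0)" for h
      using linear_scale[OF has_derivative_linear[OF der], of h "(1, 0)"] by simp
  qed
  show "((\<lambda>s. \<phi> (s, snd z)) has_vector_derivative \<phi>' (1, 0)) (at (fst z) within {0..<T})"
    using D unfolding has_vector_derivative_def eq .
qed

lemma space_slice_derivative:
  assumes der: "(\<phi> has_derivative \<phi>') (at z within space_time T UNIV)" and z: "z \<in> space_time T UNIV"
  shows "((\<lambda>x. \<phi> (fst z, x)) has_derivative (\<lambda>h. \<phi>' (0, h))) (at (snd z))"
proof -
  have fd: "((\<lambda>x. (fst z, x)) has_derivative (\<lambda>h. (0, h))) (at (snd z) within UNIV)"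
    by (auto intro!: derivative_eq_intros)
  have sub: "(\<lambda>x. (fst z, x)) ` UNIV \<subseteq> space_time T UNIV" using z by (auto simp: space_time_def)
  have "(\<phi> has_derivative \<phi>') (at (fst z, snd z) within (\<lambda>x. (fst z, x)) ` UNIV)"
    using has_derivative_subset[OF der sub] by simp
  from has_derivative_in_compose[OF fd this] show ?thesis .
qed

lemma space_deriv_eq:
  assumes "(\<phi> has_derivative \<phi>') (at z within space_time T UNIV)" "z \<in> space_time T UNIV"
  shows "space_deriv i \<phi> z = \<phi>' (0, axis i 1)"
  unfolding space_deriv_def using frechet_derivative_at[OF space_slice_derivative[OF assms]] by metis

lemma c1_test_time_integral:
  assumes t: "c1_test \<phi> \<phi>'" and Q: "open Q"
  shows "integrable lborel (\<lambda>z. indicator Q (snd z) * (indicator half_space z * \<phi>' z (1, 0)))"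
    "integrable lborel (\<lambda>x. indicator Q x * \<phi> (0, x))"
    "(LINT z|lborel. indicator Q (snd z) * (indicator half_space z * \<phi>' z (1, 0))) = - (LINT x|lborel. indicator Q x * \<phi> (0, x))"
proof -
  obtain R where R: "\<And>z. z \<in> half_space \<Longrightarrow> norm z > R \<Longrightarrow> \<phi> z = 0 \<and> (\<forall>v. \<phi>' z v = 0)"
    using t unfolding c1_test_def by blast
  have i: "integrable lborel (\<lambda>z. indicator half_space z * \<phi>' z (1, 0))"
    by (rule integrable_half_space[OF c1_test_D(4)[OF t]]) (use R in blast)
  have "open {z::stpoint. snd z \<in> Q}" using open_vimage_snd[OF Q] by (simp add: vimage_def)
  then have mQ: "{z::stpoint. snd z \<in> Q} \<in> sets lborel" by simp
  have "integrable lborel (\<lambda>z. indicator {z::stpoint. snd z \<in> Q} z *\<^sub>R (indicator half_space z * \<phi>' z (1, 0)))"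
    by (rule integrable_mult_indicator[OF mQ i])
  moreover have "indicator {z::stpoint. snd z \<in> Q} z *\<^sub>R r = indicator Q (snd z) * r" for z and r :: real by (simp add: indicator_def)
  ultimately show I: "integrable lborel (\<lambda>z. indicator Q (snd z) * (indicator half_space z * \<phi>' z (1, 0)))" by (simp only:)
  have i0: "integrable lborel (\<lambda>x. \<phi> (0, x))"
  proof (rule integrable_continuous_bounded_support[of _ "cball 0 R"])
    show "continuous_on UNIV (\<lambda>x. \<phi> (0, x))"
      by (intro continuous_intros continuous_on_compose2[OF c1_test_D(1)[OF t]]) auto
    show "\<phi> (0, x) = 0" if "x \<notin> cball 0 R" for x using R[of "(0, x)"] that by (simp add: norm_Pair)
  qed auto
  show I0: "integrable lborel (\<lambda>x. indicator Q x * \<phi> (0, x))"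
    using integrable_mult_indicator[OF _ i0, of Q] Q by simp
  have line: "((\<lambda>s. indicator half_space (s, x) * \<phi>' (s, x) (1, 0)) has_integral (- \<phi> (0, x))) UNIV" for x
  proof -
    define B where "B = \<bar>R\<bar> + 1"
    have big: "norm (s, x) > R" if "s \<ge> B" for s
      using that norm_fst_le[of s x] by (simp add: B_def)
    have "((\<lambda>s. \<phi>' (s, x) (1, 0)) has_integral (\<phi> (B, x) - \<phi> (0, x))) {0..B}"
    proof (rule fundamental_theorem_of_calculus)
      fix s assume s: "s \<in> {0..B}"
      have hs: "(s, x) \<in> half_space" using s by simp
      have fd: "((\<lambda>s. (s, x)) has_derivative (\<lambda>h. (h, 0))) (at s within {0..B})"
        by (auto intro!: derivative_eq_intros)
      have D: "((\<lambda>s. \<phi> (s, x)) has_derivative (\<lambda>h. \<phi>' (s, x) (h, 0))) (at s within {0..B})"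
        by (rule has_derivative_in_compose2[OF c1_test_D(3)[OF t] _ s fd]) auto
      have eq: "(\<lambda>h. \<phi>' (s, x) (h, 0)) = (\<lambda>h. h *\<^sub>R \<phi>' (s, x) (1, 0))"
      proof
        show "\<phi>' (s, x) (h, 0) = h *\<^sub>R \<phi>' (s, x) (1, 0)" for h
          using linear_scale[OF c1_test_D(2)[OF t hs], of h "(1, 0)"] by simp
      qed
      show "((\<lambda>s. \<phi> (s, x)) has_vector_derivative \<phi>' (s, x) (1, 0)) (at s within {0..B})"
        using D unfolding has_vector_derivative_def eq .
    qed (simp add: B_def)
    moreover have "\<phi> (B, x) = 0" using R[of "(B, x)"] big[of B] by (simp add: B_def)
    ultimately have "((\<lambda>s. \<phi>' (s, x) (1, 0)) has_integral (- \<phi> (0, x))) {0..B}" by simp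
    then have "((\<lambda>s. indicator half_space (s, x) * \<phi>' (s, x) (1, 0)) has_integral (- \<phi> (0, x))) {0..B}"
      by (rule has_integral_eq[rotated]) simp
    then show ?thesis
    proof (rule has_integral_on_superset)
      fix s assume "s \<notin> {0..B}"
      then show "indicator half_space (s, x) * \<phi>' (s, x) (1, 0) = 0"
        using R[of "(s, x)"] big[of s] by (cases "s < 0") auto
    qed auto
  qed
  have ip: "integrable (lborel \<Otimes>\<^sub>M lborel) (\<lambda>(s, x). indicator Q x * (indicator half_space (s, x) * \<phi>' (s, x) (1, 0)))"
    using I by (simp add: lborel_prod case_prod_unfold)
  have "(LINT z|lborel. indicator Q (snd z) * (indicator half_space z * \<phi>' z (1, 0)))
      = (LINT x|lborel. LINT s|lborel. indicator Q x * (indicator half_space (s, x) * \<phi>' (s, x) (1, 0)))"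
    using lborel_pair.integral_snd[OF ip] by (simp add: lborel_prod case_prod_unfold)
  also have "\<dots> = (LINT x|lborel. - (indicator Q x * \<phi> (0, x)))"
  proof (rule integral_cong_AE)
    show "(\<lambda>x. LINT s|lborel. indicator Q x * (indicator half_space (s, x) * \<phi>' (s, x) (1, 0))) \<in> borel_measurable lborel"
      using lborel_pair.integrable_snd[OF ip] by (rule borel_measurable_integrable)
    show "(\<lambda>x. - (indicator Q x * \<phi> (0, x))) \<in> borel_measurable lborel"
      using borel_measurable_integrable[OF I0] by (rule borel_measurable_uminus)
    show "AE x in lborel. (LINT s|lborel. indicator Q x * (indicator half_space (s, x) * \<phi>' (s, x) (1, 0))) = - (indicator Q x * \<phi> (0, x))"
      using lborel_pair.AE_integrable_snd[OF ip]
    proof (rule eventually_mono)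
      fix x assume ix: "integrable lborel (\<lambda>s. indicator Q x * (indicator half_space (s, x) * \<phi>' (s, x) (1, 0)))"
      have "((\<lambda>s. indicator Q x * (indicator half_space (s, x) * \<phi>' (s, x) (1, 0))) has_integral (indicator Q x * - \<phi> (0, x))) UNIV"
        by (rule has_integral_mult_right[OF line])
      from has_integral_unique[OF has_integral_integral_lborel[OF ix] this]
      show "(LINT s|lborel. indicator Q x * (indicator half_space (s, x) * \<phi>' (s, x) (1, 0))) = - (indicator Q x * \<phi> (0, x))" by simp
    qed
  qed
  finally show "(LINT z|lborel. indicator Q (snd z) * (indicator half_space z * \<phi>' z (1, 0))) = - (LINT x|lborel. indicator Q x * \<phi> (0, x))"
    by simp
qed

lemma c1_test_coords:
  assumes "c1_test \<phi> \<phi>'" "z \<in> half_space"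
  shows "\<phi>' z y = fst y * \<phi>' z (1, 0) + snd y $ 1 * \<phi>' z (0, axis 1 1) + snd y $ 2 * \<phi>' z (0, axis 2 1)"
proof -
  have "\<phi>' z y = (\<Sum>v\<in>{st_dir 0, st_dir 1, st_dir 2}. (y \<bullet> v) * \<phi>' z v)"
    using c1_test_pairing[OF assms, of y] unfolding Basis_stpoint .
  also have "\<dots> = (y \<bullet> st_dir 0) * \<phi>' z (st_dir 0) + (y \<bullet> st_dir 1) * \<phi>' z (st_dir 1) + (y \<bullet> st_dir 2) * \<phi>' z (st_dir 2)"
    using st_dir_distinct by simp
  finally show ?thesis by (simp add: st_dir_def inner_stpoint axis_def)
qed

lemma integrable_c1_test_times:
  assumes t: "c1_test \<phi> \<phi>'" and h: "h \<in> borel_measurable lborel" and B: "AE z in lborel. z \<in> half_space \<longrightarrow> \<bar>h z\<bar> \<le> B"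
  shows "integrable lborel (\<lambda>z. indicator half_space z * (h z * \<phi>' z v))"
proof -
  obtain R where R: "\<And>z. z \<in> half_space \<Longrightarrow> norm z > R \<Longrightarrow> \<phi> z = 0 \<and> (\<forall>v. \<phi>' z v = 0)"
    using t unfolding c1_test_def by blast
  have i: "integrable lborel (\<lambda>z. indicator half_space z * \<phi>' z v)"
    by (rule integrable_half_space[OF c1_test_D(4)[OF t]]) (use R in blast)
  have eq: "indicator half_space z * (h z * \<phi>' z v) = h z * (indicator half_space z * \<phi>' z v)" for z by simp
  show ?thesis
    unfolding eq
  proof (rule Bochner_Integration.integrable_bound[of lborel "\<lambda>z. B * (indicator half_space z * \<phi>' z v)"])
    show "integrable lborel (\<lambda>z. B * (indicator half_space z * \<phi>' z v))" using i by simp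
    show "(\<lambda>z. h z * (indicator half_space z * \<phi>' z v)) \<in> borel_measurable lborel"
      by (intro borel_measurable_times h borel_measurable_integrable[OF i])
    show "AE z in lborel. norm (h z * (indicator half_space z * \<phi>' z v)) \<le> norm (B * (indicator half_space z * \<phi>' z v))"
      using B
    proof (rule eventually_mono)
      fix z assume b: "z \<in> half_space \<longrightarrow> \<bar>h z\<bar> \<le> B"
      show "norm (h z * (indicator half_space z * \<phi>' z v)) \<le> norm (B * (indicator half_space z * \<phi>' z v))"
      proof (cases "z \<in> half_space")
        case True
        then have "\<bar>h z\<bar> \<le> \<bar>B\<bar>" using b by linarith
        then show ?thesis unfolding real_norm_def abs_mult[of "h z"] abs_mult[of B] by (rule mult_right_mono) simp
      qed simp
    qed
  qed
qed


subsection \<open>Assembling the pieces\<close>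

lemma c1_test_component:
  fixes \<Phi> :: "stpoint \<Rightarrow> real^2"
  assumes T: "T > 0"
    and der: "\<And>z. z \<in> space_time T UNIV \<Longrightarrow> (\<Phi> has_derivative \<Phi>' z) (at z within space_time T UNIV)"
    and cont: "\<And>v. continuous_on (space_time T UNIV) (\<lambda>z. \<Phi>' z v)"
    and K: "compact K" "K \<subseteq> space_time T UNIV" and 0: "\<And>z. z \<in> space_time T UNIV - K \<Longrightarrow> \<Phi> z = 0"
  shows "c1_test (\<lambda>z. if fst z < T then \<Phi> z $ i else 0) (\<lambda>z v. if fst z < T then \<Phi>' z v $ i else 0)"
proof (rule c1_test_extend[OF T _ _ K])
  show "((\<lambda>z. \<Phi> z $ i) has_derivative (\<lambda>v. \<Phi>' z v $ i)) (at z within space_time T UNIV)"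
    if "z \<in> space_time T UNIV" for z
    by (rule bounded_linear.has_derivative[OF bounded_linear_vec_nth der[OF that]])
  show "continuous_on (space_time T UNIV) (\<lambda>z. \<Phi>' z v $ i)" for v by (intro continuous_intros cont)
  show "\<Phi> z $ i = 0" if "z \<in> space_time T UNIV - K" for z using 0[OF that] by simp
qed

text \<open>Fubini in time: on each slice before T the field is tangential, so its divergence
  integrates to zero over \<Omega>.\<close>

lemma space_time_divergence:
  fixes \<Phi> :: "stpoint \<Rightarrow> real^2"
  assumes \<Omega>: "open \<Omega>" "bounded \<Omega>" and T: "T > 0"
    and der: "\<And>z. z \<in> space_time T UNIV \<Longrightarrow> (\<Phi> has_derivative \<Phi>' z) (at z within space_time T UNIV)"
    and cont: "\<And>v. continuous_on (space_time T UNIV) (\<lambda>z. \<Phi>' z v)"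
    and K: "compact K" "K \<subseteq> space_time T UNIV" and 0: "\<And>z. z \<in> space_time T UNIV - K \<Longrightarrow> \<Phi> z = 0"
    and tang: "tangential_on_boundary T \<Omega> \<Phi>"
  defines "dv \<equiv> \<lambda>z. indicator \<Omega> (snd z) * (indicator half_space z *
    (if fst z < T then \<Phi>' z (0, axis 1 1) $ 1 + \<Phi>' z (0, axis 2 1) $ 2 else 0))"
  shows "integrable lborel dv" "(LINT z|lborel. dv z) = 0"
proof -
  note t = c1_test_component[OF T der cont K 0]
  define g where "g = (\<lambda>z. (if fst z < T then \<Phi>' z (0, axis 1 1) $ 1 else 0) + (if fst z < T then \<Phi>' z (0, axis 2 1) $ 2 else 0))"
  have cg: "continuous_on half_space g" unfolding g_def
    using c1_test_D(4)[OF t[of 1], of "(0, axis 1 1)"] c1_test_D(4)[OF t[of 2], of "(0, axis 2 1)"] by (rule continuous_on_add)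
  have st: "z \<in> space_time T UNIV \<longleftrightarrow> z \<in> half_space \<and> fst z < T" for z by (auto simp: space_time_def mem_Times_iff)
  obtain R where R: "K \<subseteq> cball 0 R"
    using bounded_subset_ballD[OF compact_imp_bounded[OF K(1)], of 0] ball_subset_cball by blast
  have out: "\<Phi>' z v = 0" if z: "z \<in> space_time T UNIV - K" for z v
  proof -
    show ?thesis using test_derivative_outside[OF der K(1) 0 z] .
  qed
  have i: "integrable lborel (\<lambda>z. indicator half_space z * g z)"
  proof (rule integrable_half_space[OF cg])
    fix z assume z: "z \<in> half_space" "norm z > R"
    then have "z \<notin> K" using R by auto
    then show "g z = 0" using out[of z] st[of z] z(1) by (simp add: g_def)
  qed
  have dv: "dv z = indicator \<Omega> (snd z) * (indicator half_space z * g z)" for z by (simp add: dv_def g_def)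
  have "open {z::stpoint. snd z \<in> \<Omega>}" using open_vimage_snd[OF \<Omega>(1)] by (simp add: vimage_def)
  then have mQ: "{z::stpoint. snd z \<in> \<Omega>} \<in> sets lborel" by simp
  have "integrable lborel (\<lambda>z. indicator {z::stpoint. snd z \<in> \<Omega>} z *\<^sub>R (indicator half_space z * g z))"
    by (rule integrable_mult_indicator[OF mQ i])
  moreover have "indicator {z::stpoint. snd z \<in> \<Omega>} z *\<^sub>R r = indicator \<Omega> (snd z) * r" for z and r :: real by (simp add: indicator_def)
  ultimately show I: "integrable lborel dv" unfolding dv by (simp only:)
  have ip: "integrable (lborel \<Otimes>\<^sub>M lborel) (\<lambda>(s, x). dv (s, x))" using I by (simp add: lborel_prod)
  have "(LINT z|lborel. dv z) = (LINT s|lborel. LINT x|lborel. dv (s, x))"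
    using lborel_pair.integral_fst[OF ip] by (simp add: lborel_prod)
  also have "\<dots> = (LINT s::real|lborel. 0)"
  proof (rule Bochner_Integration.integral_cong[OF refl])
    fix s :: real
    show "(LINT x|lborel. dv (s, x)) = 0"
    proof (cases "0 \<le> s \<and> s < T")
      case True
      have S: "(s, x) \<in> space_time T UNIV" for x using True by (simp add: space_time_def)
      have big: "(s, x) \<in> space_time T UNIV - K" if "norm x > R" for x
      proof -
        have "norm (s, x) > R" using that norm_snd_le[of x s] by linarith
        then have "(s, x) \<notin> K" using R by auto
        then show ?thesis using S by blast
      qed
      have "(LINT x|lborel. indicator \<Omega> x * (\<Phi>' (s, x) (0, axis 1 1) $ 1 + \<Phi>' (s, x) (0, axis 2 1) $ 2)) = 0"
      proof (rule integral_divergence_tangential[OF \<Omega>, where \<Phi> = "\<lambda>x. \<Phi> (s, x)" and \<Phi>' = "\<lambda>x v. \<Phi>' (s, x) (0, v)" and R = R])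
        show "((\<lambda>x. \<Phi> (s, x)) has_derivative (\<lambda>v. \<Phi>' (s, x) (0, v))) (at x)" for x
          using space_slice_derivative[OF der[OF S] S] by simp
        show "continuous_on UNIV (\<lambda>x. \<Phi>' (s, x) (0, v))" for v
          by (rule continuous_on_compose2[OF cont]) (use S in \<open>auto intro!: continuous_intros\<close>)
        show "\<Phi> (s, x) = 0" if "norm x > R" for x using 0[OF big[OF that]] .
        show "\<Phi>' (s, x) (0, v) = 0" if "norm x > R" for x v using out[OF big[OF that]] .
        show "\<Phi> (s, x) \<bullet> \<nu> = 0" if "outward_unit_normal \<Omega> x \<nu>" for x \<nu>
          using tang True that unfolding tangential_on_boundary_def by auto
      qed
      then show ?thesis using True by (simp add: dv_def)
    next
      case False
      then have "dv (s, x) = 0" for x by (auto simp: dv_def)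
      then show ?thesis by simp
    qed
  qed
  finally show "(LINT z|lborel. dv z) = 0" by simp
qed

definition cvec :: "complex \<Rightarrow> real^2" where
  "cvec w = vector [Re w, Im w]"

lemma cvec_nth [simp]: "cvec w $ 1 = Re w" "cvec w $ 2 = Im w"
  by (simp_all add: cvec_def)

lemma norm_cvec: "norm (cvec w) = norm w"
  by (simp add: norm_eq_sqrt_inner inner_vec_def sum_2 inner_complex_def)

lemma cvec_eq_iff: "cvec w = cvec w' \<longleftrightarrow> w = w'"
  by (simp add: vec_eq_iff forall_2 complex_eq_iff)

lemma cvec_0 [simp]: "cvec 0 = 0"
  by (simp add: vec_eq_iff forall_2)

lemma measurable_cvec: "f \<in> borel_measurable M \<Longrightarrow> (\<lambda>z. cvec (f z)) \<in> borel_measurable M"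
proof -
  have "linear cvec" by (rule linearI) (simp_all add: vec_eq_iff forall_2)
  then have "cvec \<in> borel_measurable borel"
    by (intro borel_measurable_continuous_onI linear_continuous_on) (simp add: linear_conv_bounded_linear)
  then show "f \<in> borel_measurable M \<Longrightarrow> ?thesis" using measurable_compose by blast
qed

lemma L_infty_lebesgue_on:
  fixes f :: "'a::euclidean_space \<Rightarrow> 'b::{real_normed_vector, second_countable_topology}"
  assumes S: "S \<in> sets borel" and f: "f \<in> borel_measurable lborel" and C: "AE x in lborel. x \<in> S \<longrightarrow> norm (f x) \<le> C"
  shows "L_infty (lebesgue_on S) f"
proof -
  have S': "S \<inter> space lebesgue \<in> sets lebesgue" using S by simp
  have "f \<in> borel_measurable (lebesgue_on S)"
    by (rule measurable_restrict_space1[OF measurable_completion[OF f]])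
  moreover have "AE x in lebesgue_on S. norm (f x) \<le> C"
    unfolding AE_restrict_space_iff[OF S'] AE_completion_iff using C .
  ultimately show ?thesis unfolding L_infty_def by blast
qed

locale wild_pieces =
  fixes T :: real and \<Omega> :: "(real^2) set" and n :: nat and Q :: "nat \<Rightarrow> (real^2) set" and e :: "nat \<Rightarrow> real"
    and W :: "nat \<Rightarrow> stpoint \<Rightarrow> complex" and U0 :: "nat \<Rightarrow> real^2 \<Rightarrow> complex"
  assumes T: "T > 0" and \<Omega>: "open \<Omega>" "bounded \<Omega>"
    and Q: "\<And>i. i < n \<Longrightarrow> open (Q i)" "\<And>i. i < n \<Longrightarrow> Q i \<subseteq> \<Omega>" "disjoint_family_on Q {..<n}"
    and cover: "negligible (\<Omega> - (\<Union>i<n. Q i))"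
    and e: "\<And>i. i < n \<Longrightarrow> e i > 0"
    and U0: "\<And>i. i < n \<Longrightarrow> U0 i \<in> borel_measurable lborel" "\<And>i x. i < n \<Longrightarrow> x \<notin> Q i \<Longrightarrow> U0 i x = 0"
      "\<And>i. i < n \<Longrightarrow> AE x in lborel. x \<in> Q i \<longrightarrow> (norm (U0 i x))\<^sup>2 = 2 * e i"
    and W: "\<And>i. i < n \<Longrightarrow> W i \<in> borel_measurable lborel" "\<And>i z. i < n \<Longrightarrow> snd z \<notin> Q i \<or> T \<le> fst z \<Longrightarrow> W i z = 0"
      "\<And>i. i < n \<Longrightarrow> AE z in lborel. 0 \<le> fst z \<and> fst z < T \<and> snd z \<in> Q i \<longrightarrow> (norm (W i z))\<^sup>2 = 2 * e i"
      "\<And>i. i < n \<Longrightarrow> weak_euler (W i) (U0 i)"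
begin

definition step_fun :: "(nat \<Rightarrow> real) \<Rightarrow> real^2 \<Rightarrow> real" where
  "step_fun c x = (\<Sum>i<n. indicator (Q i) x * c i)"

text \<open>At each point at most one summand is nonzero. The summands can simply be added, because
  each carries zero flux through the boundary of its own piece.\<close>

definition vel :: "stpoint \<Rightarrow> real^2" where
  "vel z = cvec (\<Sum>i<n. W i z)"

definition vel0 :: "real^2 \<Rightarrow> real^2" where
  "vel0 x = cvec (\<Sum>i<n. U0 i x)"

lemma only_piece:
  fixes f :: "nat \<Rightarrow> 'a::comm_monoid_add"
  assumes i: "i < n" "x \<in> Q i" and f: "\<And>k. k < n \<Longrightarrow> x \<notin> Q k \<Longrightarrow> f k = 0"
  shows "(\<Sum>k<n. f k) = f i"
proof -
  have "f k = 0" if "k \<in> {..<n} - {i}" for k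
  proof (rule f)
    show "x \<notin> Q k" using that i Q(3) unfolding disjoint_family_on_def by blast
  qed (use that in simp)
  then show ?thesis using i(1) by (simp add: sum.remove[of "{..<n}" i])
qed

lemma step_fun_piece: "i < n \<Longrightarrow> x \<in> Q i \<Longrightarrow> step_fun c x = c i"
  unfolding step_fun_def by (subst only_piece[of i x]) auto

lemma vel_piece: "i < n \<Longrightarrow> snd z \<in> Q i \<Longrightarrow> vel z = cvec (W i z)"
  unfolding vel_def using W(2) by (subst only_piece[of i "snd z"]) auto

lemma vel0_piece: "i < n \<Longrightarrow> x \<in> Q i \<Longrightarrow> vel0 x = cvec (U0 i x)"
  unfolding vel0_def using U0(2) by (subst only_piece[of i x]) auto

lemma AE_pieces: "AE x in lborel. x \<in> \<Omega> \<longrightarrow> (\<exists>i<n. x \<in> Q i)"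
proof -
  have o: "\<Omega> - (\<Union>i<n. Q i) \<in> sets borel" using \<Omega>(1) Q(1) by (intro sets.Diff borel_open open_UN) auto
  have "\<Omega> - (\<Union>i<n. Q i) \<in> null_sets lborel"
    using cover o unfolding negligible_iff_null_sets by (subst (asm) null_sets_completion_iff) auto
  then have "AE x in lborel. x \<notin> \<Omega> - (\<Union>i<n. Q i)" by (rule AE_not_in)
  then show ?thesis by (rule eventually_mono) auto
qed

lemma W_bound: "i < n \<Longrightarrow> AE z in lborel. z \<in> half_space \<longrightarrow> (norm (W i z))\<^sup>2 \<le> 2 * e i"
  using W(3)[of i]
proof (rule eventually_mono)
  fix z assume i: "i < n" and h: "0 \<le> fst z \<and> fst z < T \<and> snd z \<in> Q i \<longrightarrow> (norm (W i z))\<^sup>2 = 2 * e i"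
  show "z \<in> half_space \<longrightarrow> (norm (W i z))\<^sup>2 \<le> 2 * e i"
    using h W(2)[OF i, of z] e[OF i] by (cases "fst z < T \<and> snd z \<in> Q i") auto
qed

lemma integrable_W_terms:
  assumes t: "c1_test \<phi> \<phi>'" and i: "i < n"
  shows "integrable lborel (\<lambda>z. indicator half_space z * (Re (W i z) * \<phi>' z v))"
    "integrable lborel (\<lambda>z. indicator half_space z * (Im (W i z) * \<phi>' z v))"
    "integrable lborel (\<lambda>z. indicator half_space z * (Re ((W i z)\<^sup>2 / 2) * \<phi>' z v))"
    "integrable lborel (\<lambda>z. indicator half_space z * (Im ((W i z)\<^sup>2 / 2) * \<phi>' z v))"
proof -
  have m2: "(\<lambda>z. (W i z)\<^sup>2 / 2) \<in> borel_measurable lborel"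
    using W(1)[OF i] by (intro borel_measurable_divide borel_measurable_power) auto
  have Rem: "Re \<in> borel_measurable borel" and Imm: "Im \<in> borel_measurable borel"
    by (intro borel_measurable_continuous_onI continuous_intros)+
  have b1: "AE z in lborel. z \<in> half_space \<longrightarrow> norm (W i z) \<le> sqrt (2 * e i)"
    using W_bound[OF i] by (rule eventually_mono) (use real_le_rsqrt in blast)
  have b2: "AE z in lborel. z \<in> half_space \<longrightarrow> norm ((W i z)\<^sup>2 / 2) \<le> e i"
    using W_bound[OF i] by (rule eventually_mono) (simp add: norm_divide norm_power mult.commute)
  show "integrable lborel (\<lambda>z. indicator half_space z * (Re (W i z) * \<phi>' z v))"
    by (rule integrable_c1_test_times[OF t measurable_compose[OF W(1)[OF i] Rem]])
      (use b1 in eventually_elim, use abs_Re_le_cmod order_trans in blast)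
  show "integrable lborel (\<lambda>z. indicator half_space z * (Im (W i z) * \<phi>' z v))"
    by (rule integrable_c1_test_times[OF t measurable_compose[OF W(1)[OF i] Imm]])
      (use b1 in eventually_elim, use abs_Im_le_cmod order_trans in blast)
  show "integrable lborel (\<lambda>z. indicator half_space z * (Re ((W i z)\<^sup>2 / 2) * \<phi>' z v))"
    by (rule integrable_c1_test_times[OF t measurable_compose[OF m2 Rem]])
      (use b2 in eventually_elim, use abs_Re_le_cmod order_trans in blast)
  show "integrable lborel (\<lambda>z. indicator half_space z * (Im ((W i z)\<^sup>2 / 2) * \<phi>' z v))"
    by (rule integrable_c1_test_times[OF t measurable_compose[OF m2 Imm]])
      (use b2 in eventually_elim, use abs_Im_le_cmod order_trans in blast)
qed

lemma integrable_U0_terms: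
  assumes t: "c1_test \<phi> \<phi>'" and i: "i < n"
  shows "integrable lborel (\<lambda>x. Re (U0 i x) * \<phi> (0, x))" "integrable lborel (\<lambda>x. Im (U0 i x) * \<phi> (0, x))"
proof -
  have i0: "integrable lborel (\<lambda>x. \<phi> (0, x))" using c1_test_time_integral(2)[OF t open_UNIV] by simp
  have Rem: "Re \<in> borel_measurable borel" and Imm: "Im \<in> borel_measurable borel"
    by (intro borel_measurable_continuous_onI continuous_intros)+
  have b: "AE x in lborel. norm (U0 i x) \<le> sqrt (2 * e i)"
    using U0(3)[OF i]
  proof (rule eventually_mono)
    fix x assume h: "x \<in> Q i \<longrightarrow> (norm (U0 i x))\<^sup>2 = 2 * e i"
    show "norm (U0 i x) \<le> sqrt (2 * e i)"
      using h U0(2)[OF i, of x] e[OF i] by (cases "x \<in> Q i") (auto intro: real_le_rsqrt)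
  qed
  have *: "integrable lborel (\<lambda>x. h x * \<phi> (0, x))"
    if h: "h \<in> borel_measurable lborel" "\<And>x. \<bar>h x\<bar> \<le> norm (U0 i x)" for h
  proof (rule Bochner_Integration.integrable_bound[of lborel "\<lambda>x. sqrt (2 * e i) * \<phi> (0, x)"])
    show "integrable lborel (\<lambda>x. sqrt (2 * e i) * \<phi> (0, x))" using i0 by simp
    show "(\<lambda>x. h x * \<phi> (0, x)) \<in> borel_measurable lborel"
      by (intro borel_measurable_times h borel_measurable_integrable[OF i0])
    show "AE x in lborel. norm (h x * \<phi> (0, x)) \<le> norm (sqrt (2 * e i) * \<phi> (0, x))"
      using b
    proof (rule eventually_mono)
      fix x assume "norm (U0 i x) \<le> sqrt (2 * e i)"
      then have "\<bar>h x\<bar> \<le> \<bar>sqrt (2 * e i)\<bar>" using h(2)[of x] by linarith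
      then show "norm (h x * \<phi> (0, x)) \<le> norm (sqrt (2 * e i) * \<phi> (0, x))"
        unfolding real_norm_def abs_mult[of "h x"] abs_mult[of "sqrt (2 * e i)"] by (rule mult_right_mono) simp
    qed
  qed
  show "integrable lborel (\<lambda>x. Re (U0 i x) * \<phi> (0, x))"
    by (rule *[OF measurable_compose[OF U0(1)[OF i] Rem] abs_Re_le_cmod])
  show "integrable lborel (\<lambda>x. Im (U0 i x) * \<phi> (0, x))"
    by (rule *[OF measurable_compose[OF U0(1)[OF i] Imm] abs_Im_le_cmod])
qed

lemma pairing_identities:
  assumes t: "c1_test \<phi> \<phi>'" and i: "i < n"
  defines "Y \<equiv> \<lambda>z. (W i z, (W i z)\<^sup>2 / 2)"
  shows "integrable lborel (\<lambda>z. indicator half_space z * \<phi>' z (momentum1_field (Y z)))"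
    "integrable lborel (\<lambda>z. indicator half_space z * \<phi>' z (momentum2_field (Y z)))"
    "integrable lborel (\<lambda>z. indicator half_space z * \<phi>' z (velocity_field (Y z)))"
    "(LINT z|lborel. indicator half_space z * \<phi>' z (momentum1_field (Y z))) = - (LINT x|lborel. Re (U0 i x) * \<phi> (0, x))"
    "(LINT z|lborel. indicator half_space z * \<phi>' z (momentum2_field (Y z))) = - (LINT x|lborel. Im (U0 i x) * \<phi> (0, x))"
    "(LINT z|lborel. indicator half_space z * \<phi>' z (velocity_field (Y z))) = 0"
proof -
  have co: "indicator half_space z * \<phi>' z y = indicator half_space z * (fst y * \<phi>' z (1, 0))
      + (indicator half_space z * (snd y $ 1 * \<phi>' z (0, axis 1 1)) + indicator half_space z * (snd y $ 2 * \<phi>' z (0, axis 2 1)))" for z y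
    using c1_test_coords[OF t, of z y] by (cases "z \<in> half_space") auto
  note I = integrable_W_terms[OF t i]
  have a: "indicator half_space z * \<phi>' z (momentum1_field (Y z)) = indicator half_space z * (Re (W i z) * \<phi>' z (1, 0))
      + (indicator half_space z * (Re ((W i z)\<^sup>2 / 2) * \<phi>' z (0, axis 1 1)) + indicator half_space z * (Im ((W i z)\<^sup>2 / 2) * \<phi>' z (0, axis 2 1)))" for z
    by (subst co) (simp add: momentum1_field_def Y_def)
  have b: "indicator half_space z * \<phi>' z (momentum2_field (Y z)) = indicator half_space z * (Im (W i z) * \<phi>' z (1, 0))
      + (indicator half_space z * (Im ((W i z)\<^sup>2 / 2) * \<phi>' z (0, axis 1 1)) + (- 1) * (indicator half_space z * (Re ((W i z)\<^sup>2 / 2) * \<phi>' z (0, axis 2 1))))" for z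
    by (subst co) (simp add: momentum2_field_def Y_def)
  have c: "indicator half_space z * \<phi>' z (velocity_field (Y z)) = indicator half_space z * (Re (W i z) * \<phi>' z (0, axis 1 1)) + indicator half_space z * (Im (W i z) * \<phi>' z (0, axis 2 1))" for z
    by (subst co) (simp add: velocity_field_def Y_def)
  show "integrable lborel (\<lambda>z. indicator half_space z * \<phi>' z (momentum1_field (Y z)))"
    unfolding a by (intro Bochner_Integration.integrable_add I)
  show "integrable lborel (\<lambda>z. indicator half_space z * \<phi>' z (momentum2_field (Y z)))"
    unfolding b by (intro Bochner_Integration.integrable_add integrable_mult_right I)
  show "integrable lborel (\<lambda>z. indicator half_space z * \<phi>' z (velocity_field (Y z)))"
    unfolding c by (intro Bochner_Integration.integrable_add I)
  have w: "weak_identity (\<lambda>z. momentum1_field (Y z)) (\<lambda>x. momentum1_field (U0 i x, (U0 i x)\<^sup>2 / 2))"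
    "weak_identity (\<lambda>z. momentum2_field (Y z)) (\<lambda>x. momentum2_field (U0 i x, (U0 i x)\<^sup>2 / 2))"
    "weak_identity (\<lambda>z. velocity_field (Y z)) (\<lambda>x. velocity_field (U0 i x, (U0 i x)\<^sup>2 / 2))"
    using W(4)[OF i] unfolding weak_euler_def Y_def by auto
  show "(LINT z|lborel. indicator half_space z * \<phi>' z (momentum1_field (Y z))) = - (LINT x|lborel. Re (U0 i x) * \<phi> (0, x))"
    using w(1)[unfolded weak_identity_def, rule_format, OF t] by (simp add: momentum1_field_def)
  show "(LINT z|lborel. indicator half_space z * \<phi>' z (momentum2_field (Y z))) = - (LINT x|lborel. Im (U0 i x) * \<phi> (0, x))"
    using w(2)[unfolded weak_identity_def, rule_format, OF t] by (simp add: momentum2_field_def)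
  show "(LINT z|lborel. indicator half_space z * \<phi>' z (velocity_field (Y z))) = 0"
    using w(3)[unfolded weak_identity_def, rule_format, OF t] by (simp add: velocity_field_def)
qed

text \<open>The time part cancels against the datum by itself, and the flux part vanishes because
  the velocity is weakly divergence-free on each piece. Hence the coefficients \<alpha> and \<beta>
  are independent of each other, which the energy balance exploits: energy density and energy flux
  have different factors.\<close>

lemma scalar_balance:
  assumes test: "test_function T \<phi>"
    and F: "\<And>i. i < n \<Longrightarrow> AE z in lborel. 0 \<le> fst z \<and> fst z < T \<and> snd z \<in> Q i \<longrightarrow>
      F z = \<alpha> i * time_deriv T \<phi> z + \<beta> i * (cvec (W i z) \<bullet> grad \<phi> z)"
    and G: "\<And>i. i < n \<Longrightarrow> AE x in lborel. x \<in> Q i \<longrightarrow> G x = \<alpha> i * \<phi> (0, x)"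
  shows "weak_balance T \<Omega> F G"
proof -
  obtain \<phi>' K where der: "\<And>z. z \<in> space_time T UNIV \<Longrightarrow> (\<phi> has_derivative \<phi>' z) (at z within space_time T UNIV)"
    and cont: "\<And>v. continuous_on (space_time T UNIV) (\<lambda>z. \<phi>' z v)"
    and K: "compact K" "K \<subseteq> space_time T UNIV" and 0: "\<And>z. z \<in> space_time T UNIV - K \<Longrightarrow> \<phi> z = 0"
    using test_functionE[OF test] by blast
  define f f' where "f = (\<lambda>z. if fst z < T then \<phi> z else 0)" and "f' = (\<lambda>z v. if fst z < T then \<phi>' z v else 0)"
  have t: "c1_test f f'" unfolding f_def f'_def by (rule c1_test_extend[OF T der cont K 0])
  define A where "A = (\<lambda>i z. indicator (Q i) (snd z) * (indicator half_space z * f' z (1, 0)))"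
  define C where "C = (\<lambda>i z. indicator half_space z * f' z (velocity_field (W i z, (W i z)\<^sup>2 / 2)))"
  note ti = c1_test_time_integral[OF t Q(1)]
  note pi = pairing_identities[OF t]
  have iA: "i < n \<Longrightarrow> integrable lborel (A i)" and iC: "i < n \<Longrightarrow> integrable lborel (C i)" for i
    unfolding A_def C_def using ti(1) pi(3) by auto
  have S: "z \<in> space_time T UNIV \<longleftrightarrow> 0 \<le> fst z \<and> fst z < T" for z :: stpoint by (auto simp: space_time_def mem_Times_iff)
  show ?thesis
  proof (rule weak_balance_intro[OF \<Omega>(1), where F' = "\<lambda>z. \<Sum>i<n. \<alpha> i * A i z + \<beta> i * C i z" and G' = "\<lambda>x. \<Sum>i<n. \<alpha> i * (indicator (Q i) x * f (0, x))"])
    show "integrable lborel (\<lambda>z. \<Sum>i<n. \<alpha> i * A i z + \<beta> i * C i z)"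
      by (intro Bochner_Integration.integrable_sum Bochner_Integration.integrable_add integrable_mult_right iA iC) auto
    show "integrable lborel (\<lambda>x. \<Sum>i<n. \<alpha> i * (indicator (Q i) x * f (0, x)))"
      by (intro Bochner_Integration.integrable_sum integrable_mult_right ti(2)) auto
    have "(LINT z|lborel. (\<Sum>i<n. \<alpha> i * A i z + \<beta> i * C i z)) = (\<Sum>i<n. \<alpha> i * (LINT z|lborel. A i z) + \<beta> i * (LINT z|lborel. C i z))"
      using iA iC by (subst Bochner_Integration.integral_sum) auto
    also have "\<dots> = (\<Sum>i<n. \<alpha> i * - (LINT x|lborel. indicator (Q i) x * f (0, x)))"
      unfolding A_def C_def using ti(3) pi(6) by (intro sum.cong) auto
    finally show "(LINT z|lborel. (\<Sum>i<n. \<alpha> i * A i z + \<beta> i * C i z)) + (LINT x|lborel. (\<Sum>i<n. \<alpha> i * (indicator (Q i) x * f (0, x)))) = 0"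
      using ti(2) by (subst (2) Bochner_Integration.integral_sum) (auto simp: sum_negf)
    have "AE x in lborel. \<forall>i\<in>{..<n}. x \<in> Q i \<longrightarrow> G x = \<alpha> i * \<phi> (0, x)"
      by (rule eventually_ball_finite) (use G in auto)
    then show "AE x in lborel. indicator \<Omega> x * G x = (\<Sum>i<n. \<alpha> i * (indicator (Q i) x * f (0, x)))"
      using AE_pieces
    proof eventually_elim
      case (elim x)
      show ?case
      proof (cases "x \<in> \<Omega>")
        case True
        then obtain i where i: "i < n" "x \<in> Q i" using elim(2) by blast
        have "(\<Sum>i<n. \<alpha> i * (indicator (Q i) x * f (0, x))) = \<alpha> i * (indicator (Q i) x * f (0, x))"
          by (rule only_piece[OF i]) simp
        then show ?thesis using elim(1) i True T by (simp add: f_def)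
      next
        case False
        then have "x \<notin> Q i" if "i < n" for i using Q(2)[OF that] by blast
        then show ?thesis using False by simp
      qed
    qed
    have "AE z in lborel. \<forall>i\<in>{..<n}. 0 \<le> fst z \<and> fst z < T \<and> snd z \<in> Q i \<longrightarrow>
      F z = \<alpha> i * time_deriv T \<phi> z + \<beta> i * (cvec (W i z) \<bullet> grad \<phi> z)"
      by (rule eventually_ball_finite) (use F in auto)
    then show "AE z in lborel. indicator (space_time T \<Omega>) z * F z = (\<Sum>i<n. \<alpha> i * A i z + \<beta> i * C i z)"
      using AE_lborel_snd[OF AE_pieces]
    proof eventually_elim
      case (elim z)
      have W0: "C i z = 0" if "i < n" "snd z \<notin> Q i" for i
      proof -
        have "(W i z, (W i z)\<^sup>2 / 2) = 0" using W(2)[of i z] that by (simp add: zero_prod_def)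
        then show ?thesis
          using linear_0[OF linear_fields(3)] linear_0[OF c1_test_D(2)[OF t, of z]]
          by (cases "z \<in> half_space") (simp_all add: C_def)
      qed
      show ?case
      proof (cases "z \<in> space_time T \<Omega>")
        case True
        then have z: "0 \<le> fst z" "fst z < T" "snd z \<in> \<Omega>" by (auto simp: space_time_def mem_Times_iff)
        then have zS: "z \<in> space_time T UNIV" using S by blast
        obtain i where i: "i < n" "snd z \<in> Q i" using elim(2) z(3) by blast
        have "(\<Sum>i<n. \<alpha> i * A i z + \<beta> i * C i z) = \<alpha> i * A i z + \<beta> i * C i z"
          by (rule only_piece[OF i]) (simp add: W0, simp add: A_def)
        also have "A i z = time_deriv T \<phi> z"
          using z i time_deriv_eq[OF der[OF zS] zS] by (simp add: A_def f'_def)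
        also have "C i z = cvec (W i z) \<bullet> grad \<phi> z"
          unfolding C_def using z c1_test_coords[OF t, of z "velocity_field (W i z, (W i z)\<^sup>2 / 2)"] space_deriv_eq[OF der[OF zS] zS]
          by (simp add: velocity_field_def f'_def grad_def inner_vec_def sum_2)
        finally show ?thesis using elim(1) i z True by simp
      next
        case False
        have "\<alpha> i * A i z + \<beta> i * C i z = 0" if i: "i < n" for i
        proof (cases "snd z \<in> Q i")
          case True
          then have "snd z \<in> \<Omega>" using Q(2)[OF i] by blast
          then have "fst z < 0 \<or> T \<le> fst z" using False by (auto simp: space_time_def mem_Times_iff)
          then show ?thesis by (auto simp: A_def C_def f'_def)
        qed (simp add: W0 i, simp add: A_def)
        then show ?thesis using False by simp
      qed
    qed
  qed
qed

text \<open>Splitting the tensor square into its trace-free part and |u|^2 / 2 times the identity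
  leaves r e + q in front of the divergence. As this is the same k on all pieces,
  \<open>space_time_divergence\<close> on the whole of \<Omega> removes it; on a single piece this
  would fail, since a test field need not be tangential to the interfaces.\<close>

lemma momentum_balance:
  assumes test: "test_function T \<Phi>" and tang: "tangential_on_boundary T \<Omega> \<Phi>"
    and F: "\<And>i. i < n \<Longrightarrow> AE z in lborel. 0 \<le> fst z \<and> fst z < T \<and> snd z \<in> Q i \<longrightarrow>
      F z = (r i *\<^sub>R cvec (W i z)) \<bullet> time_deriv T \<Phi> z + contract (r i *\<^sub>R outer (cvec (W i z)) (cvec (W i z))) (jacobi \<Phi> z)
        + q i * diverg \<Phi> z"
    and G: "\<And>i. i < n \<Longrightarrow> AE x in lborel. x \<in> Q i \<longrightarrow> G x = (r i *\<^sub>R cvec (U0 i x)) \<bullet> \<Phi> (0, x)"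
    and total: "\<And>i. i < n \<Longrightarrow> r i * e i + q i = k"
  shows "weak_balance T \<Omega> F G"
proof -
  obtain \<Phi>' K where der: "\<And>z. z \<in> space_time T UNIV \<Longrightarrow> (\<Phi> has_derivative \<Phi>' z) (at z within space_time T UNIV)"
    and cont: "\<And>v. continuous_on (space_time T UNIV) (\<lambda>z. \<Phi>' z v)"
    and K: "compact K" "K \<subseteq> space_time T UNIV" and 0: "\<And>z. z \<in> space_time T UNIV - K \<Longrightarrow> \<Phi> z = 0"
    using test_functionE[OF test] by blast
  define f f' where "f = (\<lambda>j z. if fst z < T then \<Phi> z $ j else 0)" and "f' = (\<lambda>j z v. if fst z < T then \<Phi>' z v $ j else 0)"
  have t: "c1_test (f j) (f' j)" for j unfolding f_def f'_def by (rule c1_test_component[OF T der cont K 0])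
  define A where "A = (\<lambda>i z. indicator half_space z * f' 1 z (momentum1_field (W i z, (W i z)\<^sup>2 / 2)))"
  define B where "B = (\<lambda>i z. indicator half_space z * f' 2 z (momentum2_field (W i z, (W i z)\<^sup>2 / 2)))"
  define dv where "dv = (\<lambda>z. indicator \<Omega> (snd z) * (indicator half_space z *
    (if fst z < T then \<Phi>' z (0, axis 1 1) $ 1 + \<Phi>' z (0, axis 2 1) $ 2 else 0)))"
  have dv: "integrable lborel dv" "(LINT z|lborel. dv z) = 0"
    using space_time_divergence[OF \<Omega> T der cont K 0 tang] unfolding dv_def by blast+
  note p1 = pairing_identities[OF t[of 1]] note p2 = pairing_identities[OF t[of 2]]
  note u1 = integrable_U0_terms[OF t[of 1]] note u2 = integrable_U0_terms[OF t[of 2]]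
  have iA: "i < n \<Longrightarrow> integrable lborel (A i)" and iB: "i < n \<Longrightarrow> integrable lborel (B i)" for i
    unfolding A_def B_def using p1(1) p2(2) by auto
  define g where "g = (\<lambda>i x. Re (U0 i x) * f 1 (0, x) + Im (U0 i x) * f 2 (0, x))"
  have ig: "i < n \<Longrightarrow> integrable lborel (g i)" for i
    unfolding g_def using u1(1) u2(2) by (intro Bochner_Integration.integrable_add) auto
  have S: "z \<in> space_time T UNIV \<longleftrightarrow> 0 \<le> fst z \<and> fst z < T" for z :: stpoint by (auto simp: space_time_def mem_Times_iff)
  show ?thesis
  proof (rule weak_balance_intro[OF \<Omega>(1), where F' = "\<lambda>z. (\<Sum>i<n. r i * (A i z + B i z)) + k * dv z" and G' = "\<lambda>x. \<Sum>i<n. r i * g i x"])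
    show "integrable lborel (\<lambda>z. (\<Sum>i<n. r i * (A i z + B i z)) + k * dv z)"
      by (intro Bochner_Integration.integrable_sum Bochner_Integration.integrable_add integrable_mult_right iA iB dv) auto
    show "integrable lborel (\<lambda>x. \<Sum>i<n. r i * g i x)"
      by (intro Bochner_Integration.integrable_sum integrable_mult_right ig) auto
    have iAB: "integrable lborel (\<lambda>z. \<Sum>i<n. r i * (A i z + B i z))"
      by (intro Bochner_Integration.integrable_sum Bochner_Integration.integrable_add integrable_mult_right iA iB) auto
    have "(LINT z|lborel. (\<Sum>i<n. r i * (A i z + B i z)) + k * dv z) = (LINT z|lborel. (\<Sum>i<n. r i * (A i z + B i z))) + k * (LINT z|lborel. dv z)"
      using iAB dv(1) by simp
    also have "\<dots> = (\<Sum>i<n. r i * ((LINT z|lborel. A i z) + (LINT z|lborel. B i z)))"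
      using iA iB dv(2) by (subst Bochner_Integration.integral_sum) auto
    also have "\<dots> = (\<Sum>i<n. r i * - (LINT x|lborel. g i x))"
    proof (intro sum.cong refl)
      fix i assume "i \<in> {..<n}"
      then have i: "i < n" by simp
      have "(LINT x|lborel. g i x) = (LINT x|lborel. Re (U0 i x) * f 1 (0, x)) + (LINT x|lborel. Im (U0 i x) * f 2 (0, x))"
        unfolding g_def by (rule Bochner_Integration.integral_add[OF u1(1)[OF i] u2(2)[OF i]])
      then show "r i * ((LINT z|lborel. A i z) + (LINT z|lborel. B i z)) = r i * - (LINT x|lborel. g i x)"
        using p1(4)[OF i] p2(5)[OF i] unfolding A_def B_def by simp
    qed
    moreover have "(LINT x|lborel. (\<Sum>i<n. r i * g i x)) = (\<Sum>i<n. r i * (LINT x|lborel. g i x))"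
      using ig by (subst Bochner_Integration.integral_sum) auto
    ultimately show "(LINT z|lborel. (\<Sum>i<n. r i * (A i z + B i z)) + k * dv z) + (LINT x|lborel. (\<Sum>i<n. r i * g i x)) = 0"
      by (simp add: sum_negf)
    have "AE x in lborel. \<forall>i\<in>{..<n}. x \<in> Q i \<longrightarrow> G x = (r i *\<^sub>R cvec (U0 i x)) \<bullet> \<Phi> (0, x)"
      by (rule eventually_ball_finite) (use G in auto)
    then show "AE x in lborel. indicator \<Omega> x * G x = (\<Sum>i<n. r i * g i x)"
      using AE_pieces
    proof eventually_elim
      case (elim x)
      have g0: "g i x = 0" if "i < n" "x \<notin> Q i" for i using U0(2)[OF that] by (simp add: g_def)
      show ?case
      proof (cases "x \<in> \<Omega>")
        case True
        then obtain i where i: "i < n" "x \<in> Q i" using elim(2) by blast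
        have "(\<Sum>i<n. r i * g i x) = r i * g i x"
          by (rule only_piece[OF i]) (simp add: g0)
        then show ?thesis using elim(1) i True T by (simp add: f_def g_def inner_vec_def sum_2 algebra_simps)
      next
        case False
        then have "x \<notin> Q i" if "i < n" for i using Q(2)[OF that] by blast
        then show ?thesis using False g0 by simp
      qed
    qed
    have FF: "AE z in lborel. \<forall>i\<in>{..<n}. 0 \<le> fst z \<and> fst z < T \<and> snd z \<in> Q i \<longrightarrow>
      F z = (r i *\<^sub>R cvec (W i z)) \<bullet> time_deriv T \<Phi> z + contract (r i *\<^sub>R outer (cvec (W i z)) (cvec (W i z))) (jacobi \<Phi> z)
        + q i * diverg \<Phi> z"
      by (rule eventually_ball_finite) (use F in auto)
    have NN: "AE z in lborel. \<forall>i\<in>{..<n}. 0 \<le> fst z \<and> fst z < T \<and> snd z \<in> Q i \<longrightarrow> (norm (W i z))\<^sup>2 = 2 * e i"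
      by (rule eventually_ball_finite) (use W(3) in auto)
    show "AE z in lborel. indicator (space_time T \<Omega>) z * F z = (\<Sum>i<n. r i * (A i z + B i z)) + k * dv z"
      using FF NN AE_lborel_snd[OF AE_pieces]
    proof eventually_elim
      case (elim z)
      have AB0: "A i z + B i z = 0" if "i < n" "snd z \<notin> Q i" for i
      proof -
        have "(W i z, (W i z)\<^sup>2 / 2) = 0" using W(2)[of i z] that by (simp add: zero_prod_def)
        then show ?thesis
          using linear_0[OF linear_fields(1)] linear_0[OF linear_fields(2)]
            linear_0[OF c1_test_D(2)[OF t[of 1], of z]] linear_0[OF c1_test_D(2)[OF t[of 2], of z]]
          by (cases "z \<in> half_space") (simp_all add: A_def B_def)
      qed
      show ?case
      proof (cases "z \<in> space_time T \<Omega>")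
        case True
        then have z: "0 \<le> fst z" "fst z < T" "snd z \<in> \<Omega>" by (auto simp: space_time_def mem_Times_iff)
        then have zS: "z \<in> space_time T UNIV" using S by blast
        obtain i where i: "i < n" "snd z \<in> Q i" using elim(3) z(3) by blast
        define x y where "x = Re (W i z)" and "y = Im (W i z)"
        have xy: "x\<^sup>2 + y\<^sup>2 = 2 * e i" using elim(2) i z by (auto simp: x_def y_def cmod_power2)
        define t1 t2 where "t1 = \<Phi>' z (1, 0) $ 1" and "t2 = \<Phi>' z (1, 0) $ 2"
        define d11 d12 d21 d22 where "d11 = \<Phi>' z (0, axis 1 1) $ 1" and "d12 = \<Phi>' z (0, axis 2 1) $ 1"
          and "d21 = \<Phi>' z (0, axis 1 1) $ 2" and "d22 = \<Phi>' z (0, axis 2 1) $ 2"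
        have E1: "(\<Sum>i<n. r i * (A i z + B i z)) = r i * (A i z + B i z)"
          by (rule only_piece[OF i]) (simp add: AB0)
        have EA: "A i z = x * t1 + (x\<^sup>2 - y\<^sup>2) / 2 * d11 + x * y * d12"
          unfolding A_def using z c1_test_coords[OF t[of 1], of z "momentum1_field (W i z, (W i z)\<^sup>2 / 2)"]
          by (simp add: momentum1_field_def f'_def Re_power2 Im_power2 x_def y_def t1_def d11_def d12_def)
        have EB: "B i z = y * t2 + x * y * d21 - (x\<^sup>2 - y\<^sup>2) / 2 * d22"
          unfolding B_def using z c1_test_coords[OF t[of 2], of z "momentum2_field (W i z, (W i z)\<^sup>2 / 2)"]
          by (simp add: momentum2_field_def f'_def Re_power2 Im_power2 x_def y_def t2_def d21_def d22_def)
        have ED: "dv z = d11 + d22" using z by (simp add: dv_def d11_def d22_def)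
        have sd: "space_deriv j (\<lambda>w. \<Phi> w $ l) z = \<Phi>' z (0, axis j 1) $ l" for j l
          by (rule space_deriv_eq[OF bounded_linear.has_derivative[OF bounded_linear_vec_nth der[OF zS]] zS])
        have td: "time_deriv T \<Phi> z = \<Phi>' z (1, 0)" by (rule time_deriv_eq[OF der[OF zS] zS])
        have EF: "F z = r i * (x * t1 + y * t2) + r i * (x * x * d11 + x * y * d12 + y * x * d21 + y * y * d22) + q i * (d11 + d22)"
          using elim(1) i z
          by (simp add: td sd contract_def outer_def jacobi_def diverg_def inner_vec_def sum_2 x_def y_def t1_def t2_def d11_def d12_def d21_def d22_def algebra_simps)
        \<comment> \<open>Here the full energy enters: |u|^2 / 2 equals the prescribed level e i
          almost everywhere, so the isotropic stress is exactly k.\<close>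
        have EK: "k = r i * ((x\<^sup>2 + y\<^sup>2) / 2) + q i" using total[OF i(1)] xy by simp
        have "F z = r i * (A i z + B i z) + k * dv z"
          unfolding EF EA EB ED EK by (simp add: power2_eq_square field_simps)
        then show ?thesis using True E1 by simp
      next
        case False
        have "r i * (A i z + B i z) = 0" if i: "i < n" for i
        proof (cases "snd z \<in> Q i")
          case True
          then have "snd z \<in> \<Omega>" using Q(2)[OF i] by blast
          then have "fst z < 0 \<or> T \<le> fst z" using False by (auto simp: space_time_def mem_Times_iff)
          then show ?thesis by (auto simp: A_def B_def f'_def)
        qed (simp add: AB0 i)
        then have "(\<Sum>i<n. r i * (A i z + B i z)) = 0" by (intro sum.neutral ballI) blast
        moreover have "dv z = 0" using False by (auto simp: dv_def space_time_def mem_Times_iff indicator_def)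
        ultimately show ?thesis using False by simp
      qed
    qed
  qed
qed

end


theorem corollary3p2:
  fixes T :: real and \<Omega> :: "(real^2) set" and p :: "real \<Rightarrow> real"
    and \<rho>0 b0 :: "real^2 \<Rightarrow> real"
  assumes "T > 0"
    and "open \<Omega>" and "connected \<Omega>" and "\<Omega> \<noteq> {}" and "bounded \<Omega>"
    and "\<And>r. r > 0 \<Longrightarrow> p r > 0"
    and "L_infty (lebesgue_on \<Omega>) \<rho>0" and "AE x in lebesgue_on \<Omega>. \<rho>0 x > 0"
    and "L_infty (lebesgue_on \<Omega>) b0"
    and "piecewise_constant \<Omega> \<rho>0 b0"
  shows "\<exists>u0 :: real^2 \<Rightarrow> real^2. L_infty (lebesgue_on \<Omega>) u0 \<and>
    (\<exists>S. infinite S \<and> pairwise (\<lambda>s s'. \<not> same_state T \<Omega> s s') S \<and>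
      (\<forall>(\<rho>, u, b) \<in> S.
         weak_solution p T \<Omega> \<rho>0 u0 b0 \<rho> u b \<and>
         energy_conserving p T \<Omega> \<rho>0 u0 b0 \<rho> u b \<and>
         (AE z in lebesgue_on (space_time T \<Omega>). \<rho> z = \<rho>0 (snd z) \<and> b z = b0 (snd z))))"
proof -
  obtain n Q and \<rho>c bc :: "nat \<Rightarrow> real" where
    "(\<forall>i<n. open (Q i) \<and> Q i \<subseteq> \<Omega>) \<and> disjoint_family_on Q {..<n} \<and>
     \<Omega> = (\<Union>i<n. closure (Q i) \<inter> \<Omega>) \<and> negligible (\<Omega> - (\<Union>i<n. Q i)) \<and>
     (\<forall>i<n. \<rho>c i > 0 \<and> (AE x in lebesgue_on (Q i). \<rho>0 x = \<rho>c i) \<and> (AE x in lebesgue_on (Q i). b0 x = bc i))"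
    using assms(10) unfolding piecewise_constant_def by (elim exE) (rule that)
  then have Qo: "\<And>i. i < n \<Longrightarrow> open (Q i)" "\<And>i. i < n \<Longrightarrow> Q i \<subseteq> \<Omega>"
    and disj: "disjoint_family_on Q {..<n}" and cl: "\<Omega> = (\<Union>i<n. closure (Q i) \<inter> \<Omega>)"
    and neg: "negligible (\<Omega> - (\<Union>i<n. Q i))" and \<rho>c: "\<And>i. i < n \<Longrightarrow> \<rho>c i > 0"
    and ae: "\<And>i. i < n \<Longrightarrow> AE x in lebesgue_on (Q i). \<rho>0 x = \<rho>c i" "\<And>i. i < n \<Longrightarrow> AE x in lebesgue_on (Q i). b0 x = bc i"
    by auto

  \<comment> \<open>Energy levels of the pieces\<close>
  define q where "q = (\<lambda>i. p (\<rho>c i) + (bc i)\<^sup>2 / 2)"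
  \<comment> \<open>The q i are nonnegative, so their sum is at least each of them, and the 1 makes
    the excess strict; hence every energy level (k - q i) / \<rho>c i is positive.\<close>
  define k where "k = 1 + (\<Sum>i<n. q i)"
  define e where "e = (\<lambda>i. (k - q i) / \<rho>c i)"
  have q0: "q i \<ge> 0" if "i < n" for i
    using assms(6)[OF \<rho>c[OF that]] zero_le_power2[of "bc i"] unfolding q_def by linarith
  have qk: "q i < k" if "i < n" for i
    using member_le_sum[of i "{..<n}" q] q0 that unfolding k_def by simp
  have e0: "e i > 0" if "i < n" for i using qk[OF that] \<rho>c[OF that] by (simp add: e_def)
  have total: "\<rho>c i * e i + q i = k" if "i < n" for i using \<rho>c[OF that] by (simp add: e_def)
  have Qb: "bounded (Q i)" if "i < n" for i by (rule bounded_subset[OF assms(5) Qo(2)[OF that]])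
  define R where "R = (\<lambda>i U v. U \<in> borel_measurable lborel \<and> (\<forall>x. x \<notin> Q i \<longrightarrow> U x = 0) \<and>
    (AE x in lborel. x \<in> Q i \<longrightarrow> (norm (U x))\<^sup>2 = 2 * e i) \<and>
    (\<forall>j::nat. v j \<in> borel_measurable lborel) \<and> (\<forall>j z. snd z \<notin> Q i \<or> T \<le> fst z \<longrightarrow> v j z = 0) \<and>
    (\<forall>j. AE z in lborel. 0 \<le> fst z \<and> fst z < T \<and> snd z \<in> Q i \<longrightarrow> (norm (v j z))\<^sup>2 = 2 * e i) \<and>
    (\<forall>j. weak_euler (v j) U) \<and>
    (\<forall>j l. Q i \<noteq> {} \<longrightarrow> j \<noteq> l \<longrightarrow> \<not> (AE z in lborel. z \<in> {0..<T} \<times> Q i \<longrightarrow> v j z = v l z)))"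
  have "\<exists>U v. R i U v" if i: "i < n" for i
    unfolding R_def by (rule wild_euler_family[OF Qo(1)[OF i] Qb[OF i] e0[OF i] assms(1)]) blast
  then obtain U v where "\<And>i. i < n \<Longrightarrow> R i (U i) (v i)" by metis
  then have U: "\<And>i. i < n \<Longrightarrow> U i \<in> borel_measurable lborel" "\<And>i x. i < n \<Longrightarrow> x \<notin> Q i \<Longrightarrow> U i x = 0"
      "\<And>i. i < n \<Longrightarrow> AE x in lborel. x \<in> Q i \<longrightarrow> (norm (U i x))\<^sup>2 = 2 * e i"
    and v: "\<And>i j. i < n \<Longrightarrow> v i j \<in> borel_measurable lborel" "\<And>i j z. i < n \<Longrightarrow> snd z \<notin> Q i \<or> T \<le> fst z \<Longrightarrow> v i j z = 0"
      "\<And>i j. i < n \<Longrightarrow> AE z in lborel. 0 \<le> fst z \<and> fst z < T \<and> snd z \<in> Q i \<longrightarrow> (norm (v i j z))\<^sup>2 = 2 * e i"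
      "\<And>i j. i < n \<Longrightarrow> weak_euler (v i j) (U i)"
    and vdist: "\<And>i j l. i < n \<Longrightarrow> Q i \<noteq> {} \<Longrightarrow> j \<noteq> l \<Longrightarrow> \<not> (AE z in lborel. z \<in> {0..<T} \<times> Q i \<longrightarrow> v i j z = v i l z)"
    unfolding R_def by blast+
  have wp: "wild_pieces T \<Omega> n Q e (\<lambda>i. v i j) U" for j
    by (unfold_locales; (rule assms disj neg; assumption)?; (rule Qo e0 U v; assumption)?)
  interpret P: wild_pieces T \<Omega> n Q e "\<lambda>i. v i 0" U by (rule wp)
  \<comment> \<open>The same index j is used on all pieces at once, which gives one sequence of
    velocities with a datum that does not depend on j.\<close>
  define u where "u = (\<lambda>j. wild_pieces.vel n (\<lambda>i. v i j))"
  define u0 where "u0 = P.vel0"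
  define \<rho> b where "\<rho> = (\<lambda>z::stpoint. P.step_fun \<rho>c (snd z))" and "b = (\<lambda>z::stpoint. P.step_fun bc (snd z))"
  have up: "u j z = cvec (v i j z)" if "i < n" "snd z \<in> Q i" for i j z
    unfolding u_def by (rule wild_pieces.vel_piece[OF wp that])
  have u0p: "u0 x = cvec (U i x)" if "i < n" "x \<in> Q i" for i x
    unfolding u0_def by (rule P.vel0_piece[OF that])
  have \<rho>p: "\<rho> z = \<rho>c i" and bp: "b z = bc i" if "i < n" "snd z \<in> Q i" for i z
    unfolding \<rho>_def b_def using P.step_fun_piece[OF that] by auto
  have QS: "Q i \<inter> space lebesgue \<in> sets lebesgue" if "i < n" for i using Qo(1)[OF that] by simp
  have \<rho>0p: "AE x in lborel. x \<in> Q i \<longrightarrow> \<rho>0 x = \<rho>c i" and b0p: "AE x in lborel. x \<in> Q i \<longrightarrow> b0 x = bc i" if "i < n" for i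
    using ae[OF that] unfolding AE_restrict_space_iff[OF QS[OF that]] AE_completion_iff by auto
  have st: "space_time T \<Omega> \<in> sets borel" by (rule space_time_borel[OF assms(2)])
  have stS: "space_time T \<Omega> \<inter> space lebesgue \<in> sets lebesgue" using st by simp
  have pieces: "AE z::stpoint in lborel. snd z \<in> \<Omega> \<longrightarrow> (\<exists>i<n. snd z \<in> Q i)"
    by (rule AE_lborel_snd[OF P.AE_pieces])
  have pwm: "(\<lambda>z::stpoint. P.step_fun c (snd z)) \<in> borel_measurable lborel" for c
  proof -
    have "open {z::stpoint. snd z \<in> Q i}" if "i < n" for i
      using open_vimage_snd[OF Qo(1)[OF that]] by (simp add: vimage_def)
    then have "(\<lambda>z::stpoint. \<Sum>i<n. indicator {z::stpoint. snd z \<in> Q i} z * c i) \<in> borel_measurable lborel"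
      by (intro borel_measurable_sum borel_measurable_times borel_measurable_indicator) auto
    moreover have "(\<lambda>z::stpoint. P.step_fun c (snd z)) = (\<lambda>z::stpoint. \<Sum>i<n. indicator {z::stpoint. snd z \<in> Q i} z * c i)"
      by (auto simp: P.step_fun_def fun_eq_iff indicator_def intro!: sum.cong)
    ultimately show ?thesis by simp
  qed
  have L_pw: "L_infty (lebesgue_on (space_time T \<Omega>)) (\<lambda>z. P.step_fun c (snd z))" for c
  proof (rule L_infty_lebesgue_on[OF st pwm])
    show "AE z in lborel. z \<in> space_time T \<Omega> \<longrightarrow> norm (P.step_fun c (snd z)) \<le> (\<Sum>i<n. \<bar>c i\<bar>)"
    proof (intro AE_I2 impI)
      fix z :: stpoint
      have "norm (P.step_fun c (snd z)) \<le> (\<Sum>i<n. norm (indicator (Q i) (snd z) * c i))"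
        unfolding P.step_fun_def by (rule norm_sum)
      also have "\<dots> \<le> (\<Sum>i<n. \<bar>c i\<bar>)" by (intro sum_mono) (auto simp: indicator_def)
      finally show "norm (P.step_fun c (snd z)) \<le> (\<Sum>i<n. \<bar>c i\<bar>)" .
    qed
  qed
  have un: "AE z in lborel. \<forall>i\<in>{..<n}. 0 \<le> fst z \<and> fst z < T \<and> snd z \<in> Q i \<longrightarrow> (norm (v i j z))\<^sup>2 = 2 * e i" for j
    by (rule eventually_ball_finite) (use v(3) in auto)
  have bound: "sqrt (2 * e i) \<le> (\<Sum>i<n. sqrt (2 * e i))" if "i < n" for i
    using that e0 by (intro member_le_sum) (auto simp: less_imp_le)
  have L_u: "L_infty (lebesgue_on (space_time T \<Omega>)) (u j)" for j
  proof (rule L_infty_lebesgue_on[OF st])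
    show "u j \<in> borel_measurable lborel"
      unfolding u_def wild_pieces.vel_def[OF wp, abs_def]
      by (intro measurable_cvec borel_measurable_sum) (use v(1) in auto)
    show "AE z in lborel. z \<in> space_time T \<Omega> \<longrightarrow> norm (u j z) \<le> (\<Sum>i<n. sqrt (2 * e i))"
      using un[of j] pieces
    proof eventually_elim
      case (elim z)
      show ?case
      proof
        assume z: "z \<in> space_time T \<Omega>"
        then obtain i where i: "i < n" "snd z \<in> Q i" using elim(2) by (auto simp: space_time_def)
        then have "norm (v i j z) \<le> sqrt (2 * e i)"
          using elim(1) z by (intro real_le_rsqrt) (auto simp: space_time_def mem_Times_iff)
        then show "norm (u j z) \<le> (\<Sum>i<n. sqrt (2 * e i))" using bound[OF i(1)] up[OF i] by (simp add: norm_cvec)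
      qed
    qed
  qed
  have L_u0: "L_infty (lebesgue_on \<Omega>) u0"
  proof (rule L_infty_lebesgue_on[OF borel_open[OF assms(2)]])
    show "u0 \<in> borel_measurable lborel"
      unfolding u0_def P.vel0_def[abs_def]
      by (intro measurable_cvec borel_measurable_sum) (use U(1) in auto)
    have "AE x in lborel. \<forall>i\<in>{..<n}. x \<in> Q i \<longrightarrow> (norm (U i x))\<^sup>2 = 2 * e i"
      by (rule eventually_ball_finite) (use U(3) in auto)
    then show "AE x in lborel. x \<in> \<Omega> \<longrightarrow> norm (u0 x) \<le> (\<Sum>i<n. sqrt (2 * e i))"
      using P.AE_pieces
    proof eventually_elim
      case (elim x)
      show ?case
      proof
        assume "x \<in> \<Omega>"
        then obtain i where i: "i < n" "x \<in> Q i" using elim(2) by auto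
        then have "norm (U i x) \<le> sqrt (2 * e i)" using elim(1) by (intro real_le_rsqrt) auto
        then show "norm (u0 x) \<le> (\<Sum>i<n. sqrt (2 * e i))" using bound[OF i(1)] u0p[OF i] by (simp add: norm_cvec)
      qed
    qed
  qed

  \<comment> \<open>Verification of the balance laws\<close>
  have weak: "weak_solution p T \<Omega> \<rho>0 u0 b0 \<rho> (u j) b" for j
    unfolding weak_solution_def
  proof (intro conjI allI impI)
    show "L_infty (lebesgue_on (space_time T \<Omega>)) \<rho>" "L_infty (lebesgue_on (space_time T \<Omega>)) b"
      unfolding \<rho>_def b_def by (rule L_pw)+
    show "L_infty (lebesgue_on (space_time T \<Omega>)) (u j)" by (rule L_u)
    show "AE z in lebesgue_on (space_time T \<Omega>). 0 < \<rho> z"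
      unfolding AE_restrict_space_iff[OF stS] AE_completion_iff
      using pieces by (rule eventually_mono) (use \<rho>p \<rho>c in \<open>auto simp: space_time_def\<close>)
  next
    fix \<phi> :: "stpoint \<Rightarrow> real" assume \<phi>: "test_function T \<phi>"
    show "weak_balance T \<Omega> (\<lambda>z. \<rho> z * time_deriv T \<phi> z + (\<rho> z *\<^sub>R u j z) \<bullet> grad \<phi> z) (\<lambda>x. \<rho>0 x * \<phi> (0, x))"
    proof (rule wild_pieces.scalar_balance[OF wp \<phi>, where \<alpha> = \<rho>c and \<beta> = \<rho>c])
      fix i assume i: "i < n"
      show "AE z in lborel. 0 \<le> fst z \<and> fst z < T \<and> snd z \<in> Q i \<longrightarrow>
        \<rho> z * time_deriv T \<phi> z + (\<rho> z *\<^sub>R u j z) \<bullet> grad \<phi> z = \<rho>c i * time_deriv T \<phi> z + \<rho>c i * (cvec (v i j z) \<bullet> grad \<phi> z)"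
        by (intro AE_I2) (simp add: \<rho>p[OF i] up[OF i])
      show "AE x in lborel. x \<in> Q i \<longrightarrow> \<rho>0 x * \<phi> (0, x) = \<rho>c i * \<phi> (0, x)"
        using \<rho>0p[OF i] by (rule eventually_mono) simp
    qed
    show "weak_balance T \<Omega> (\<lambda>z. b z * time_deriv T \<phi> z + (b z *\<^sub>R u j z) \<bullet> grad \<phi> z) (\<lambda>x. b0 x * \<phi> (0, x))"
    proof (rule wild_pieces.scalar_balance[OF wp \<phi>, where \<alpha> = bc and \<beta> = bc])
      fix i assume i: "i < n"
      show "AE z in lborel. 0 \<le> fst z \<and> fst z < T \<and> snd z \<in> Q i \<longrightarrow>
        b z * time_deriv T \<phi> z + (b z *\<^sub>R u j z) \<bullet> grad \<phi> z = bc i * time_deriv T \<phi> z + bc i * (cvec (v i j z) \<bullet> grad \<phi> z)"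
        by (intro AE_I2) (simp add: bp[OF i] up[OF i])
      show "AE x in lborel. x \<in> Q i \<longrightarrow> b0 x * \<phi> (0, x) = bc i * \<phi> (0, x)"
        using b0p[OF i] by (rule eventually_mono) simp
    qed
  next
    fix \<Phi> :: "stpoint \<Rightarrow> real^2" assume \<Phi>: "test_function T \<Phi> \<and> tangential_on_boundary T \<Omega> \<Phi>"
    show "weak_balance T \<Omega>
        (\<lambda>z. (\<rho> z *\<^sub>R u j z) \<bullet> time_deriv T \<Phi> z + contract (\<rho> z *\<^sub>R outer (u j z) (u j z)) (jacobi \<Phi> z)
           + (p (\<rho> z) + (b z)\<^sup>2 / 2) * diverg \<Phi> z)
        (\<lambda>x. (\<rho>0 x *\<^sub>R u0 x) \<bullet> \<Phi> (0, x))"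
    proof (rule wild_pieces.momentum_balance[OF wp, where r = \<rho>c and q = q and k = k])
      fix i assume i: "i < n"
      show "AE z in lborel. 0 \<le> fst z \<and> fst z < T \<and> snd z \<in> Q i \<longrightarrow>
        (\<rho> z *\<^sub>R u j z) \<bullet> time_deriv T \<Phi> z + contract (\<rho> z *\<^sub>R outer (u j z) (u j z)) (jacobi \<Phi> z)
           + (p (\<rho> z) + (b z)\<^sup>2 / 2) * diverg \<Phi> z
        = (\<rho>c i *\<^sub>R cvec (v i j z)) \<bullet> time_deriv T \<Phi> z + contract (\<rho>c i *\<^sub>R outer (cvec (v i j z)) (cvec (v i j z))) (jacobi \<Phi> z)
           + q i * diverg \<Phi> z"
        by (intro AE_I2) (simp add: \<rho>p[OF i] bp[OF i] up[OF i] q_def)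
      show "AE x in lborel. x \<in> Q i \<longrightarrow> (\<rho>0 x *\<^sub>R u0 x) \<bullet> \<Phi> (0, x) = (\<rho>c i *\<^sub>R cvec (U i x)) \<bullet> \<Phi> (0, x)"
        using \<rho>0p[OF i] by (rule eventually_mono) (simp add: u0p[OF i])
    qed (use \<Phi> total in auto)
  qed
  have energy: "energy_conserving p T \<Omega> \<rho>0 u0 b0 \<rho> (u j) b" for j
    unfolding energy_conserving_def
  proof (intro allI impI)
    fix \<phi> :: "stpoint \<Rightarrow> real" assume \<phi>: "test_function T \<phi>"
    \<comment> \<open>With |u|^2 / 2 = e i the energy density and the factor of u in the energy flux
      are constants on each piece, and the datum has the same energy density.\<close>
    define E where "E = (\<lambda>i. \<rho>c i * e i + pressure_potential p (\<rho>c i) + (bc i)\<^sup>2 / 2)"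
    define F where "F = (\<lambda>i. \<rho>c i * e i + pressure_potential p (\<rho>c i) + p (\<rho>c i) + (bc i)\<^sup>2)"
    show "weak_balance T \<Omega>
      (\<lambda>z. (\<rho> z * (norm (u j z))\<^sup>2 / 2 + pressure_potential p (\<rho> z) + (b z)\<^sup>2 / 2) * time_deriv T \<phi> z
         + (\<rho> z * (norm (u j z))\<^sup>2 / 2 + pressure_potential p (\<rho> z) + p (\<rho> z) + (b z)\<^sup>2) * (u j z \<bullet> grad \<phi> z))
      (\<lambda>x. (\<rho>0 x * (norm (u0 x))\<^sup>2 / 2 + pressure_potential p (\<rho>0 x) + (b0 x)\<^sup>2 / 2) * \<phi> (0, x))"
    proof (rule wild_pieces.scalar_balance[OF wp \<phi>, where \<alpha> = E and \<beta> = F])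
      fix i assume i: "i < n"
      show "AE z in lborel. 0 \<le> fst z \<and> fst z < T \<and> snd z \<in> Q i \<longrightarrow>
        (\<rho> z * (norm (u j z))\<^sup>2 / 2 + pressure_potential p (\<rho> z) + (b z)\<^sup>2 / 2) * time_deriv T \<phi> z
         + (\<rho> z * (norm (u j z))\<^sup>2 / 2 + pressure_potential p (\<rho> z) + p (\<rho> z) + (b z)\<^sup>2) * (u j z \<bullet> grad \<phi> z)
        = E i * time_deriv T \<phi> z + F i * (cvec (v i j z) \<bullet> grad \<phi> z)"
        using v(3)[OF i, of j]
        by (rule eventually_mono) (simp add: \<rho>p[OF i] bp[OF i] up[OF i] norm_cvec E_def F_def)
      show "AE x in lborel. x \<in> Q i \<longrightarrow>
        (\<rho>0 x * (norm (u0 x))\<^sup>2 / 2 + pressure_potential p (\<rho>0 x) + (b0 x)\<^sup>2 / 2) * \<phi> (0, x) = E i * \<phi> (0, x)"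
        using \<rho>0p[OF i] b0p[OF i] U(3)[OF i]
        by eventually_elim (simp add: u0p[OF i] norm_cvec E_def)
    qed
  qed
  have stationary: "AE z in lebesgue_on (space_time T \<Omega>). \<rho> z = \<rho>0 (snd z) \<and> b z = b0 (snd z)"
  proof -
    have "AE x in lborel. \<forall>i\<in>{..<n}. x \<in> Q i \<longrightarrow> \<rho>0 x = \<rho>c i \<and> b0 x = bc i"
    proof (rule eventually_ball_finite)
      show "\<forall>i\<in>{..<n}. AE x in lborel. x \<in> Q i \<longrightarrow> \<rho>0 x = \<rho>c i \<and> b0 x = bc i"
      proof
        fix i assume "i \<in> {..<n}"
        then have i: "i < n" by simp
        show "AE x in lborel. x \<in> Q i \<longrightarrow> \<rho>0 x = \<rho>c i \<and> b0 x = bc i"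
          using \<rho>0p[OF i] b0p[OF i] by eventually_elim blast
      qed
    qed simp
    from AE_lborel_snd[OF this] pieces
    have "AE z::stpoint in lborel. z \<in> space_time T \<Omega> \<longrightarrow> \<rho> z = \<rho>0 (snd z) \<and> b z = b0 (snd z)"
    proof eventually_elim
      case (elim z)
      show ?case
      proof
        assume "z \<in> space_time T \<Omega>"
        then obtain i where i: "i < n" "snd z \<in> Q i" using elim(2) by (auto simp: space_time_def)
        then show "\<rho> z = \<rho>0 (snd z) \<and> b z = b0 (snd z)" using elim(1) \<rho>p[OF i] bp[OF i] by simp
      qed
    qed
    then show ?thesis unfolding AE_restrict_space_iff[OF stS] AE_completion_iff .
  qed
  \<comment> \<open>A nonempty piece exists because the closures of the pieces cover the nonempty
    \<Omega>; on it alone the velocities with different indices already differ.\<close>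
  obtain i0 where i0: "i0 < n" "Q i0 \<noteq> {}"
    using cl assms(4) by fastforce

  \<comment> \<open>Infinitely many distinct states\<close>
  have dist: "\<not> same_state T \<Omega> (\<rho>, u j, b) (\<rho>, u l, b)" if "j \<noteq> l" for j l
  proof
    assume "same_state T \<Omega> (\<rho>, u j, b) (\<rho>, u l, b)"
    then have "AE z in lborel. z \<in> space_time T \<Omega> \<longrightarrow> u j z = u l z"
      unfolding same_state_def prod.case AE_restrict_space_iff[OF stS] AE_completion_iff
      by (rule eventually_mono) blast
    then have "AE z in lborel. z \<in> {0..<T} \<times> Q i0 \<longrightarrow> v i0 j z = v i0 l z"
    proof (rule eventually_mono)
      fix z assume h: "z \<in> space_time T \<Omega> \<longrightarrow> u j z = u l z"
      show "z \<in> {0..<T} \<times> Q i0 \<longrightarrow> v i0 j z = v i0 l z"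
      proof
        assume z: "z \<in> {0..<T} \<times> Q i0"
        then have "z \<in> space_time T \<Omega>" "snd z \<in> Q i0"
          using Qo(2)[OF i0(1)] by (auto simp: space_time_def)
        then show "v i0 j z = v i0 l z" using h up[OF i0(1)] by (simp add: cvec_eq_iff)
      qed
    qed
    then show False using vdist[OF i0 that] by blast
  qed
  define S where "S = range (\<lambda>j. (\<rho>, u j, b))"
  have refl: "same_state T \<Omega> s s" for s by (cases s) (simp add: same_state_def)
  have "inj (\<lambda>j. (\<rho>, u j, b))"
  proof (rule injI, rule ccontr)
    fix j l assume "(\<rho>, u j, b) = (\<rho>, u l, b)" "j \<noteq> l"
    then show False using dist[of j l] refl by metis
  qed
  then have "infinite S" unfolding S_def by (rule range_inj_infinite)
  moreover have "pairwise (\<lambda>s s'. \<not> same_state T \<Omega> s s') S"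
  proof (rule pairwiseI)
    fix s s' assume "s \<in> S" "s' \<in> S" "s \<noteq> s'"
    then obtain j l where "s = (\<rho>, u j, b)" "s' = (\<rho>, u l, b)" "j \<noteq> l" unfolding S_def by auto
    then show "\<not> same_state T \<Omega> s s'" using dist by simp
  qed
  moreover have "\<forall>(\<rho>, u, b) \<in> S.
         weak_solution p T \<Omega> \<rho>0 u0 b0 \<rho> u b \<and>
         energy_conserving p T \<Omega> \<rho>0 u0 b0 \<rho> u b \<and>
         (AE z in lebesgue_on (space_time T \<Omega>). \<rho> z = \<rho>0 (snd z) \<and> b z = b0 (snd z))"
  proof (rule ballI)
    fix s assume "s \<in> S"
    then obtain j where "s = (\<rho>, u j, b)" unfolding S_def by blast
    then show "case s of (\<rho>, u, b) \<Rightarrow>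
         weak_solution p T \<Omega> \<rho>0 u0 b0 \<rho> u b \<and>
         energy_conserving p T \<Omega> \<rho>0 u0 b0 \<rho> u b \<and>
         (AE z in lebesgue_on (space_time T \<Omega>). \<rho> z = \<rho>0 (snd z) \<and> b z = b0 (snd z))"
      using weak energy stationary by simp
  qed
  ultimately show ?thesis using L_u0 by blast
qed

end
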